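(* Let $a\in\mathbb R$ with $a^2>2$, and let $\mathfrak p(t)=2(2-a^2)t^2-a^2$ and $$\mathcal W_a(t)=\frac{e^{-t^2}}{\mathfrak p^2(t)}\begin{pmatrix}\frac{a^2}{4(a^2-2)}\mathfrak p(t)^2+\frac{\mathfrak p(t)}{a^2-2}-a^2 & a\left(\frac{\mathfrak p(t)}{a^2-2}-2\right)t\\ a\left(\frac{\mathfrak p(t)}{a^2-2}-2\right)t& \frac{2(a^2(a^2-2)-\mathfrak p(t))}{(a^2-2)^2}\end{pmatrix},\quad t\in\mathbb R.$$ For each $\zeta\ge0$ there exist exceptional matrix polynomials $\mathcal P_{n,a,\zeta}$, $n\in\mathbb N\setminus\{1\}$, orthogonal with respect to the weight matrix $$\frac1{\sqrt\pi}\mathcal W_a(t)\,dt+\zeta\begin{pmatrix}0&0\\0&1\end{pmatrix}\delta_0$$ and eigenfunctions of the second order differential operator (which does not depend on $\zeta$) $\mathcal D(y)=y\mathcal F_0+y'\mathcal F_1+y''\mathcal F_2$, where $$\mathcal F_2(t)=\frac{1}{\mathfrak p(t)}\begin{pmatrix}-a^2(2t^2+1)& -(a^2-2)at(2t^2+1)\\ \frac{4at}{a^2-2} & 4t^2\end{pmatrix},$$ $$\mathcal F_1(t)=\frac{1}{\mathfrak p^2(t)}\begin{pmatrix}-2t(\mathfrak p^2(t)+4\mathfrak p(t)-4a^2) & \frac{4(a^2-2)t^2}{a}(-\mathfrak p(t)+2a^2)\\ \frac{4(\mathfrak p(t)+2a^2)(\mathfrak p(t)-a^2)}{a(a^2-2)}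 & -8a^2t\end{pmatrix},\qquad \mathcal F_0=\begin{pmatrix}2-\frac4{a^2}&0\\0&0\end{pmatrix}.$$
   Context: $\mathbb N=\{0,1,2,\dots\}$, $\delta_0$ is the Dirac mass at $0$, $*$ is (conjugate) transpose. A weight matrix is a positive definite matrix of measures on $\mathbb R$ with finite moments of every order. Exceptional matrix polynomials $Q_n$, $n\in\mathbb N\setminus X$ ($X$ finite), with respect to a weight matrix $\mathcal V$ and a second order operator $\mathcal D$: each $Q_n$ is a $2\times2$ matrix polynomial of degree $n$ with nonsingular leading coefficient; $\int Q_n\,d\mathcal V\,Q_k^*=0$ for $n\neq k$ and $\int Q_n\,d\mathcal V\,Q_n^*$ is positive definite; finite sums $\sum C_nQ_n$ ($C_n$ constant $2\times 2$ matrices) are dense in $L^2(\mathcal V)$, the space of $2\times2$ matrix functions $f$ with $\int\operatorname{tr}(f\,d\mathcal V f^* )<\infty$ modulo null functions; and $\mathcal D(Q_n)=\Gamma_nQ_n$ for constant matrices $\Gamma_n$. The coefficients of $\mathcal D$ multiply on the right. *)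

theory Defs
  imports "HOL-Analysis.Analysis"
begin

type_synonym cmat2 = "complex ^ 2 ^ 2"

definition mat22 :: "complex \<Rightarrow> complex \<Rightarrow> complex \<Rightarrow> complex \<Rightarrow> cmat2" where
  "mat22 a b c d = vector [vector [a, b], vector [c, d]]"

definition adj :: "cmat2 \<Rightarrow> cmat2" where
  "adj A = (\<chi> i j. cnj (A $ j $ i))"

definition quad_form :: "cmat2 \<Rightarrow> complex ^ 2 \<Rightarrow> complex" where
  "quad_form A v = (\<Sum>i\<in>UNIV. \<Sum>j\<in>UNIV. v $ i * A $ i $ j * cnj (v $ j))"

definition pos_semidef :: "cmat2 \<Rightarrow> bool" where
  "pos_semidef A \<longleftrightarrow> (\<forall>v. Im (quad_form A v) = 0 \<and> Re (quad_form A v) \<ge> 0)"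

definition pos_def :: "cmat2 \<Rightarrow> bool" where
  "pos_def A \<longleftrightarrow> (\<forall>v. v \<noteq> 0 \<longrightarrow> Im (quad_form A v) = 0 \<and> Re (quad_form A v) > 0)"


text \<open>
  A matrix of measures is a matrix-valued set function on the Borel sets of the line. By the
  usual convention it is called positive definite when its value on every Borel set is a positive
  semidefinite matrix (the value on the empty set is zero, and point masses may be singular).
\<close>

definition pos_matrix_measure :: "(real set \<Rightarrow> cmat2) \<Rightarrow> bool" where
  "pos_matrix_measure V \<longleftrightarrow>
     (\<forall>A \<in> sets borel. pos_semidef (V A)) \<and>
     (\<forall>A :: nat \<Rightarrow> real set. range A \<subseteq> sets borel \<longrightarrow> disjoint_family A \<longrightarrow>
        (\<lambda>i. V (A i)) sums V (\<Union>i. A i))"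

text \<open>
  Every entry of a positive definite matrix of measures is absolutely continuous with respect to
  its trace measure, so integrals against it are defined through the (almost everywhere unique)
  matrix density with respect to the trace measure.
\<close>

definition trace_measure :: "(real set \<Rightarrow> cmat2) \<Rightarrow> real measure" where
  "trace_measure V = measure_of UNIV (sets borel) (\<lambda>A. ennreal (Re (trace (V A))))"

definition is_trace_density :: "(real set \<Rightarrow> cmat2) \<Rightarrow> (real \<Rightarrow> cmat2) \<Rightarrow> bool" where
  "is_trace_density V \<Phi> \<longleftrightarrow>
     \<Phi> \<in> borel_measurable borel \<and> (\<forall>t. pos_semidef (\<Phi> t)) \<and>
     (\<forall>A \<in> sets borel. set_integrable (trace_measure V) A \<Phi> \<and>
        V A = set_lebesgue_integral (trace_measure V) A \<Phi>)"

definition trace_density :: "(real set \<Rightarrow> cmat2) \<Rightarrow> real \<Rightarrow> cmat2" where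
  "trace_density V = (SOME \<Phi>. is_trace_density V \<Phi>)"

definition weight_matrix :: "(real set \<Rightarrow> cmat2) \<Rightarrow> bool" where
  "weight_matrix V \<longleftrightarrow> pos_matrix_measure V \<and>
     (\<forall>n :: nat. integrable (trace_measure V) (\<lambda>t. t ^ n *\<^sub>R trace_density V t))"

text \<open>The matrix \<open>\<integral> f dV g\<^sup>*\<close>.\<close>

definition matrix_inner ::
    "(real set \<Rightarrow> cmat2) \<Rightarrow> (real \<Rightarrow> cmat2) \<Rightarrow> (real \<Rightarrow> cmat2) \<Rightarrow> cmat2" where
  "matrix_inner V f g =
     (\<integral>t. f t ** trace_density V t ** adj (g t) \<partial>trace_measure V)"

text \<open>
  The squared norm \<open>\<integral> tr (f dV f\<^sup>*)\<close> of \<open>L\<^sup>2(V)\<close>. The integrand is real and nonnegative because the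
  density is positive semidefinite; the value is infinite exactly when \<open>f\<close> is not in \<open>L\<^sup>2(V)\<close>.
\<close>

definition L2_norm_sq :: "(real set \<Rightarrow> cmat2) \<Rightarrow> (real \<Rightarrow> cmat2) \<Rightarrow> ennreal" where
  "L2_norm_sq V f =
     (\<integral>\<^sup>+t. ennreal (Re (trace (f t ** trace_density V t ** adj (f t)))) \<partial>trace_measure V)"

definition in_L2 :: "(real set \<Rightarrow> cmat2) \<Rightarrow> (real \<Rightarrow> cmat2) \<Rightarrow> bool" where
  "in_L2 V f \<longleftrightarrow> f \<in> borel_measurable borel \<and> L2_norm_sq V f < \<infinity>"


definition matrix_poly_nonsing :: "nat \<Rightarrow> (real \<Rightarrow> cmat2) \<Rightarrow> bool" where
  "matrix_poly_nonsing n P \<longleftrightarrow>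
     (\<exists>A :: nat \<Rightarrow> cmat2. invertible (A n) \<and> P = (\<lambda>t. \<Sum>k\<le>n. t ^ k *\<^sub>R A k))"

definition second_order_op ::
    "(real \<Rightarrow> cmat2) \<Rightarrow> (real \<Rightarrow> cmat2) \<Rightarrow> (real \<Rightarrow> cmat2) \<Rightarrow> (real \<Rightarrow> cmat2) \<Rightarrow> real \<Rightarrow> cmat2"
  where
  "second_order_op F2 F1 F0 y t =
     y t ** F0 t
     + vector_derivative y (at t) ** F1 t
     + vector_derivative (\<lambda>s. vector_derivative y (at s)) (at t) ** F2 t"

text \<open>Only the values \<open>Q n\<close> with \<open>n \<notin> X\<close> are meaningful.\<close>

definition exceptional_matrix_polys ::
    "(real set \<Rightarrow> cmat2) \<Rightarrow> ((real \<Rightarrow> cmat2) \<Rightarrow> real \<Rightarrow> cmat2) \<Rightarrow> nat set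
      \<Rightarrow> (nat \<Rightarrow> real \<Rightarrow> cmat2) \<Rightarrow> bool" where
  "exceptional_matrix_polys V D X Q \<longleftrightarrow>
     weight_matrix V \<and> finite X \<and>
     (\<forall>n. n \<notin> X \<longrightarrow> matrix_poly_nonsing n (Q n)) \<and>
     (\<forall>n k. n \<notin> X \<longrightarrow> k \<notin> X \<longrightarrow> n \<noteq> k \<longrightarrow> matrix_inner V (Q n) (Q k) = 0) \<and>
     (\<forall>n. n \<notin> X \<longrightarrow> pos_def (matrix_inner V (Q n) (Q n))) \<and>
     (\<forall>f. in_L2 V f \<longrightarrow> (\<forall>\<epsilon>>0. \<exists>S (C :: nat \<Rightarrow> cmat2). finite S \<and> S \<inter> X = {} \<and>
        L2_norm_sq V (\<lambda>t. f t - (\<Sum>n\<in>S. C n ** Q n t)) < ennreal \<epsilon>)) \<and>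
     (\<exists>\<Gamma> :: nat \<Rightarrow> cmat2. \<forall>n. n \<notin> X \<longrightarrow> (\<forall>t. D (Q n) t = \<Gamma> n ** Q n t))"


definition pp :: "real \<Rightarrow> real \<Rightarrow> real" where
  "pp a t = 2 * (2 - a\<^sup>2) * t\<^sup>2 - a\<^sup>2"

definition W :: "real \<Rightarrow> real \<Rightarrow> cmat2" where
  "W a t = (exp (- t\<^sup>2) / (pp a t)\<^sup>2) *\<^sub>R mat22
     (of_real (a\<^sup>2 / (4 * (a\<^sup>2 - 2)) * (pp a t)\<^sup>2 + pp a t / (a\<^sup>2 - 2) - a\<^sup>2))
     (of_real (a * (pp a t / (a\<^sup>2 - 2) - 2) * t))
     (of_real (a * (pp a t / (a\<^sup>2 - 2) - 2) * t))
     (of_real (2 * (a\<^sup>2 * (a\<^sup>2 - 2) - pp a t) / (a\<^sup>2 - 2)\<^sup>2))"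

definition V :: "real \<Rightarrow> real \<Rightarrow> real set \<Rightarrow> cmat2" where
  "V a \<zeta> A = (1 / sqrt pi) *\<^sub>R set_lebesgue_integral lborel A (W a)
     + (\<zeta> * indicator A 0) *\<^sub>R mat22 0 0 0 1"

definition F2 :: "real \<Rightarrow> real \<Rightarrow> cmat2" where
  "F2 a t = (1 / pp a t) *\<^sub>R mat22
     (of_real (- (a\<^sup>2) * (2 * t\<^sup>2 + 1)))
     (of_real (- ((a\<^sup>2 - 2) * a * t * (2 * t\<^sup>2 + 1))))
     (of_real (4 * a * t / (a\<^sup>2 - 2)))
     (of_real (4 * t\<^sup>2))"

definition F1 :: "real \<Rightarrow> real \<Rightarrow> cmat2" where
  "F1 a t = (1 / (pp a t)\<^sup>2) *\<^sub>R mat22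
     (of_real (- 2 * t * ((pp a t)\<^sup>2 + 4 * pp a t - 4 * a\<^sup>2)))
     (of_real (4 * (a\<^sup>2 - 2) * t\<^sup>2 / a * (- pp a t + 2 * a\<^sup>2)))
     (of_real (4 * (pp a t + 2 * a\<^sup>2) * (pp a t - a\<^sup>2) / (a * (a\<^sup>2 - 2))))
     (of_real (- 8 * a\<^sup>2 * t))"

definition F0 :: "real \<Rightarrow> real \<Rightarrow> cmat2" where
  "F0 a t = mat22 (of_real (2 - 4 / a\<^sup>2)) 0 0 0"

end

theory Submission
  imports Defs "HOL-Probability.Sinc_Integral"
begin

text \<open>
  Let \<open>b = a\<^sup>2 - 2\<close>, \<open>p\<close> the quadratic in the denominator and \<open>T = t + K\<close> with \<open>K\<close> the constant
  matrix with rows \<open>(0, -a/2)\<close>, \<open>(a/b, 0)\<close>; then \<open>(t - K) T = - p / (2 b)\<close>. The operator, whose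
  leading coefficient is a projection of rank one, has no pole at the zeros of \<open>p\<close> on the
  matrix polynomials \<open>Y\<close> with \<open>Y' = Z T\<close> for a polynomial \<open>Z\<close>, and it maps this space into itself
  without raising the degree. The space is spanned over the constant matrices by \<open>I\<close> and
  \<open>t\<^sup>n I + n / (n - 1) t\<^sup>n\<^sup>-\<^sup>1 K\<close> for \<open>n \<ge> 2\<close>, which is why exactly degree one is missing. The operator is symmetric for the
  absolutely continuous part by integration by parts, and for the point mass because the second columns of
  all coefficients vanish at \<open>0\<close>. Hence the Gram-Schmidt orthogonalization of the basis consists of
  eigenfunctions. Since the space contains all multiples of \<open>p\<^sup>2\<close>, density reduces to the density of
  polynomials in \<open>L\<^sup>2\<close> of a measure with exponential moments.
\<close>

section \<open>Polynomial density in \<open>L\<^sup>2\<close> for measures with exponential moments\<close>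

text \<open>Why the orthogonalized basis consists of eigenfunctions: the operator preserves every
  step of the filtration of the space by degree, so it is triangular in that basis, and a symmetric
  triangular operator is diagonal. The eigenvalue matrices are thus obtained by existence and never
  computed. Inner products are matrix valued, so orthogonalization divides by Gram matrices; their
  invertibility rests on strict positivity of the absolutely continuous weight at every real point.
  Multiples of p^2 rather than p appear because the derivative of p^2 R is p (2 p' R + p R'), and T
  is a right factor of p I, whereas the term p' R in the derivative of p R need not have that
  factor. Dividing a target function by p^2 costs a factor p^4 in the measure, which the Gaussian
  absorbs. On the measure side the obstacle is that the density with respect to the trace measure is
  merely chosen. Pointwise facts about it hold almost everywhere and are imported from an explicit
  density.\<close>

definition poly_approx :: "real measure \<Rightarrow> (real \<Rightarrow> real) \<Rightarrow> bool" where
  "poly_approx M g \<longleftrightarrow> g \<in> borel_measurable borel \<and>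
     (\<forall>\<epsilon>>0. \<exists>q. real_polynomial_function q \<and>
        (\<integral>\<^sup>+t. ennreal ((g t - q t)\<^sup>2) \<partial>M) < ennreal \<epsilon>)"

lemma real_polynomial_function_measurable:
  fixes q :: "real \<Rightarrow> real"
  assumes "real_polynomial_function q"
  shows "q \<in> borel_measurable borel"
  using assms by (intro borel_measurable_continuous_onI continuous_on_polymonial_function)
    (simp add: real_polynomial_function_eq)

lemma poly_approx_measurable: "poly_approx M g \<Longrightarrow> g \<in> borel_measurable borel"
  by (simp add: poly_approx_def)

lemma poly_approx_polynomial:
  assumes "real_polynomial_function q"
  shows "poly_approx M q"
  using assms unfolding poly_approx_def
  by (auto intro!: real_polynomial_function_measurable exI[of _ q])

text \<open>This replaces Minkowski's inequality, so that no square root of an extended integral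
  occurs; errors below e/4 in both summands then combine to less than e.\<close>

lemma nn_integral_square_add_le:
  fixes f g :: "'a \<Rightarrow> real"
  assumes [measurable]: "f \<in> borel_measurable M" "g \<in> borel_measurable M"
  shows "(\<integral>\<^sup>+t. ennreal ((f t + g t)\<^sup>2) \<partial>M)
    \<le> 2 * (\<integral>\<^sup>+t. ennreal ((f t)\<^sup>2) \<partial>M) + 2 * (\<integral>\<^sup>+t. ennreal ((g t)\<^sup>2) \<partial>M)"
proof -
  have "(\<integral>\<^sup>+t. ennreal ((f t + g t)\<^sup>2) \<partial>M)
      \<le> (\<integral>\<^sup>+t. 2 * ennreal ((f t)\<^sup>2) + 2 * ennreal ((g t)\<^sup>2) \<partial>M)"
  proof (rule nn_integral_mono)
    fix t
    have "(f t + g t)\<^sup>2 \<le> 2 * (f t)\<^sup>2 + 2 * (g t)\<^sup>2"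
      using sum_squares_bound[of "f t" "g t"] by (simp add: power2_sum)
    then have "ennreal ((f t + g t)\<^sup>2) \<le> ennreal (2 * (f t)\<^sup>2 + 2 * (g t)\<^sup>2)"
      by (rule ennreal_leI)
    then show "ennreal ((f t + g t)\<^sup>2) \<le> 2 * ennreal ((f t)\<^sup>2) + 2 * ennreal ((g t)\<^sup>2)"
      by (simp add: ennreal_plus ennreal_mult)
  qed
  also have "\<dots> = 2 * (\<integral>\<^sup>+t. ennreal ((f t)\<^sup>2) \<partial>M) + 2 * (\<integral>\<^sup>+t. ennreal ((g t)\<^sup>2) \<partial>M)"
    by (simp add: nn_integral_add nn_integral_cmult)
  finally show ?thesis .
qed

lemma ennreal_two_fourths:
  assumes "x < ennreal (e / 4)" "y < ennreal (e / 4)" "0 < e"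
  shows "2 * x + 2 * y < ennreal e"
proof -
  from assms obtain r where r: "x = ennreal r" "0 \<le> r" by (cases x) auto
  from assms obtain s where s: "y = ennreal s" "0 \<le> s" by (cases y) auto
  have "r < e / 4" "s < e / 4"
    using assms r s by (auto simp: ennreal_less_iff)
  then have "ennreal (2 * r + 2 * s) < ennreal e"
    using r s assms(3) by (subst ennreal_less_iff) auto
  then show ?thesis
    using r s by (simp add: ennreal_plus ennreal_mult)
qed

lemma poly_approx_limit_L2:
  assumes sets: "sets M = sets borel" and g: "g \<in> borel_measurable borel"
    and f: "\<And>n. poly_approx M (f n)"
    and lim: "(\<lambda>n. \<integral>\<^sup>+t. ennreal ((g t - f n t)\<^sup>2) \<partial>M) \<longlonglongrightarrow> 0"
  shows "poly_approx M g"
  unfolding poly_approx_def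
proof (intro conjI allI impI g)
  fix e :: real assume "e > 0"
  note [measurable_cong] = sets
  note [measurable] = g poly_approx_measurable[OF f]
  have "\<forall>\<^sub>F n in sequentially. (\<integral>\<^sup>+t. ennreal ((g t - f n t)\<^sup>2) \<partial>M) < ennreal (e / 4)"
    using lim \<open>e > 0\<close> by (intro order_tendstoD) auto
  then obtain n where n: "(\<integral>\<^sup>+t. ennreal ((g t - f n t)\<^sup>2) \<partial>M) < ennreal (e / 4)"
    by (auto simp: eventually_sequentially)
  obtain q where q: "real_polynomial_function q"
    "(\<integral>\<^sup>+t. ennreal ((f n t - q t)\<^sup>2) \<partial>M) < ennreal (e / 4)"
    using f[of n] \<open>e > 0\<close> unfolding poly_approx_def
    by (metis divide_pos_pos zero_less_numeral)
  note [measurable] = real_polynomial_function_measurable[OF q(1)]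
  have "(\<integral>\<^sup>+t. ennreal ((g t - q t)\<^sup>2) \<partial>M)
      = (\<integral>\<^sup>+t. ennreal (((g t - f n t) + (f n t - q t))\<^sup>2) \<partial>M)"
    by simp
  also have "\<dots> \<le> 2 * (\<integral>\<^sup>+t. ennreal ((g t - f n t)\<^sup>2) \<partial>M) + 2 * (\<integral>\<^sup>+t. ennreal ((f n t - q t)\<^sup>2) \<partial>M)"
    by (intro nn_integral_square_add_le) measurable
  also have "\<dots> < ennreal e"
    using n q(2) \<open>e > 0\<close> by (rule ennreal_two_fourths)
  finally show "\<exists>q. real_polynomial_function q \<and> (\<integral>\<^sup>+t. ennreal ((g t - q t)\<^sup>2) \<partial>M) < ennreal e"
    using q by blast
qed

lemma poly_approx_add:
  assumes sets: "sets M = sets borel" and f: "poly_approx M f" and g: "poly_approx M g"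
  shows "poly_approx M (\<lambda>t. f t + g t)"
  unfolding poly_approx_def
proof (intro conjI allI impI)
  note [measurable_cong] = sets
  note [measurable] = poly_approx_measurable[OF f] poly_approx_measurable[OF g]
  show "(\<lambda>t. f t + g t) \<in> borel_measurable borel" by measurable
  fix e :: real assume "e > 0"
  obtain q where q: "real_polynomial_function q"
    "(\<integral>\<^sup>+t. ennreal ((f t - q t)\<^sup>2) \<partial>M) < ennreal (e / 4)"
    using f \<open>e > 0\<close> unfolding poly_approx_def by (metis divide_pos_pos zero_less_numeral)
  obtain r where r: "real_polynomial_function r"
    "(\<integral>\<^sup>+t. ennreal ((g t - r t)\<^sup>2) \<partial>M) < ennreal (e / 4)"
    using g \<open>e > 0\<close> unfolding poly_approx_def by (metis divide_pos_pos zero_less_numeral)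
  note [measurable] = real_polynomial_function_measurable[OF q(1)]
    real_polynomial_function_measurable[OF r(1)]
  have "(\<integral>\<^sup>+t. ennreal (((f t + g t) - (q t + r t))\<^sup>2) \<partial>M)
      = (\<integral>\<^sup>+t. ennreal (((f t - q t) + (g t - r t))\<^sup>2) \<partial>M)"
    by (simp add: algebra_simps)
  also have "\<dots> \<le> 2 * (\<integral>\<^sup>+t. ennreal ((f t - q t)\<^sup>2) \<partial>M) + 2 * (\<integral>\<^sup>+t. ennreal ((g t - r t)\<^sup>2) \<partial>M)"
    by (intro nn_integral_square_add_le) measurable
  also have "\<dots> < ennreal e"
    using q(2) r(2) \<open>e > 0\<close> by (rule ennreal_two_fourths)
  finally have "(\<integral>\<^sup>+t. ennreal ((f t + g t - (q t + r t))\<^sup>2) \<partial>M) < ennreal e" .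
  moreover have "real_polynomial_function (\<lambda>t. q t + r t)"
    using q(1) r(1) by (rule real_polynomial_function.intros(3))
  ultimately show "\<exists>q. real_polynomial_function q \<and>
      (\<integral>\<^sup>+t. ennreal ((f t + g t - q t)\<^sup>2) \<partial>M) < ennreal e"
    by (intro exI[of _ "\<lambda>t. q t + r t"] conjI)
qed

lemma poly_approx_cmult:
  assumes sets: "sets M = sets borel" and f: "poly_approx M f"
  shows "poly_approx M (\<lambda>t. c * f t)"
  unfolding poly_approx_def
proof (intro conjI allI impI)
  note [measurable_cong] = sets
  note [measurable] = poly_approx_measurable[OF f]
  show "(\<lambda>t. c * f t) \<in> borel_measurable borel" by measurable
  fix e :: real assume "e > 0"
  \<comment> \<open>Adding one keeps the divisor of e positive when \<open>c\<close> is
    zero.\<close>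
  define d where "d = c\<^sup>2 + 1"
  have d: "d > 0" "c\<^sup>2 \<le> d" by (auto simp: d_def add_nonneg_pos)
  obtain q where q: "real_polynomial_function q"
    "(\<integral>\<^sup>+t. ennreal ((f t - q t)\<^sup>2) \<partial>M) < ennreal (e / d)"
    using f \<open>e > 0\<close> d unfolding poly_approx_def by (metis divide_pos_pos)
  note [measurable] = real_polynomial_function_measurable[OF q(1)]
  have "(\<integral>\<^sup>+t. ennreal ((c * f t - c * q t)\<^sup>2) \<partial>M)
      \<le> (\<integral>\<^sup>+t. ennreal d * ennreal ((f t - q t)\<^sup>2) \<partial>M)"
  proof (rule nn_integral_mono)
    fix t
    have "(c * f t - c * q t)\<^sup>2 = c\<^sup>2 * (f t - q t)\<^sup>2"
      by (simp add: power_mult_distrib flip: right_diff_distrib)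
    also have "\<dots> \<le> d * (f t - q t)\<^sup>2"
      using d by (intro mult_right_mono) auto
    finally show "ennreal ((c * f t - c * q t)\<^sup>2) \<le> ennreal d * ennreal ((f t - q t)\<^sup>2)"
      using d by (subst ennreal_mult[symmetric]) (auto intro!: ennreal_leI)
  qed
  also have "\<dots> = ennreal d * (\<integral>\<^sup>+t. ennreal ((f t - q t)\<^sup>2) \<partial>M)"
    by (intro nn_integral_cmult) measurable
  also have "\<dots> < ennreal d * ennreal (e / d)"
    using q(2) d by (intro ennreal_mult_strict_left_mono) auto
  also have "\<dots> = ennreal e"
    using d \<open>e > 0\<close> by (subst ennreal_mult[symmetric]) auto
  finally have "(\<integral>\<^sup>+t. ennreal ((c * f t - c * q t)\<^sup>2) \<partial>M) < ennreal e" .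
  moreover have "real_polynomial_function (\<lambda>t. c * q t)"
    using real_polynomial_function.intros(2) q(1) by (rule real_polynomial_function.intros(4))
  ultimately show "\<exists>q. real_polynomial_function q \<and>
      (\<integral>\<^sup>+t. ennreal ((c * f t - q t)\<^sup>2) \<partial>M) < ennreal e"
    by (intro exI[of _ "\<lambda>t. c * q t"] conjI)
qed

text \<open>Finite moments of every order alone do not make polynomials dense. Every rate
  \<open>c\<close> is required because squaring a bound doubles its rate and composing it with a
  polynomial multiplies the rate by an amount growing with the degree.\<close>

locale exp_moment_measure = finite_measure M for M :: "real measure" +
  assumes sets_M [measurable_cong]: "sets M = sets borel"
    and exp_moment: "\<And>c::real. integrable M (\<lambda>t. exp (c * \<bar>t\<bar>))"
begin

text \<open>A common bound C exp(c |t|) makes 4 C^2 exp(2 c |t|) an integrable majorant of all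
  squared errors. The passages from polynomials to sines, continuous functions, indicators and
  bounded functions all go through this closure property.\<close>

lemma poly_approx_dominated_limit:
  assumes g: "\<And>t. (\<lambda>n. f n t) \<longlonglongrightarrow> g t"
    and f: "\<And>n. poly_approx M (f n)"
    and bound: "\<And>n t. \<bar>f n t\<bar> \<le> C * exp (c * \<bar>t\<bar>)"
  shows "poly_approx M g"
proof (rule poly_approx_limit_L2[OF sets_M _ f])
  note [measurable] = poly_approx_measurable[OF f]
  show g_meas [measurable]: "g \<in> borel_measurable borel"
    by (rule borel_measurable_LIMSEQ_real[where u=f]) (auto intro: g)
  have g_bound: "\<bar>g t\<bar> \<le> C * exp (c * \<bar>t\<bar>)" for t
    by (rule LIMSEQ_le_const2[OF tendsto_rabs[OF g]]) (use bound in auto)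
  have "(\<lambda>n. \<integral>\<^sup>+t. ennreal ((g t - f n t)\<^sup>2) \<partial>M) \<longlonglongrightarrow> (\<integral>\<^sup>+t. 0 \<partial>M)"
  proof (rule nn_integral_dominated_convergence[where w="\<lambda>t. ennreal (4 * C\<^sup>2 * exp (2 * c * \<bar>t\<bar>))"])
    have "integrable M (\<lambda>t. 4 * C\<^sup>2 * exp (2 * c * \<bar>t\<bar>))"
      by (intro integrable_mult_right exp_moment)
    then show "(\<integral>\<^sup>+t. ennreal (4 * C\<^sup>2 * exp (2 * c * \<bar>t\<bar>)) \<partial>M) < \<infinity>"
      by (simp add: nn_integral_eq_integral)
    show "AE t in M. ennreal ((g t - f n t)\<^sup>2) \<le> ennreal (4 * C\<^sup>2 * exp (2 * c * \<bar>t\<bar>))" for n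
    proof (intro AE_I2 ennreal_leI)
      fix t
      have "\<bar>g t - f n t\<bar> \<le> 2 * (C * exp (c * \<bar>t\<bar>))"
        using g_bound[of t] bound[of n t] by linarith
      then have "\<bar>g t - f n t\<bar>\<^sup>2 \<le> (2 * (C * exp (c * \<bar>t\<bar>)))\<^sup>2"
        by (intro power_mono) auto
      also have "\<dots> = 4 * C\<^sup>2 * exp (2 * c * \<bar>t\<bar>)"
        by (simp add: power_mult_distrib exp_double[symmetric] mult.assoc)
      finally show "(g t - f n t)\<^sup>2 \<le> 4 * C\<^sup>2 * exp (2 * c * \<bar>t\<bar>)" by simp
    qed
    show "AE t in M. (\<lambda>n. ennreal ((g t - f n t)\<^sup>2)) \<longlonglongrightarrow> 0"
    proof (intro AE_I2)
      fix t
      have "(\<lambda>n. (g t - f n t)\<^sup>2) \<longlonglongrightarrow> (g t - g t)\<^sup>2"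
        by (intro tendsto_intros g)
      then show "(\<lambda>n. ennreal ((g t - f n t)\<^sup>2)) \<longlonglongrightarrow> 0"
        using tendsto_ennrealI by fastforce
    qed
  qed auto
  then show "(\<lambda>n. \<integral>\<^sup>+t. ennreal ((g t - f n t)\<^sup>2) \<partial>M) \<longlonglongrightarrow> 0" by simp
qed

text \<open>The argument \<open>y\<close> will be a partial sum of the sine series, bounded by exp
  |r t|. The estimate sees \<open>y\<close> only through \<open>x\<close>, so it is uniform over all
  partial sums.\<close>

lemma real_polynomial_function_exp_bound:
  assumes "real_polynomial_function (q :: real \<Rightarrow> real)"
  shows "\<exists>C c. 0 \<le> C \<and> 0 \<le> c \<and> (\<forall>x y. 0 \<le> x \<longrightarrow> \<bar>y\<bar> \<le> exp x \<longrightarrow> \<bar>q y\<bar> \<le> C * exp (c * x))"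
  using assms
proof (induction rule: real_polynomial_function.induct)
  case (linear f)
  then obtain K where K: "\<bar>f y\<bar> \<le> \<bar>y\<bar> * K" "K > 0" for y
    using bounded_linear.pos_bounded by (metis real_norm_def)
  show ?case
  proof (rule exI[of _ K], rule exI[of _ 1], intro conjI allI impI)
    fix x y :: real assume "0 \<le> x" "\<bar>y\<bar> \<le> exp x"
    then have "\<bar>y\<bar> * K \<le> exp x * K" using K by (intro mult_right_mono) auto
    then show "\<bar>f y\<bar> \<le> K * exp (1 * x)"
      using K(1)[of y] by (simp add: mult.commute)
  qed (use K in auto)
next
  case (const d)
  show ?case by (rule exI[of _ "\<bar>d\<bar>"], rule exI[of _ 0]) auto
next
  case (add f g)
  then obtain C c D d where *: "0 \<le> C" "0 \<le> c" "0 \<le> D" "0 \<le> d"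
    "\<And>x y. 0 \<le> x \<Longrightarrow> \<bar>y\<bar> \<le> exp x \<Longrightarrow> \<bar>f y\<bar> \<le> C * exp (c * x)"
    "\<And>x y. 0 \<le> x \<Longrightarrow> \<bar>y\<bar> \<le> exp x \<Longrightarrow> \<bar>g y\<bar> \<le> D * exp (d * x)"
    by metis
  show ?case
  proof (rule exI[of _ "C + D"], rule exI[of _ "c + d"], intro conjI allI impI)
    fix x y :: real assume xy: "0 \<le> x" "\<bar>y\<bar> \<le> exp x"
    have "C * exp (c * x) \<le> C * exp ((c + d) * x)" "D * exp (d * x) \<le> D * exp ((c + d) * x)"
      using * xy by (auto intro!: mult_left_mono mult_right_mono)
    then show "\<bar>f y + g y\<bar> \<le> (C + D) * exp ((c + d) * x)"
      using *(5,6)[OF xy] by (simp add: distrib_right)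
  qed (use * in auto)
next
  case (mult f g)
  then obtain C c D d where *: "0 \<le> C" "0 \<le> c" "0 \<le> D" "0 \<le> d"
    "\<And>x y. 0 \<le> x \<Longrightarrow> \<bar>y\<bar> \<le> exp x \<Longrightarrow> \<bar>f y\<bar> \<le> C * exp (c * x)"
    "\<And>x y. 0 \<le> x \<Longrightarrow> \<bar>y\<bar> \<le> exp x \<Longrightarrow> \<bar>g y\<bar> \<le> D * exp (d * x)"
    by metis
  show ?case
  proof (rule exI[of _ "C * D"], rule exI[of _ "c + d"], intro conjI allI impI)
    fix x y :: real assume xy: "0 \<le> x" "\<bar>y\<bar> \<le> exp x"
    have "\<bar>f y\<bar> * \<bar>g y\<bar> \<le> (C * exp (c * x)) * (D * exp (d * x))"
      using *(5,6)[OF xy] * by (intro mult_mono) auto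
    moreover have "exp ((c + d) * x) = exp (c * x) * exp (d * x)"
      by (simp add: distrib_right exp_add)
    ultimately show "\<bar>f y * g y\<bar> \<le> (C * D) * exp ((c + d) * x)"
      by (simp add: abs_mult mult_ac)
  qed (use * in auto)
qed

lemma poly_approx_polynomial_sin:
  assumes q: "real_polynomial_function q"
  shows "poly_approx M (\<lambda>t. q (sin (r * t)))"
proof -
  define S where "S n t = (\<Sum>k<n. sin_coeff k * (r * t) ^ k)" for n and t :: real
  from real_polynomial_function_exp_bound[OF q] obtain C c
    where "0 \<le> C \<and> 0 \<le> c \<and> (\<forall>x y. 0 \<le> x \<longrightarrow> \<bar>y\<bar> \<le> exp x \<longrightarrow> \<bar>q y\<bar> \<le> C * exp (c * x))"
    by (elim exE)
  then have C: "\<bar>q y\<bar> \<le> C * exp (c * x)" if "0 \<le> x" "\<bar>y\<bar> \<le> exp x" for x y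
    using that by simp
  have q_cont: "continuous_on UNIV q"
    using q by (simp add: continuous_on_polymonial_function real_polynomial_function_eq)
  show ?thesis
  proof (rule poly_approx_dominated_limit)
    fix t
    have "(\<lambda>n. S n t) \<longlonglongrightarrow> sin (r * t)"
      using sin_converges[of "r * t"] by (simp add: S_def sums_def)
    with q_cont show "(\<lambda>n. q (S n t)) \<longlonglongrightarrow> q (sin (r * t))"
      by (rule continuous_on_tendsto_compose) auto
  next
    fix n
    have "real_polynomial_function (S n)"
      unfolding S_def
      by (intro real_polynomial_function_sum real_polynomial_function.intros(4)
          real_polynomial_function_power real_polynomial_function.intros(2)
          real_polynomial_function.intros(1) bounded_linear_intros) auto
    then have "real_polynomial_function (q \<circ> S n)"
      using q by (intro real_polynomial_function_compose) (auto simp: real_polynomial_function_eq)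
    then show "poly_approx M (\<lambda>t. q (S n t))"
      by (intro poly_approx_polynomial) (simp add: o_def)
  next
    fix n t
    \<comment> \<open>Comparison with the exponential series: every sine coefficient is at most 1 /
      k! in modulus, so the bound does not depend on \<open>n\<close>.\<close>
    have "\<bar>S n t\<bar> \<le> (\<Sum>k<n. \<bar>sin_coeff k * (r * t) ^ k\<bar>)"
      unfolding S_def by (rule sum_abs)
    also have "\<dots> \<le> (\<Sum>k<n. inverse (fact k) * \<bar>r * t\<bar> ^ k)"
      by (intro sum_mono) (auto simp: abs_mult power_abs sin_coeff_def divide_inverse
          intro!: mult_right_mono)
    also have "\<dots> \<le> (\<Sum>k. inverse (fact k) * \<bar>r * t\<bar> ^ k)"
      by (rule sum_le_suminf) (auto intro: summable_exp)
    also have "\<dots> = exp \<bar>r * t\<bar>" by (simp add: exp_def)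
    finally have "\<bar>q (S n t)\<bar> \<le> C * exp (c * \<bar>r * t\<bar>)"
      by (intro C) auto
    then show "\<bar>q (S n t)\<bar> \<le> C * exp ((c * \<bar>r\<bar>) * \<bar>t\<bar>)"
      by (simp add: abs_mult mult.assoc)
  qed
qed

lemma poly_approx_continuous_sin:
  fixes h :: "real \<Rightarrow> real"
  assumes h: "continuous_on {-1..1} h"
  shows "poly_approx M (\<lambda>t. h (sin (r * t)))"
proof -
  have "\<exists>q. real_polynomial_function q \<and> (\<forall>x\<in>{-1..1}. \<bar>h x - q x\<bar> < 1 / Suc n)" for n
  proof -
    have "0 < 1 / real (Suc n)" by simp
    from Stone_Weierstrass_real_polynomial_function[OF compact_Icc h this]
    obtain g where "real_polynomial_function g" "\<And>x. x \<in> {-1..1} \<Longrightarrow> \<bar>h x - g x\<bar> < 1 / Suc n"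
      by blast
    then show ?thesis by blast
  qed
  then obtain q where q: "\<And>n. real_polynomial_function (q n)"
    "\<And>n x. x \<in> {-1..1} \<Longrightarrow> \<bar>h x - q n x\<bar> < 1 / Suc n"
    by metis
  obtain B where "\<forall>y\<in>h ` {-1..1}. norm y \<le> B"
    using compact_imp_bounded[OF compact_continuous_image[OF h compact_Icc]]
    unfolding bounded_iff by blast
  then have B: "\<bar>h x\<bar> \<le> B" if "x \<in> {-1..1}" for x
    using that by simp
  show ?thesis
  proof (rule poly_approx_dominated_limit)
    fix t
    have "\<bar>q n (sin (r * t)) - h (sin (r * t))\<bar> \<le> 1 / Suc n" for n
      using q(2)[of "sin (r * t)" n] by (simp add: abs_minus_commute less_imp_le del: of_nat_Suc)
    then have "(\<lambda>n. q n (sin (r * t)) - h (sin (r * t))) \<longlonglongrightarrow> 0"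
      by (intro Lim_null_comparison[OF _ LIMSEQ_Suc[OF lim_1_over_n]])
        (auto simp del: of_nat_Suc)
    then show "(\<lambda>n. q n (sin (r * t))) \<longlonglongrightarrow> h (sin (r * t))"
      by (rule LIM_zero_cancel)
  next
    show "poly_approx M (\<lambda>t. q n (sin (r * t)))" for n
      by (intro poly_approx_polynomial_sin q)
  next
    fix n t
    have "\<bar>h (sin (r * t)) - q n (sin (r * t))\<bar> < 1 / Suc n" by (rule q) auto
    also have "1 / real (Suc n) \<le> 1" by simp
    finally show "\<bar>q n (sin (r * t))\<bar> \<le> (B + 1) * exp (0 * \<bar>t\<bar>)"
      using B[of "sin (r * t)"] by auto
  qed
qed

text \<open>Polynomials in \<open>sin (r t)\<close> are bounded, so Weierstrass approximation on \<open>[-1, 1]\<close> is uniform on the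
  whole line. The function \<open>n arcsin (sin (t / n))\<close> equals \<open>t\<close> for \<open>\<bar>t\<bar> \<le> n\<close>, which turns this into
  the approximation of arbitrary bounded continuous functions.\<close>

lemma poly_approx_bounded_continuous:
  fixes g :: "real \<Rightarrow> real"
  assumes g: "continuous_on UNIV g" and B: "\<And>t. \<bar>g t\<bar> \<le> B"
  shows "poly_approx M g"
proof (rule poly_approx_dominated_limit)
  fix t
  show "(\<lambda>n. g (Suc n * arcsin (sin (inverse (Suc n) * t)))) \<longlonglongrightarrow> g t"
  proof (rule tendsto_eventually)
    obtain N where N: "\<bar>t\<bar> \<le> real N" using real_arch_simple by blast
    show "\<forall>\<^sub>F n in sequentially. g (Suc n * arcsin (sin (inverse (Suc n) * t))) = g t"
      using eventually_ge_at_top[of N]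
    proof eventually_elim
      case (elim n)
      have "\<bar>t\<bar> \<le> 1 * real (Suc n)" using N elim by simp
      then have "\<bar>inverse (Suc n) * t\<bar> \<le> 1"
        by (simp add: abs_mult field_simps del: of_nat_Suc)
      \<comment> \<open>The argument has modulus at most 1, hence lies in [-pi/2, pi/2], where
        \<open>arcsin\<close> inverts \<open>sin\<close>.\<close>
      then have "arcsin (sin (inverse (Suc n) * t)) = inverse (Suc n) * t"
        using pi_gt3 by (intro arcsin_sin) (auto simp del: of_nat_Suc)
      moreover have "real (Suc n) * (inverse (real (Suc n)) * t) = t"
        by (simp del: of_nat_Suc flip: mult.assoc)
      ultimately show ?case by (simp only:)
    qed
  qed
next
  fix n
  have "continuous_on {-1..1} (\<lambda>x. g (Suc n * arcsin x))"
    by (rule continuous_on_compose2[OF g]) (auto intro!: continuous_intros)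
  then show "poly_approx M (\<lambda>t. g (Suc n * arcsin (sin (inverse (Suc n) * t))))"
    by (rule poly_approx_continuous_sin)
next
  show "\<bar>g (Suc n * arcsin (sin (inverse (Suc n) * t)))\<bar> \<le> B * exp (0 * \<bar>t\<bar>)" for n t
    using B by simp
qed

text \<open>Dynkin's argument: the half-lines are closed under intersection and generate the Borel
  sets, while the approximable sets are closed under complements by linearity and under disjoint
  countable unions by dominated limits.\<close>

lemma poly_approx_indicator:
  assumes "A \<in> sets borel"
  shows "poly_approx M (indicator A)"
proof -
  have half_line: "poly_approx M (indicator {..a})" for a :: real
  proof (rule poly_approx_dominated_limit)
    fix t
    \<comment> \<open>Continuous ramps, equal to 1 up to \<open>a\<close> and, for positive
      \<open>n\<close>, equal to 0 from a + 1/n on.\<close>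
    show "(\<lambda>n. max 0 (min 1 (1 - real n * (t - a)))) \<longlonglongrightarrow> indicator {..a} t"
    proof (cases "t \<le> a")
      case True
      then have "max 0 (min 1 (1 - real n * (t - a))) = 1" for n
        by (auto simp: mult_nonneg_nonpos min_def max_def)
      then show ?thesis using True by simp
    next
      case False
      obtain N where N: "1 \<le> real N * (t - a)"
        using False reals_Archimedean3[of "t - a"] by (metis diff_gt_0_iff_gt less_imp_le not_le)
      have "\<forall>\<^sub>F n in sequentially. max 0 (min 1 (1 - real n * (t - a))) = 0"
        using eventually_ge_at_top[of N]
      proof eventually_elim
        case (elim n)
        have "real N * (t - a) \<le> real n * (t - a)"
          using elim False by (intro mult_right_mono) auto
        then show ?case using N by simp
      qed
      then show ?thesis using False by (simp add: tendsto_eventually)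
    qed
  next
    show "poly_approx M (\<lambda>t. max 0 (min 1 (1 - real n * (t - a))))" for n
      by (rule poly_approx_bounded_continuous[where B=1]) (auto intro!: continuous_intros)
    show "\<bar>max 0 (min 1 (1 - real n * (t - a)))\<bar> \<le> 1 * exp (0 * \<bar>t\<bar>)" for n t
      by simp
  qed
  have A: "A \<in> sigma_sets UNIV (range (\<lambda>a::real. {..a}))"
    using assms by (metis borel_eq_atMost sets_measure_of_conv top_greatest Pow_UNIV)
  have int: "Int_stable (range (\<lambda>a::real. {..a}))" "range (\<lambda>a::real. {..a}) \<subseteq> Pow UNIV"
    by (auto simp: Int_stable_def)
  show ?thesis
    using int A
  proof (induction rule: sigma_sets_induct_disjoint)
    case (basic A)
    then show ?case using half_line by auto
  next
    case empty
    have "(indicator {} :: real \<Rightarrow> real) = (\<lambda>_. 0)" by auto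
    then show ?case by (simp add: poly_approx_polynomial real_polynomial_function.intros(2))
  next
    case (compl A)
    have "poly_approx M (\<lambda>t. 1 + (-1) * indicator A t)"
      by (intro poly_approx_add poly_approx_cmult sets_M compl poly_approx_polynomial
          real_polynomial_function.intros(2))
    moreover have "(\<lambda>t. 1 + (-1) * indicator A t) = (indicator (UNIV - A) :: real \<Rightarrow> real)"
      by (auto simp: indicator_def)
    ultimately show ?case by simp
  next
    case (union A)
    show ?case
    proof (rule poly_approx_dominated_limit)
      show "(\<lambda>n. indicator (\<Union>i<n. A i) t) \<longlonglongrightarrow> (indicator (\<Union>i. A i) t :: real)" for t
        by (rule LIMSEQ_indicator_UN)
    next
      fix n
      show "poly_approx M (indicator (\<Union>i<n. A i))"
      proof (induction n)
        case 0
        have "(indicator (\<Union>i<0. A i) :: real \<Rightarrow> real) = (\<lambda>_. 0)" by auto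
        then show ?case by (simp add: poly_approx_polynomial real_polynomial_function.intros(2))
      next
        case (Suc n)
        have "A i \<inter> A n = {}" if "i < n" for i
          using that by (intro disjoint_family_onD[OF union(1)]) auto
        then have disj: "(\<Union>i<n. A i) \<inter> A n = {}" by blast
        have "(\<Union>i<Suc n. A i) = (\<Union>i<n. A i) \<union> A n"
          by (simp add: lessThan_Suc Un_commute)
        then have eq: "indicator (\<Union>i<Suc n. A i) = (\<lambda>t. indicator (\<Union>i<n. A i) t + indicator (A n) t :: real)"
          using disj by (auto simp: indicator_def fun_eq_iff)
        show ?case
          unfolding eq by (rule poly_approx_add[OF sets_M Suc union(3)])
      qed
    next
      show "\<bar>indicator (\<Union>i<n. A i) t\<bar> \<le> 1 * exp (0 * \<bar>t\<bar>)" for n t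
        by (simp add: indicator_def)
    qed
  qed
qed

text \<open>Boundedness stands as a premise inside the conclusion so that the induction can pass it
  down: a bound on a sum or a monotone limit of nonnegative functions also bounds the
  pieces.\<close>

lemma poly_approx_bounded_nonneg:
  assumes "g \<in> borel_measurable borel" "\<And>t. 0 \<le> g t"
  shows "(\<exists>B. \<forall>t. g t \<le> B) \<longrightarrow> poly_approx M g"
  using assms
proof (induction rule: borel_measurable_induct_real)
  case (set A)
  then show ?case by (simp add: poly_approx_indicator)
next
  case (mult u c)
  show ?case
  \<comment> \<open>For \<open>c = 0\<close> a bound on the product says nothing about
    \<open>u\<close>, so the induction hypothesis is out of reach; but then the product is the zero
    polynomial.\<close>
  proof (cases "c = 0")
    case True
    then show ?thesis by (simp add: poly_approx_polynomial real_polynomial_function.intros(2))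
  next
    case False
    show ?thesis
    proof
      assume "\<exists>B. \<forall>t. c * u t \<le> B"
      then obtain B where "\<forall>t. c * u t \<le> B" by blast
      then have "\<forall>t. u t \<le> B / c" using False mult(1) by (simp add: field_simps)
      then show "poly_approx M (\<lambda>t. c * u t)"
        using mult by (intro poly_approx_cmult sets_M) blast
    qed
  qed
next
  case (add u v)
  show ?case
  proof
    assume "\<exists>B. \<forall>t. v t + u t \<le> B"
    then obtain B where B: "\<And>t. v t + u t \<le> B" by blast
    have "u t \<le> B" "v t \<le> B" for t
      using B[of t] add.hyps(2)[of t] add.hyps(4)[of t] by linarith+
    then show "poly_approx M (\<lambda>t. v t + u t)"
      using add by (intro poly_approx_add sets_M) blast+
  qed
next
  case (seq U)
  show ?case
  proof
    assume "\<exists>B. \<forall>t. g t \<le> B"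
    then obtain B where B: "\<And>t. g t \<le> B" by blast
    have U: "U n t \<le> B" for n t
    proof -
      have "incseq (\<lambda>n. U n t)" using seq.hyps(3) by (auto simp: incseq_def le_fun_def)
      then have "U n t \<le> g t" using seq.hyps(4) by (intro incseq_le) auto
      then show ?thesis using B order_trans by blast
    qed
    show "poly_approx M g"
    proof (rule poly_approx_dominated_limit)
      show "(\<lambda>n. U n t) \<longlonglongrightarrow> g t" for t using seq.hyps(4) by simp
      show "poly_approx M (U n)" for n using seq.IH U by blast
      show "\<bar>U n t\<bar> \<le> B * exp (0 * \<bar>t\<bar>)" for n t using U seq.hyps(2) by simp
    qed
  qed
qed

lemma poly_approx_bounded:
  assumes g [measurable]: "g \<in> borel_measurable borel" and B: "\<And>t. \<bar>g t\<bar> \<le> B"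
  shows "poly_approx M g"
proof -
  have "0 \<le> g t + B" "g t + B \<le> 2 * B" for t
    using B[of t] by (auto simp: abs_le_iff)
  then have "poly_approx M (\<lambda>t. g t + B)"
    by (intro poly_approx_bounded_nonneg[rule_format] exI[of _ "2 * B"]) auto
  then have "poly_approx M (\<lambda>t. (g t + B) + (- B))"
    by (rule poly_approx_add[OF sets_M _ poly_approx_polynomial[OF real_polynomial_function.intros(2)]])
  then show ?thesis by simp
qed

end

section \<open>Complex two by two matrices and Gaussian decay\<close>

lemma mat22_nth [simp]:
  "mat22 x y z w $ 1 $ 1 = x" "mat22 x y z w $ 1 $ 2 = y"
  "mat22 x y z w $ 2 $ 1 = z" "mat22 x y z w $ 2 $ 2 = w"
  by (simp_all add: mat22_def)

lemma cmat2_eq_iff: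
  fixes A B :: cmat2
  shows "A = B \<longleftrightarrow> A $ 1 $ 1 = B $ 1 $ 1 \<and> A $ 1 $ 2 = B $ 1 $ 2 \<and> A $ 2 $ 1 = B $ 2 $ 1 \<and> A $ 2 $ 2 = B $ 2 $ 2"
  by (auto simp: vec_eq_iff forall_2)

lemma cmat2_mult_nth [simp]:
  fixes A B :: cmat2
  shows "(A ** B) $ i $ j = A $ i $ 1 * B $ 1 $ j + A $ i $ 2 * B $ 2 $ j"
  by (simp add: matrix_matrix_mult_def sum_2)

lemma adj_nth [simp]: "adj A $ i $ j = cnj (A $ j $ i)"
  by (simp add: adj_def)

lemma trace_cmat2: "trace (A :: cmat2) = A $ 1 $ 1 + A $ 2 $ 2"
  by (simp add: trace_def sum_2)

lemma adj_mult: "adj (A ** B) = adj B ** adj A"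
  by (simp add: cmat2_eq_iff mult.commute)

lemma adj_adj [simp]: "adj (adj A) = A"
  by (simp add: cmat2_eq_iff)

lemma quad_form_cmat2:
  "quad_form A v = v $ 1 * A $ 1 $ 1 * cnj (v $ 1) + v $ 1 * A $ 1 $ 2 * cnj (v $ 2)
    + v $ 2 * A $ 2 $ 1 * cnj (v $ 1) + v $ 2 * A $ 2 $ 2 * cnj (v $ 2)"
  by (simp add: quad_form_def sum_2)

section \<open>Linearity, continuity and measurability of the matrix operations\<close>

lemma bounded_bilinear_cmat2_mult: "bounded_bilinear ((**) :: cmat2 \<Rightarrow> cmat2 \<Rightarrow> cmat2)"
  unfolding bilinear_conv_bounded_bilinear[symmetric] bilinear_def
  by (auto intro!: linearI simp: cmat2_eq_iff algebra_simps)

lemma bounded_linear_cmat2_nth: "bounded_linear (\<lambda>A :: cmat2. A $ i $ j)"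
  unfolding linear_linear by (auto intro!: linearI)

lemma bounded_linear_adj: "bounded_linear adj"
  unfolding linear_linear by (auto intro!: linearI simp: cmat2_eq_iff)

lemma bounded_linear_quad_form: "bounded_linear (\<lambda>A. quad_form A v)"
  unfolding linear_linear by (auto intro!: linearI simp: quad_form_cmat2 algebra_simps)

lemma bounded_linear_Re_trace: "bounded_linear (\<lambda>A :: cmat2. Re (trace A))"
  unfolding linear_linear by (auto intro!: linearI simp: trace_cmat2 algebra_simps)

lemmas continuous_on_cmat2_mult [continuous_intros] =
  bounded_bilinear.continuous_on[OF bounded_bilinear_cmat2_mult]
lemmas continuous_on_cmat2_nth [continuous_intros] =
  bounded_linear.continuous_on[OF bounded_linear_cmat2_nth]
lemmas continuous_on_adj [continuous_intros] =
  bounded_linear.continuous_on[OF bounded_linear_adj]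

lemma measurable_cmat2_mult [measurable]:
  fixes f g :: "'a \<Rightarrow> cmat2"
  assumes [measurable]: "f \<in> borel_measurable M" "g \<in> borel_measurable M"
  shows "(\<lambda>x. f x ** g x) \<in> borel_measurable M"
  by (rule borel_measurable_continuous_Pair[OF assms]) (intro continuous_intros)

lemma measurable_cmat2_nth [measurable]:
  fixes f :: "'a \<Rightarrow> cmat2"
  assumes "f \<in> borel_measurable M"
  shows "(\<lambda>x. f x $ i $ j) \<in> borel_measurable M"
  using borel_measurable_continuous_onI[OF continuous_on_cmat2_nth[OF continuous_on_id]] assms
  by (rule measurable_compose[rotated])

lemma measurable_adj [measurable]:
  assumes "f \<in> borel_measurable M"
  shows "(\<lambda>x. adj (f x)) \<in> borel_measurable M"
  using borel_measurable_continuous_onI[OF continuous_on_adj[OF continuous_on_id]] assms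
  by (rule measurable_compose[rotated])

lemma continuous_on_mat22 [continuous_intros]:
  assumes "continuous_on S f" "continuous_on S g" "continuous_on S h" "continuous_on S k"
  shows "continuous_on S (\<lambda>x. mat22 (f x) (g x) (h x) (k x))"
proof -
  have *: "mat22 x y z w = (\<chi> i j. if i = 1 then if j = 1 then x else y else if j = 1 then z else w)"
    for x y z w by (simp add: cmat2_eq_iff)
  have "continuous_on S (\<lambda>x. if i = 1 then if j = 1 then f x else g x else if j = 1 then h x else k x)"
    for i j :: 2
    using assms by (cases "i = 1"; cases "j = 1") auto
  then show ?thesis
    unfolding * by (intro continuous_on_vec_lambda)
qed

lemma pos_semidef_quad:
  assumes "pos_semidef A"
  shows "0 \<le> Re (quad_form A v)" "Im (quad_form A v) = 0"
  using assms by (auto simp: pos_semidef_def)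

lemma pos_semidef_diag:
  assumes "pos_semidef A"
  shows "0 \<le> Re (A $ 1 $ 1)" "0 \<le> Re (A $ 2 $ 2)"
  using pos_semidef_quad(1)[OF assms, of "vector [1, 0]"] pos_semidef_quad(1)[OF assms, of "vector [0, 1]"]
  by (simp_all add: quad_form_cmat2)

text \<open>The parallelogram law for \<open>v = (v\<^sub>1, 0) + (0, v\<^sub>2)\<close>; no Cauchy-Schwarz inequality is needed.\<close>

lemma pos_semidef_quad_le:
  assumes "pos_semidef A"
  shows "Re (quad_form A v) \<le> 2 * Re (trace A) * ((norm (v $ 1))\<^sup>2 + (norm (v $ 2))\<^sup>2)"
proof -
  have "Re (quad_form A v) + Re (quad_form A (vector [v $ 1, - v $ 2]))
      = 2 * ((norm (v $ 1))\<^sup>2 * Re (A $ 1 $ 1) + (norm (v $ 2))\<^sup>2 * Re (A $ 2 $ 2))"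
    by (simp add: quad_form_cmat2 cmod_power2) (simp add: power2_eq_square algebra_simps)
  moreover have "(norm (v $ 1))\<^sup>2 * Re (A $ 1 $ 1) \<le> (norm (v $ 1))\<^sup>2 * Re (trace A)"
    "(norm (v $ 2))\<^sup>2 * Re (A $ 2 $ 2) \<le> (norm (v $ 2))\<^sup>2 * Re (trace A)"
    using pos_semidef_diag[OF assms] by (auto simp: trace_cmat2 intro!: mult_left_mono)
  ultimately show ?thesis
    using pos_semidef_quad(1)[OF assms, of "vector [v $ 1, - v $ 2]"] by (simp add: algebra_simps)
qed

text \<open>The rows of \<open>F\<close> decouple, so every estimate of the matrix norm in L^2
  reduces to the quadratic form of the density at two vectors.\<close>

lemma trace_congruence:
  "trace (F ** A ** adj F) = quad_form A (F $ 1) + quad_form A (F $ 2)"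
  by (simp add: trace_cmat2 quad_form_cmat2 algebra_simps)

text \<open>Completing the square. Multiplying by \<gamma> avoids a division and isolates the
  determinant, which gives the criterion \<open>pos_def_mat22_real\<close>.\<close>

lemma quad_form_mat22_real:
  fixes \<alpha> \<beta> \<gamma> :: real
  shows "Im (quad_form (mat22 \<alpha> \<beta> \<beta> \<gamma>) v) = 0"
    and "\<gamma> * Re (quad_form (mat22 \<alpha> \<beta> \<beta> \<gamma>) v)
      = (norm (of_real \<beta> * v $ 1 + of_real \<gamma> * v $ 2))\<^sup>2 + (\<alpha> * \<gamma> - \<beta>\<^sup>2) * (norm (v $ 1))\<^sup>2"
  by (simp_all add: quad_form_cmat2 cmod_power2) (simp_all add: power2_eq_square algebra_simps)

lemma pos_def_mat22_real:
  fixes \<alpha> \<beta> \<gamma> :: real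
  assumes "\<gamma> > 0" "\<alpha> * \<gamma> - \<beta>\<^sup>2 > 0"
  shows "pos_def (mat22 \<alpha> \<beta> \<beta> \<gamma>)"
  unfolding pos_def_def
proof (intro allI impI conjI quad_form_mat22_real)
  fix v :: "complex ^ 2" assume "v \<noteq> 0"
  then have nz: "v $ 1 \<noteq> 0 \<or> v $ 2 \<noteq> 0" by (auto simp: vec_eq_iff forall_2)
  have "0 < (norm (of_real \<beta> * v $ 1 + of_real \<gamma> * v $ 2))\<^sup>2 + (\<alpha> * \<gamma> - \<beta>\<^sup>2) * (norm (v $ 1))\<^sup>2"
  proof (cases "v $ 1 = 0")
    case True
    then show ?thesis using nz assms by (simp add: power2_eq_square)
  next
    case False
    then show ?thesis using assms by (intro add_nonneg_pos mult_pos_pos) auto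
  qed
  then show "0 < Re (quad_form (mat22 \<alpha> \<beta> \<beta> \<gamma>) v)"
    unfolding quad_form_mat22_real(2)[symmetric] using assms(1) by (simp add: zero_less_mult_iff)
qed

lemma quad_form_scaleR: "quad_form (r *\<^sub>R A) v = r *\<^sub>R quad_form A v"
  by (rule linear_cmul[OF bounded_linear.linear[OF bounded_linear_quad_form]])

lemma pos_def_imp_pos_semidef:
  assumes "pos_def A"
  shows "pos_semidef A"
  unfolding pos_semidef_def
proof
  fix v
  show "Im (quad_form A v) = 0 \<and> 0 \<le> Re (quad_form A v)"
    using assms by (cases "v = 0") (auto simp: pos_def_def quad_form_cmat2 less_imp_le)
qed

lemma pos_def_scaleR: "r > 0 \<Longrightarrow> pos_def A \<Longrightarrow> pos_def (r *\<^sub>R A)"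
  by (simp add: pos_def_def quad_form_scaleR)

lemma pos_semidef_scaleR: "r \<ge> 0 \<Longrightarrow> pos_semidef A \<Longrightarrow> pos_semidef (r *\<^sub>R A)"
  by (simp add: pos_semidef_def quad_form_scaleR)

lemma pos_semidef_add: "pos_semidef A \<Longrightarrow> pos_semidef B \<Longrightarrow> pos_semidef (A + B)"
  by (simp add: pos_semidef_def linear_add[OF bounded_linear.linear[OF bounded_linear_quad_form]])

lemma pos_semidef_unit: "pos_semidef (mat22 0 0 0 1)"
  by (simp add: pos_semidef_def quad_form_cmat2)

text \<open>This class contains the polynomials and the negative powers of \<open>pp a\<close>, is
  stable under bounded bilinear maps, and is dominated by the Gaussian. Integrability and vanishing
  boundary terms therefore need no degree counts. Nonnegative constants allow two rates to be
  enlarged to their sum.\<close>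

definition exp_bounded :: "(real \<Rightarrow> 'a::real_normed_vector) \<Rightarrow> bool" where
  "exp_bounded f \<longleftrightarrow> (\<exists>C c. 0 \<le> C \<and> 0 \<le> c \<and> (\<forall>t. norm (f t) \<le> C * exp (c * \<bar>t\<bar>)))"

lemma exp_boundedE:
  assumes "exp_bounded f"
  obtains C c where "0 \<le> C" "0 \<le> c" "\<And>t. norm (f t) \<le> C * exp (c * \<bar>t\<bar>)"
  using assms unfolding exp_bounded_def by blast

lemma exp_boundedI:
  assumes "0 \<le> C" "0 \<le> c" "\<And>t. norm (f t) \<le> C * exp (c * \<bar>t\<bar>)"
  shows "exp_bounded f"
  using assms unfolding exp_bounded_def by blast

named_theorems exp_bounded_intros

lemma exp_bounded_const [exp_bounded_intros]: "exp_bounded (\<lambda>t. c)"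
  by (rule exp_boundedI[of "norm c" 0]) auto

lemma exp_bounded_ident [exp_bounded_intros]: "exp_bounded (\<lambda>t. t)"
proof (rule exp_boundedI[of 1 1])
  show "norm t \<le> 1 * exp (1 * \<bar>t\<bar>)" for t :: real
    using exp_ge_add_one_self[of "\<bar>t\<bar>"] by (simp del: exp_ge_add_one_self)
qed auto

lemma exp_bounded_exp_abs [exp_bounded_intros]: "exp_bounded (\<lambda>t. exp (c * \<bar>t\<bar>))" for c :: real
  by (rule exp_boundedI[of 1 "\<bar>c\<bar>"]) (auto intro!: mult_right_mono)

lemma exp_bounded_bounded:
  "(\<And>t. norm (f t) \<le> B) \<Longrightarrow> exp_bounded f"
  by (rule exp_boundedI[of "\<bar>B\<bar>" 0]) (auto intro: order_trans[OF _ abs_ge_self])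

lemma exp_bounded_add [exp_bounded_intros]:
  assumes "exp_bounded f" "exp_bounded g"
  shows "exp_bounded (\<lambda>t. f t + g t)"
proof -
  obtain C c where C: "0 \<le> C" "0 \<le> c" "\<And>t. norm (f t) \<le> C * exp (c * \<bar>t\<bar>)"
    using exp_boundedE[OF assms(1)] by metis
  obtain D d where D: "0 \<le> D" "0 \<le> d" "\<And>t. norm (g t) \<le> D * exp (d * \<bar>t\<bar>)"
    using exp_boundedE[OF assms(2)] by metis
  show ?thesis
  proof (rule exp_boundedI[of "C + D" "c + d"])
    fix t
    have "C * exp (c * \<bar>t\<bar>) \<le> C * exp ((c + d) * \<bar>t\<bar>)" "D * exp (d * \<bar>t\<bar>) \<le> D * exp ((c + d) * \<bar>t\<bar>)"
      using C D by (auto intro!: mult_left_mono mult_right_mono)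
    then show "norm (f t + g t) \<le> (C + D) * exp ((c + d) * \<bar>t\<bar>)"
      using C(3)[of t] D(3)[of t] norm_triangle_ineq[of "f t" "g t"] by (simp add: distrib_right)
  qed (use C D in auto)
qed

lemma exp_bounded_bilinear:
  assumes "bounded_bilinear h" "exp_bounded f" "exp_bounded g"
  shows "exp_bounded (\<lambda>t. h (f t) (g t))"
proof -
  obtain C c where C: "0 \<le> C" "0 \<le> c" "\<And>t. norm (f t) \<le> C * exp (c * \<bar>t\<bar>)"
    using exp_boundedE[OF assms(2)] by metis
  obtain D d where D: "0 \<le> D" "0 \<le> d" "\<And>t. norm (g t) \<le> D * exp (d * \<bar>t\<bar>)"
    using exp_boundedE[OF assms(3)] by metis
  obtain K where K: "0 \<le> K" "\<And>x y. norm (h x y) \<le> norm x * norm y * K"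
    using bounded_bilinear.nonneg_bounded[OF assms(1)] by metis
  show ?thesis
  proof (rule exp_boundedI[of "C * D * K" "c + d"])
    fix t
    have "norm (h (f t) (g t)) \<le> norm (f t) * norm (g t) * K" by (rule K)
    also have "\<dots> \<le> (C * exp (c * \<bar>t\<bar>)) * (D * exp (d * \<bar>t\<bar>)) * K"
      using C D K by (intro mult_right_mono mult_mono) auto
    also have "\<dots> = C * D * K * (exp (c * \<bar>t\<bar>) * exp (d * \<bar>t\<bar>))"
      by (simp add: mult_ac)
    also have "exp (c * \<bar>t\<bar>) * exp (d * \<bar>t\<bar>) = exp ((c + d) * \<bar>t\<bar>)"
      by (simp add: distrib_right exp_add)
    finally show "norm (h (f t) (g t)) \<le> C * D * K * exp ((c + d) * \<bar>t\<bar>)" .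
  qed (use C D K in auto)
qed

lemmas exp_bounded_mult [exp_bounded_intros] = exp_bounded_bilinear[OF bounded_bilinear_mult]
lemmas exp_bounded_scaleR [exp_bounded_intros] = exp_bounded_bilinear[OF bounded_bilinear_scaleR]
lemmas exp_bounded_cmat2_mult [exp_bounded_intros] = exp_bounded_bilinear[OF bounded_bilinear_cmat2_mult]

lemma exp_bounded_linear:
  assumes h: "bounded_linear h" and f: "exp_bounded f"
  shows "exp_bounded (\<lambda>t. h (f t))"
proof -
  \<comment> \<open>Pairing with the constant function 1 turns the linear case into the bilinear
    one.\<close>
  have "bounded_bilinear (\<lambda>(r::real) x. r *\<^sub>R h x)"
    using bounded_bilinear.comp[OF bounded_bilinear_scaleR bounded_linear_ident h] .
  from exp_bounded_bilinear[OF this exp_bounded_const[of 1] f] show ?thesis by simp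
qed

lemmas exp_bounded_adj [exp_bounded_intros] = exp_bounded_linear[OF bounded_linear_adj]
lemmas exp_bounded_of_real [exp_bounded_intros] = exp_bounded_linear[OF bounded_linear_of_real]

lemma exp_bounded_minus [exp_bounded_intros]: "exp_bounded f \<Longrightarrow> exp_bounded (\<lambda>t. - f t)"
  by (simp add: exp_bounded_def)

lemma exp_bounded_diff [exp_bounded_intros]:
  "exp_bounded f \<Longrightarrow> exp_bounded g \<Longrightarrow> exp_bounded (\<lambda>t. f t - g t)"
  using exp_bounded_add[of f "\<lambda>t. - g t"] by (simp add: exp_bounded_minus)

lemma exp_bounded_power [exp_bounded_intros]:
  fixes f :: "real \<Rightarrow> 'a::real_normed_algebra_1"
  shows "exp_bounded f \<Longrightarrow> exp_bounded (\<lambda>t. f t ^ n)"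
  by (induction n) (simp_all add: exp_bounded_mult exp_bounded_const)

lemma exp_bounded_sum [exp_bounded_intros]:
  "(\<And>i. i \<in> I \<Longrightarrow> exp_bounded (f i)) \<Longrightarrow> exp_bounded (\<lambda>t. \<Sum>i\<in>I. f i t)"
  by (induction I rule: infinite_finite_induct) (simp_all add: exp_bounded_add exp_bounded_const)

lemma exp_bounded_mat22 [exp_bounded_intros]:
  assumes "exp_bounded f" "exp_bounded g" "exp_bounded h" "exp_bounded k"
  shows "exp_bounded (\<lambda>t. mat22 (f t) (g t) (h t) (k t))"
proof -
  have lin: "bounded_linear (\<lambda>x. mat22 x 0 0 0)" "bounded_linear (\<lambda>x. mat22 0 x 0 0)"
    "bounded_linear (\<lambda>x. mat22 0 0 x 0)" "bounded_linear (\<lambda>x. mat22 0 0 0 x)"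
    unfolding linear_linear by (auto intro!: linearI simp: cmat2_eq_iff)
  have "mat22 x y z w = mat22 x 0 0 0 + mat22 0 y 0 0 + mat22 0 0 z 0 + mat22 0 0 0 w" for x y z w
    by (simp add: cmat2_eq_iff)
  then have *: "(\<lambda>t. mat22 (f t) (g t) (h t) (k t))
      = (\<lambda>t. mat22 (f t) 0 0 0 + mat22 0 (g t) 0 0 + mat22 0 0 (h t) 0 + mat22 0 0 0 (k t))"
    by (rule ext)
  show ?thesis
    by (subst *) (intro exp_bounded_add exp_bounded_linear[OF lin(1)] exp_bounded_linear[OF lin(2)]
        exp_bounded_linear[OF lin(3)] exp_bounded_linear[OF lin(4)] assms)
qed

lemma gauss_dominates_exp:
  fixes c t :: real
  shows "exp (- t\<^sup>2) * exp (c * \<bar>t\<bar>) \<le> exp (c\<^sup>2 / 4)"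
proof -
  have "0 \<le> (c / 2 - \<bar>t\<bar>)\<^sup>2" by simp
  then have "- t\<^sup>2 + c * \<bar>t\<bar> \<le> c\<^sup>2 / 4"
    by (simp add: power2_diff power_divide)
  then show ?thesis by (simp flip: exp_add)
qed

text \<open>The factor 1 + t^2 is absorbed into \<open>f\<close> before the Gaussian is spent. The
  resulting bound is integrable and also tends to zero, so it serves both purposes below.\<close>

lemma exp_bounded_gauss_decay:
  assumes "exp_bounded f"
  obtains K where "0 \<le> K" "\<And>t. norm (exp (- t\<^sup>2) *\<^sub>R f t) \<le> K * inverse (1 + t\<^sup>2)"
proof -
  have "exp_bounded (\<lambda>t. (1 + t\<^sup>2) *\<^sub>R f t)"
    by (intro exp_bounded_intros assms)
  then obtain C c where C: "0 \<le> C" "0 \<le> c"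
    "\<And>t. norm ((1 + t\<^sup>2) *\<^sub>R f t) \<le> C * exp (c * \<bar>t\<bar>)"
    by (rule exp_boundedE) (rule that)
  show ?thesis
  proof (rule that[of "C * exp (c\<^sup>2 / 4)"])
    fix t :: real
    have pos: "1 + t\<^sup>2 > 0" by (simp add: add_pos_nonneg)
    have "(1 + t\<^sup>2) * norm (exp (- t\<^sup>2) *\<^sub>R f t) = exp (- t\<^sup>2) * norm ((1 + t\<^sup>2) *\<^sub>R f t)"
      using pos by simp
    also have "\<dots> \<le> exp (- t\<^sup>2) * (C * exp (c * \<bar>t\<bar>))"
      by (intro mult_left_mono C) auto
    also have "\<dots> = C * (exp (- t\<^sup>2) * exp (c * \<bar>t\<bar>))" by simp
    also have "\<dots> \<le> C * exp (c\<^sup>2 / 4)"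
      by (intro mult_left_mono C gauss_dominates_exp)
    finally show "norm (exp (- t\<^sup>2) *\<^sub>R f t) \<le> C * exp (c\<^sup>2 / 4) * inverse (1 + t\<^sup>2)"
      using pos by (simp add: field_simps)
  qed (use C in auto)
qed

lemma exp_bounded_gauss_integrable:
  fixes f :: "real \<Rightarrow> 'a::{banach, second_countable_topology}"
  assumes "exp_bounded f" and [measurable]: "f \<in> borel_measurable borel"
  shows "integrable lborel (\<lambda>t. exp (- t\<^sup>2) *\<^sub>R f t)"
proof -
  obtain K where K: "0 \<le> K" "\<And>t. norm (exp (- t\<^sup>2) *\<^sub>R f t) \<le> K * inverse (1 + t\<^sup>2)"
    using exp_bounded_gauss_decay[OF assms(1)] by blast
  have "integrable lborel (\<lambda>t::real. inverse (1 + t\<^sup>2))"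
    using integrable_inverse_1_plus_square by (simp add: set_integrable_def einterval_def)
  then have "integrable lborel (\<lambda>t. K * inverse (1 + t\<^sup>2))"
    by (intro integrable_mult_right)
  then show ?thesis
    by (rule Bochner_Integration.integrable_bound) (use K in \<open>auto intro!: AE_I2 order_trans[OF K(2)]\<close>)
qed

text \<open>The filter is left open, subject to |t| tending to infinity, so that both ends of the
  line are covered.\<close>

lemma exp_bounded_gauss_tendsto_0:
  assumes f: "exp_bounded f" and F: "filterlim (\<lambda>t::real. \<bar>t\<bar>) at_top F"
  shows "((\<lambda>t. exp (- t\<^sup>2) *\<^sub>R f t) \<longlongrightarrow> 0) F"
proof -
  obtain K where K: "0 \<le> K" "\<And>t. norm (exp (- t\<^sup>2) *\<^sub>R f t) \<le> K * inverse (1 + t\<^sup>2)"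
    using exp_bounded_gauss_decay[OF f] by blast
  have "filterlim (\<lambda>t::real. 1 + t\<^sup>2) at_top F"
  proof -
    have "filterlim (\<lambda>t::real. 1 + \<bar>t\<bar> ^ 2) at_top F"
      by (intro filterlim_tendsto_add_at_top[OF tendsto_const] filterlim_pow_at_top F) auto
    then show ?thesis by simp
  qed
  then have "((\<lambda>t::real. K * inverse (1 + t\<^sup>2)) \<longlongrightarrow> K * 0) F"
    by (intro tendsto_mult tendsto_const tendsto_inverse_0_at_top)
  then have "((\<lambda>t::real. K * inverse (1 + t\<^sup>2)) \<longlongrightarrow> 0) F" by simp
  then show ?thesis
    by (rule Lim_null_comparison[rotated]) (intro always_eventually allI K)
qed

lemma filterlim_abs_real_at_bot: "filterlim (abs :: real \<Rightarrow> real) at_top at_bot"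
  by (subst filterlim_at_bot_mirror) (simp add: filterlim_abs_real)

text \<open>This is the form in which integration by parts enters: \<open>B\<close> will be the
  bilinear concomitant of two elements of the space, and the Gaussian removes its boundary
  values.\<close>

lemma integral_derivative_gauss_eq_0:
  fixes B :: "real \<Rightarrow> 'a::euclidean_space"
  assumes B: "\<And>t. ((\<lambda>t. exp (- t\<^sup>2) *\<^sub>R B t) has_vector_derivative exp (- t\<^sup>2) *\<^sub>R b t) (at t)"
    and cont: "continuous_on UNIV b" and bd: "exp_bounded B" "exp_bounded b"
  shows "(\<integral>t. exp (- t\<^sup>2) *\<^sub>R b t \<partial>lborel) = 0"
proof -
  have meas: "b \<in> borel_measurable borel"
    by (intro borel_measurable_continuous_onI cont)
  have "(LBINT t=-\<infinity>..\<infinity>. exp (- t\<^sup>2) *\<^sub>R b t) = 0 - 0"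
  proof (rule interval_integral_FTC_integrable[OF _ B])
    show "isCont (\<lambda>t. exp (- t\<^sup>2) *\<^sub>R b t) t" for t
      using cont by (auto intro!: continuous_intros simp: continuous_on_eq_continuous_at)
    show "set_integrable lborel (einterval (-\<infinity>) \<infinity>) (\<lambda>t. exp (- t\<^sup>2) *\<^sub>R b t)"
      using exp_bounded_gauss_integrable[OF bd(2) meas] by (simp add: set_integrable_def einterval_def)
    show "(((\<lambda>t. exp (- t\<^sup>2) *\<^sub>R B t) \<circ> real_of_ereal) \<longlongrightarrow> 0) (at_right (-\<infinity>))"
      unfolding ereal_tendsto_simps
      by (intro exp_bounded_gauss_tendsto_0 bd filterlim_abs_real_at_bot)
    show "(((\<lambda>t. exp (- t\<^sup>2) *\<^sub>R B t) \<circ> real_of_ereal) \<longlongrightarrow> 0) (at_left \<infinity>)"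
      unfolding ereal_tendsto_simps
      by (intro exp_bounded_gauss_tendsto_0 bd filterlim_abs_real)
  qed auto
  then show ?thesis
    by (simp add: interval_lebesgue_integral_def set_lebesgue_integral_def einterval_def)
qed

section \<open>The weight matrix\<close>

lemma trace_measure_eq:
  assumes U: "pos_matrix_measure U"
  shows "sets (trace_measure U) = sets borel" "space (trace_measure U) = UNIV"
    and "A \<in> sets borel \<Longrightarrow> emeasure (trace_measure U) A = ennreal (Re (trace (U A)))"
proof -
  have sub: "sets (borel :: real measure) \<subseteq> Pow UNIV" by simp
  show s: "sets (trace_measure U) = sets borel" and "space (trace_measure U) = UNIV"
    unfolding trace_measure_def
    using sets.sigma_sets_eq[of "borel :: real measure"]
    by (simp_all add: sets_measure_of_conv space_measure_of_conv)
  have nonneg: "0 \<le> Re (trace (U A))" if "A \<in> sets borel" for A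
    using U pos_semidef_diag[of "U A"] that by (auto simp: pos_matrix_measure_def trace_cmat2)
  have Re_trace: "(\<lambda>i. Re (trace (U (A i)))) sums Re (trace (U (\<Union>i. A i)))"
    if "range A \<subseteq> sets borel" "disjoint_family A" for A
    using U that unfolding pos_matrix_measure_def
    by (intro bounded_linear.sums[OF bounded_linear_Re_trace]) auto
  \<comment> \<open>The empty set is the disjoint union of infinitely many copies of itself, and a
    constant series converges only if its term is zero.\<close>
  have "U {} = 0"
  proof -
    have "(\<lambda>i::nat. U {}) sums U (\<Union>i::nat. {})"
      using U unfolding pos_matrix_measure_def by (auto simp: disjoint_family_on_def)
    then show ?thesis
      using sums_summable summable_const_iff by blast
  qed
  then have pos: "positive (sets (trace_measure U)) (\<lambda>A. ennreal (Re (trace (U A))))"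
    by (simp add: positive_def trace_cmat2)
  have ca: "countably_additive (sets (trace_measure U)) (\<lambda>A. ennreal (Re (trace (U A))))"
  proof (rule countably_additiveI)
    fix A :: "nat \<Rightarrow> real set"
    assume A: "range A \<subseteq> sets (trace_measure U)" "disjoint_family A"
    from A(1) have A': "range A \<subseteq> sets borel" by (simp add: s)
    have "(\<Sum>i. ennreal (Re (trace (U (A i))))) = ennreal (\<Sum>i. Re (trace (U (A i))))"
      using Re_trace[OF A' A(2)] A'
      by (intro suminf_ennreal2) (auto intro!: nonneg simp: sums_iff)
    also have "\<dots> = ennreal (Re (trace (U (\<Union>i. A i))))"
      using Re_trace[OF A' A(2)] by (simp add: sums_iff)
    finally show "(\<Sum>i. ennreal (Re (trace (U (A i))))) = ennreal (Re (trace (U (\<Union>i. A i))))" .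
  qed
  show "A \<in> sets borel \<Longrightarrow> emeasure (trace_measure U) A = ennreal (Re (trace (U A)))"
    using emeasure_measure_of[OF trace_measure_def sub pos ca] s by simp
qed

lemma set_lebesgue_integral_sums:
  fixes f :: "'a \<Rightarrow> 'b::{banach, second_countable_topology}"
  assumes [measurable]: "\<And>i::nat. A i \<in> sets M" and "disjoint_family A" "integrable M f"
  shows "(\<lambda>i. set_lebesgue_integral M (A i) f) sums set_lebesgue_integral M (\<Union>i. A i) f"
proof -
  have int: "set_integrable M B f" if "B \<in> sets M" for B
    using assms(3) that unfolding set_integrable_def by (intro integrable_mult_indicator)
  have eq: "(\<Sum>i<n. set_lebesgue_integral M (A i) f) = set_lebesgue_integral M (\<Union>i<n. A i) f" for n
  proof (induction n)
    case (Suc n)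
    have "A i \<inter> A n = {}" if "i < n" for i
      using that by (intro disjoint_family_onD[OF assms(2)]) auto
    then have "(\<Union>i<n. A i) \<inter> A n = {}" by blast
    then have "set_lebesgue_integral M ((\<Union>i<n. A i) \<union> A n) f
        = set_lebesgue_integral M (\<Union>i<n. A i) f + set_lebesgue_integral M (A n) f"
      by (intro set_integral_Un int) auto
    then show ?case using Suc by (simp add: lessThan_Suc Un_commute)
  qed (simp add: set_lebesgue_integral_def)
  have "incseq (\<lambda>n. \<Union>i<n. A i)" by (auto simp: incseq_def intro: less_le_trans)
  then have "(\<lambda>n. set_lebesgue_integral M (\<Union>i<n. A i) f) \<longlonglongrightarrow> set_lebesgue_integral M (\<Union>n. \<Union>i<n. A i) f"
    by (intro set_integral_cont_up int) auto
  moreover have "(\<Union>n. \<Union>i<n. A i) = (\<Union>i. A i)" by auto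
  ultimately show ?thesis by (simp add: sums_def eq)
qed

lemma indicator_sums:
  assumes "disjoint_family (A :: nat \<Rightarrow> 'a set)"
  shows "(\<lambda>i. indicator (A i) x :: real) sums indicator (\<Union>i. A i) x"
proof (cases "x \<in> (\<Union>i. A i)")
  case True
  then obtain i where i: "x \<in> A i" by blast
  have "x \<notin> A j" if "j \<noteq> i" for j
    using disjoint_family_onD[OF assms, of i j] that i by auto
  then have "(\<lambda>j. indicator (A j) x :: real) = (\<lambda>j. if j = i then 1 else 0)"
    using i by (auto simp: indicator_def)
  then show ?thesis using True sums_single[of i "\<lambda>_. 1 :: real"] by simp
next
  case False
  then have "(\<lambda>i. indicator (A i) x :: real) = (\<lambda>_. 0)" by (auto simp: indicator_def)
  then show ?thesis using False by simp
qed

text \<open>The rational factor of the weight. It is of class \<open>exp_bounded\<close>, so the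
  Gaussian can be handed separately to the decay estimates.\<close>

definition W0 :: "real \<Rightarrow> real \<Rightarrow> cmat2" where
  "W0 a t = (1 / (pp a t)\<^sup>2) *\<^sub>R mat22
     (of_real (a\<^sup>2 / (4 * (a\<^sup>2 - 2)) * (pp a t)\<^sup>2 + pp a t / (a\<^sup>2 - 2) - a\<^sup>2))
     (of_real (a * (pp a t / (a\<^sup>2 - 2) - 2) * t))
     (of_real (a * (pp a t / (a\<^sup>2 - 2) - 2) * t))
     (of_real (2 * (a\<^sup>2 * (a\<^sup>2 - 2) - pp a t) / (a\<^sup>2 - 2)\<^sup>2))"

lemma W_eq_W0: "W a t = exp (- t\<^sup>2) *\<^sub>R W0 a t"
  by (simp add: W_def W0_def)

definition Wn :: "real \<Rightarrow> real \<Rightarrow> cmat2" where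
  "Wn a t = (1 / sqrt pi) *\<^sub>R W a t"

locale exceptional_hermite =
  fixes a \<zeta> :: real
  assumes a: "a\<^sup>2 > 2" and zeta: "\<zeta> \<ge> 0"
begin

lemma a_nz: "a \<noteq> 0" using a by auto

text \<open>For a^2 > 2 both summands of the quadratic are nonpositive, which keeps the zeros of the
  denominator off the real line and its inverse powers bounded.\<close>

lemma pp_le: "pp a t \<le> - 2"
proof -
  have "2 * (2 - a\<^sup>2) * t\<^sup>2 \<le> 0"
    using a by (intro mult_nonpos_nonneg[of "2 * (2 - a\<^sup>2)"]) auto
  then show ?thesis using a by (simp add: pp_def)
qed

lemma pp_neg: "pp a t < 0" using pp_le[of t] by linarith
lemma pp_nz: "pp a t \<noteq> 0" using pp_neg[of t] by simp

lemma continuous_on_pp [continuous_intros]: "continuous_on S (pp a)"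
  unfolding pp_def by (intro continuous_intros)

lemma exp_bounded_inverse_pp [exp_bounded_intros]: "exp_bounded (\<lambda>t. 1 / pp a t)"
proof (rule exp_bounded_bounded[of _ 1])
  show "norm (1 / pp a t) \<le> 1" for t
    using pp_le[of t] by (simp add: abs_le_iff le_divide_eq divide_le_eq)
qed

lemma exp_bounded_inverse_pp_power [exp_bounded_intros]: "exp_bounded (\<lambda>t. 1 / pp a t ^ n)"
  using exp_bounded_power[OF exp_bounded_inverse_pp, of n] by (simp add: power_divide)

lemma exp_bounded_pp [exp_bounded_intros]: "exp_bounded (pp a)"
  unfolding pp_def by (intro exp_bounded_intros)

lemma continuous_on_W0 [continuous_intros]: "continuous_on S (W0 a)"
  unfolding W0_def using pp_nz a
  by (intro continuous_intros continuous_on_pp) auto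

lemma exp_bounded_W0 [exp_bounded_intros]: "exp_bounded (W0 a)"
proof -
  \<comment> \<open>Division by a constant is rewritten as multiplication by a constant, the form to
    which the closure rules apply.\<close>
  have d: "x / c = x * (1 / c)" for x c :: real by simp
  show ?thesis
    unfolding W0_def
    by (subst (2 3 4 5 6) d) (intro exp_bounded_intros)
qed

lemma continuous_on_W [continuous_intros]: "continuous_on S (W a)"
  unfolding W_eq_W0 by (intro continuous_intros continuous_on_W0)

lemma pos_def_W: "pos_def (W a t)"
  unfolding W_eq_W0 W0_def
proof (intro pos_def_scaleR pos_def_mat22_real)
  define b where "b = a\<^sup>2 - 2"
  have b: "b > 0" "a\<^sup>2 = b + 2" using a by (auto simp: b_def)
  have p: "pp a t = - 2 * b * t\<^sup>2 - (b + 2)"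
    by (simp add: pp_def b_def algebra_simps)
  show "0 < 2 * (a\<^sup>2 * (a\<^sup>2 - 2) - pp a t) / (a\<^sup>2 - 2)\<^sup>2"
  proof -
    have "0 < a\<^sup>2 * (a\<^sup>2 - 2)" using a by (intro mult_pos_pos) auto
    then show ?thesis using a pp_neg[of t] by (intro divide_pos_pos) auto
  qed
  \<comment> \<open>Apart from the scalar factor of the matrix, the determinant collapses to one
    positive term once t^2 is expressed through p.\<close>
  have "(a\<^sup>2 / (4 * b) * (pp a t)\<^sup>2 + pp a t / b - a\<^sup>2) * (2 * (a\<^sup>2 * b - pp a t) / b\<^sup>2)
      - (a * (pp a t / b - 2) * t)\<^sup>2 = (pp a t)\<^sup>2 * (b + 1) / (2 * b)"
  proof -
    have t2: "t\<^sup>2 = - (pp a t + b + 2) / (2 * b)" using b p by (simp add: field_simps)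
    have sq: "(a * (pp a t / b - 2) * t)\<^sup>2 = (b + 2) * (pp a t / b - 2)\<^sup>2 * (- (pp a t + b + 2) / (2 * b))"
      by (simp only: power_mult_distrib b(2) t2)
    show ?thesis
      unfolding sq b(2) using b(1) by (simp add: field_simps power2_eq_square)
  qed
  also have "\<dots> > 0" using b pp_nz[of t] by (intro divide_pos_pos mult_pos_pos) auto
  finally show "0 < (a\<^sup>2 / (4 * (a\<^sup>2 - 2)) * (pp a t)\<^sup>2 + pp a t / (a\<^sup>2 - 2) - a\<^sup>2)
      * (2 * (a\<^sup>2 * (a\<^sup>2 - 2) - pp a t) / (a\<^sup>2 - 2)\<^sup>2) - (a * (pp a t / (a\<^sup>2 - 2) - 2) * t)\<^sup>2"
    by (simp add: b_def)
qed (use pp_nz in auto)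

lemma pos_def_Wn: "pos_def (Wn a t)"
  unfolding Wn_def by (intro pos_def_scaleR pos_def_W) auto

lemma continuous_on_Wn: "continuous_on S (Wn a)"
  unfolding Wn_def by (intro continuous_intros continuous_on_W)

lemma measurable_Wn [measurable]: "Wn a \<in> borel_measurable borel"
  by (intro borel_measurable_continuous_onI continuous_on_Wn)

lemma integrable_Wn:
  fixes q :: "real \<Rightarrow> real"
  assumes [measurable]: "q \<in> borel_measurable borel" and "exp_bounded q"
  shows "integrable lborel (\<lambda>t. q t *\<^sub>R Wn a t)"
proof -
  have [measurable]: "W0 a \<in> borel_measurable borel"
    by (intro borel_measurable_continuous_onI continuous_on_W0)
  have "integrable lborel (\<lambda>t. exp (- t\<^sup>2) *\<^sub>R ((1 / sqrt pi) *\<^sub>R q t *\<^sub>R W0 a t))"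
    by (intro exp_bounded_gauss_integrable exp_bounded_intros assms exp_bounded_W0) measurable
  then show ?thesis by (simp add: Wn_def W_eq_W0 mult_ac)
qed

lemma integrable_Wn': "integrable lborel (Wn a)"
  using integrable_Wn[of "\<lambda>_. 1"] by (simp add: exp_bounded_const)

lemma V_eq:
  assumes "A \<in> sets borel"
  shows "V a \<zeta> A = set_lebesgue_integral lborel A (Wn a) + (\<zeta> * indicator A 0) *\<^sub>R mat22 0 0 0 1"
  unfolding V_def Wn_def set_lebesgue_integral_def
  by (subst integral_scaleR_right[symmetric]) (simp add: mult.commute)

lemma pos_matrix_measure_V: "pos_matrix_measure (V a \<zeta>)"
  unfolding pos_matrix_measure_def
proof (intro conjI ballI allI impI)
  fix A :: "real set" assume A [measurable]: "A \<in> sets borel"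
  have int: "integrable lborel (\<lambda>t. indicator A t *\<^sub>R Wn a t)"
    using integrable_Wn' by (intro integrable_mult_indicator) auto
  have "pos_semidef (set_lebesgue_integral lborel A (Wn a))"
    unfolding pos_semidef_def set_lebesgue_integral_def
  proof
    fix v
    have "quad_form (\<integral>t. indicator A t *\<^sub>R Wn a t \<partial>lborel) v
        = (\<integral>t. quad_form (indicator A t *\<^sub>R Wn a t) v \<partial>lborel)"
      by (rule integral_bounded_linear[OF bounded_linear_quad_form int, symmetric])
    also have "(\<lambda>t. quad_form (indicator A t *\<^sub>R Wn a t) v)
        = (\<lambda>t. of_real (indicator A t * Re (quad_form (Wn a t) v)))"
      using pos_semidef_quad(2)[OF pos_def_imp_pos_semidef[OF pos_def_Wn]]
      by (auto simp: quad_form_scaleR complex_eq_iff)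
    also have "(\<integral>t. complex_of_real (indicator A t * Re (quad_form (Wn a t) v)) \<partial>lborel)
        = complex_of_real (\<integral>t. indicator A t * Re (quad_form (Wn a t) v) \<partial>lborel)"
      by (rule integral_complex_of_real)
    finally show "Im (quad_form (\<integral>t. indicator A t *\<^sub>R Wn a t \<partial>lborel) v) = 0 \<and>
        0 \<le> Re (quad_form (\<integral>t. indicator A t *\<^sub>R Wn a t \<partial>lborel) v)"
      using pos_semidef_quad(1)[OF pos_def_imp_pos_semidef[OF pos_def_Wn]]
      by (simp add: integral_nonneg_AE)
  qed
  then show "pos_semidef (V a \<zeta> A)"
    unfolding V_eq[OF A] using zeta
    by (intro pos_semidef_add pos_semidef_scaleR pos_semidef_unit) auto
next
  fix A :: "nat \<Rightarrow> real set" assume A: "range A \<subseteq> sets borel" "disjoint_family A"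
  show "(\<lambda>i. V a \<zeta> (A i)) sums V a \<zeta> (\<Union>i. A i)"
  proof -
    have "(\<lambda>i. set_lebesgue_integral lborel (A i) (Wn a) + (\<zeta> * indicator (A i) 0) *\<^sub>R mat22 0 0 0 1)
        sums (set_lebesgue_integral lborel (\<Union>i. A i) (Wn a) + (\<zeta> * indicator (\<Union>i. A i) 0) *\<^sub>R mat22 0 0 0 1)"
      using A integrable_Wn'
      by (intro sums_add set_lebesgue_integral_sums sums_scaleR_left sums_mult indicator_sums) auto
    moreover have "A i \<in> sets borel" for i using A by auto
    ultimately show ?thesis by (subst V_eq) (auto simp: V_eq)
  qed
qed

section \<open>The trace measure of the weight and its matrix density\<close>

abbreviation "\<mu> \<equiv> trace_measure (V a \<zeta>)"

lemmas sets_mu [measurable_cong, simp] = trace_measure_eq(1)[OF pos_matrix_measure_V]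
lemmas space_mu [simp] = trace_measure_eq(2)[OF pos_matrix_measure_V]

definition w :: "real \<Rightarrow> real" where "w t = Re (trace (Wn a t))"

lemma w_pos: "w t > 0"
proof -
  have "Re (quad_form (Wn a t) (vector [1, 0])) > 0" "Re (quad_form (Wn a t) (vector [0, 1])) > 0"
    using pos_def_Wn[of t] unfolding pos_def_def by (auto simp: vec_eq_iff forall_2)
  then show ?thesis by (simp add: w_def trace_cmat2 quad_form_cmat2)
qed

lemma w_nonneg: "w t \<ge> 0"
  using w_pos[of t] by simp

lemma measurable_w [measurable]: "w \<in> borel_measurable borel"
  unfolding w_def trace_cmat2 by measurable

lemma integrable_w: 
  assumes "q \<in> borel_measurable borel" "exp_bounded q"
  shows "integrable lborel (\<lambda>t. w t * q t)"
  using integrable_bounded_linear[OF bounded_linear_Re_trace integrable_Wn[OF assms]]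
  by (simp add: w_def trace_cmat2 algebra_simps)

lemma emeasure_mu:
  assumes [measurable]: "A \<in> sets borel"
  shows "emeasure \<mu> A = (\<integral>\<^sup>+t\<in>A. ennreal (w t) \<partial>lborel) + ennreal (\<zeta> * indicator A 0)"
proof -
  have int: "integrable lborel (\<lambda>t. indicator A t *\<^sub>R Wn a t)"
    using integrable_Wn' by (intro integrable_mult_indicator) auto
  have intw: "integrable lborel (\<lambda>t. indicator A t * w t)"
    using integrable_mult_indicator[OF _ integrable_w[of "\<lambda>_. 1"], of A] by (simp add: exp_bounded_const)
  have "Re (trace (V a \<zeta> A)) = Re (trace (\<integral>t. indicator A t *\<^sub>R Wn a t \<partial>lborel)) + \<zeta> * indicator A 0"
    by (simp add: V_eq trace_cmat2 set_lebesgue_integral_def)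
  also have "Re (trace (\<integral>t. indicator A t *\<^sub>R Wn a t \<partial>lborel)) = (\<integral>t. indicator A t * w t \<partial>lborel)"
    using integral_bounded_linear[OF bounded_linear_Re_trace int]
    by (simp add: w_def trace_cmat2 algebra_simps)
  finally have "emeasure \<mu> A = ennreal ((\<integral>t. indicator A t * w t \<partial>lborel) + \<zeta> * indicator A 0)"
    by (simp add: trace_measure_eq(3)[OF pos_matrix_measure_V])
  also have "\<dots> = ennreal (\<integral>t. indicator A t * w t \<partial>lborel) + ennreal (\<zeta> * indicator A 0)"
    using w_nonneg zeta by (intro ennreal_plus integral_nonneg_AE) (auto intro!: AE_I2 mult_nonneg_nonneg)
  also have "ennreal (\<integral>t. indicator A t * w t \<partial>lborel) = (\<integral>\<^sup>+t. ennreal (indicator A t * w t) \<partial>lborel)"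
    using w_nonneg intw by (intro nn_integral_eq_integral[symmetric]) (auto intro!: AE_I2 mult_nonneg_nonneg)
  also have "\<dots> = (\<integral>\<^sup>+t\<in>A. ennreal (w t) \<partial>lborel)"
    by (intro nn_integral_cong) (simp add: indicator_def)
  finally show ?thesis .
qed

lemma AE_lborel_nonzero: "AE t in lborel. t \<noteq> (0::real)"
  by (rule AE_lborel_singleton)

lemma emeasure_mu_zero: "emeasure \<mu> {0} = ennreal \<zeta>"
proof -
  have "(\<integral>\<^sup>+t\<in>{0}. ennreal (w t) \<partial>lborel) = (\<integral>\<^sup>+t. 0 \<partial>(lborel :: real measure))"
    by (rule nn_integral_cong_AE) (use AE_lborel_nonzero in eventually_elim, auto)
  then show ?thesis by (simp add: emeasure_mu)
qed

text \<open>Lebesgue measure does not charge the origin, so removing it from \<open>\<mu>\<close>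
  leaves exactly the absolutely continuous part. Integrals over \<open>\<mu>\<close> are then split
  at the origin, which contributes its mass \<open>\<zeta>\<close>.\<close>

lemma density_mu: "density \<mu> (indicator (- {0})) = density lborel (\<lambda>t. ennreal (w t))"
proof (rule measure_eqI)
  fix A assume "A \<in> sets (density \<mu> (indicator (- {0})))"
  then have A [measurable]: "A \<in> sets borel" by simp
  have "emeasure (density \<mu> (indicator (- {0}))) A = (\<integral>\<^sup>+t. indicator (- {0}) t * indicator A t \<partial>\<mu>)"
    by (subst emeasure_density) auto
  also have "\<dots> = (\<integral>\<^sup>+t. indicator (A - {0}) t \<partial>\<mu>)"
    by (intro nn_integral_cong) (auto simp: indicator_def)
  also have "\<dots> = emeasure \<mu> (A - {0})" by (subst nn_integral_indicator) auto
  also have "\<dots> = (\<integral>\<^sup>+t\<in>A - {0}. ennreal (w t) \<partial>lborel)" by (simp add: emeasure_mu)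
  also have "\<dots> = (\<integral>\<^sup>+t\<in>A. ennreal (w t) \<partial>lborel)"
    by (rule nn_integral_cong_AE) (use AE_lborel_nonzero in eventually_elim, auto simp: indicator_def)
  also have "\<dots> = emeasure (density lborel (\<lambda>t. ennreal (w t))) A"
    by (subst emeasure_density) auto
  finally show "emeasure (density \<mu> (indicator (- {0}))) A = emeasure (density lborel (\<lambda>t. ennreal (w t))) A" .
qed auto

lemma has_bochner_integral_mu:
  fixes h :: "real \<Rightarrow> 'b::{banach, second_countable_topology}"
  assumes [measurable]: "h \<in> borel_measurable borel" and int: "integrable lborel (\<lambda>t. w t *\<^sub>R h t)"
  shows "has_bochner_integral \<mu> h ((\<integral>t. w t *\<^sub>R h t \<partial>lborel) + \<zeta> *\<^sub>R h 0)"
proof -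
  have "has_bochner_integral (density lborel (\<lambda>t. ennreal (w t))) h (\<integral>t. w t *\<^sub>R h t \<partial>lborel)"
    using int w_pos by (simp add: has_bochner_integral_iff integrable_density integral_density less_imp_le)
  then have "has_bochner_integral (density \<mu> (\<lambda>t. ennreal (indicator (- {0}) t))) h (\<integral>t. w t *\<^sub>R h t \<partial>lborel)"
    by (simp add: density_mu[symmetric] ennreal_indicator)
  then have 1: "has_bochner_integral \<mu> (\<lambda>t. indicator (- {0}) t *\<^sub>R h t) (\<integral>t. w t *\<^sub>R h t \<partial>lborel)"
    by (simp add: has_bochner_integral_iff integrable_density integral_density)
  have "has_bochner_integral \<mu> (\<lambda>t. indicator {0} t *\<^sub>R h 0) (measure \<mu> {0} *\<^sub>R h 0)"
    by (intro has_bochner_integral_scaleR_left has_bochner_integral_real_indicator)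
      (auto simp: emeasure_mu_zero)
  moreover have "measure \<mu> {0} = \<zeta>" using zeta by (simp add: measure_def emeasure_mu_zero)
  ultimately have "has_bochner_integral \<mu> (\<lambda>t. indicator {0} t *\<^sub>R h 0) (\<zeta> *\<^sub>R h 0)" by simp
  from has_bochner_integral_add[OF 1 this]
  have "has_bochner_integral \<mu> (\<lambda>t. indicator (- {0}) t *\<^sub>R h t + indicator {0} t *\<^sub>R h 0)
    ((\<integral>t. w t *\<^sub>R h t \<partial>lborel) + \<zeta> *\<^sub>R h 0)" .
  moreover have "(\<lambda>t. indicator (- {0}) t *\<^sub>R h t + indicator {0} t *\<^sub>R h 0) = h"
    by (auto simp: indicator_def)
  ultimately show ?thesis by simp
qed

text \<open>Away from the origin this is the Lebesgue density divided by its trace. At the origin,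
  an atom when \<open>\<zeta>\<close> is positive, the value has to be the trace-one matrix of the
  point mass.\<close>

definition Phi0 :: "real \<Rightarrow> cmat2" where
  "Phi0 t = (if t = 0 then mat22 0 0 0 1 else (1 / w t) *\<^sub>R Wn a t)"

lemma measurable_Phi0 [measurable]: "Phi0 \<in> borel_measurable borel"
  unfolding Phi0_def[abs_def] by measurable

lemma pos_semidef_Phi0: "pos_semidef (Phi0 t)"
  using w_pos[of t] pos_semidef_scaleR[OF _ pos_def_imp_pos_semidef[OF pos_def_Wn]]
  by (auto simp: Phi0_def pos_semidef_unit less_imp_le)

lemma trace_Phi0: "Re (trace (Phi0 t)) = 1"
  using w_pos[of t] by (auto simp: Phi0_def trace_cmat2 w_def add_divide_distrib[symmetric])

text \<open>Linearity of \<open>h t\<close> lets the factor \<open>w t\<close> cancel against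
  \<open>1 / w t\<close>. A general family \<open>h\<close> treats restriction to a set, moments and
  products f X g^* alike.\<close>

lemma Phi0_integral:
  fixes h :: "real \<Rightarrow> cmat2 \<Rightarrow> cmat2"
  assumes lin: "\<And>t. linear (h t)" and [measurable]: "(\<lambda>t. h t (Phi0 t)) \<in> borel_measurable borel"
    and int: "integrable lborel (\<lambda>t. h t (Wn a t))"
  shows "has_bochner_integral \<mu> (\<lambda>t. h t (Phi0 t))
    ((\<integral>t. h t (Wn a t) \<partial>lborel) + \<zeta> *\<^sub>R h 0 (mat22 0 0 0 1))"
proof -
  have AE: "AE t in lborel. w t *\<^sub>R h t (Phi0 t) = h t (Wn a t)"
    using AE_lborel_nonzero
  proof eventually_elim
    case (elim t)
    then show ?case using w_pos[of t] by (simp add: Phi0_def linear_cmul[OF lin])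
  qed
  have m: "(\<lambda>t. w t *\<^sub>R h t (Phi0 t)) \<in> borel_measurable lborel"
    "(\<lambda>t. h t (Wn a t)) \<in> borel_measurable lborel"
    using borel_measurable_integrable[OF int] by measurable
  have "integrable lborel (\<lambda>t. w t *\<^sub>R h t (Phi0 t))"
    using int unfolding integrable_cong_AE[OF m AE] .
  moreover have "(\<integral>t. w t *\<^sub>R h t (Phi0 t) \<partial>lborel) = (\<integral>t. h t (Wn a t) \<partial>lborel)"
    by (rule integral_cong_AE[OF m AE])
  moreover have "Phi0 0 = mat22 0 0 0 1" by (simp add: Phi0_def)
  ultimately show ?thesis
    using has_bochner_integral_mu[of "\<lambda>t. h t (Phi0 t)"] assms(2) by simp
qed

lemma is_trace_density_Phi0: "is_trace_density (V a \<zeta>) Phi0"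
  unfolding is_trace_density_def
proof (intro conjI allI ballI measurable_Phi0 pos_semidef_Phi0)
  fix A :: "real set" assume A [measurable]: "A \<in> sets borel"
  have "has_bochner_integral \<mu> (\<lambda>t. indicator A t *\<^sub>R Phi0 t)
      ((\<integral>t. indicator A t *\<^sub>R Wn a t \<partial>lborel) + \<zeta> *\<^sub>R (indicator A 0 *\<^sub>R mat22 0 0 0 1))"
    using integrable_Wn'
    by (intro Phi0_integral[of "\<lambda>t X. indicator A t *\<^sub>R X"] integrable_mult_indicator)
      (auto intro: linear_scale_self)
  then show "set_integrable \<mu> A Phi0" "V a \<zeta> A = set_lebesgue_integral \<mu> A Phi0"
    unfolding set_integrable_def set_lebesgue_integral_def V_eq[OF A]
    by (auto simp: has_bochner_integral_iff)
qed

abbreviation "\<Phi> \<equiv> trace_density (V a \<zeta>)"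

lemma is_trace_density: "is_trace_density (V a \<zeta>) \<Phi>"
  unfolding trace_density_def by (rule someI[of "is_trace_density (V a \<zeta>)"]) (rule is_trace_density_Phi0)

lemma measurable_trace_density [measurable]: "\<Phi> \<in> borel_measurable borel"
  using is_trace_density by (simp add: is_trace_density_def)

lemma finite_measure_mu: "finite_measure \<mu>"
  by (rule finite_measureI) (simp add: trace_measure_eq(3)[OF pos_matrix_measure_V])

text \<open>\<open>trace_density\<close> is picked by the choice operator, so nothing is known about
  its values. Densities with the same integral over every Borel set agree almost everywhere, and
  this transfers all computations to \<open>Phi0\<close>.\<close>

lemma AE_trace_density: "AE t in \<mu>. \<Phi> t = Phi0 t"
proof (rule sigma_finite_measure.density_unique_banach)
  show "sigma_finite_measure \<mu>"
    using finite_measure_mu finite_measure.sigma_finite_measure by blast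
  have *: "integrable \<mu> \<Psi>" if "is_trace_density (V a \<zeta>) \<Psi>" for \<Psi>
    using that unfolding is_trace_density_def set_integrable_def
    by (auto dest: bspec[of _ _ UNIV])
  show "integrable \<mu> \<Phi>" "integrable \<mu> Phi0"
    by (intro * is_trace_density is_trace_density_Phi0)+
  show "A \<in> sets \<mu> \<Longrightarrow> set_lebesgue_integral \<mu> A \<Phi> = set_lebesgue_integral \<mu> A Phi0" for A
    using is_trace_density is_trace_density_Phi0 by (simp add: is_trace_density_def)
qed

text \<open>Measurability is assumed for every \<open>\<Psi>\<close> since it is applied both to the
  chosen density and to \<open>Phi0\<close>.\<close>

lemma trace_density_integral:
  fixes h :: "real \<Rightarrow> cmat2 \<Rightarrow> cmat2"
  assumes lin: "\<And>t. linear (h t)"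
    and [measurable]: "\<And>\<Psi>. \<Psi> \<in> borel_measurable borel \<Longrightarrow> (\<lambda>t. h t (\<Psi> t)) \<in> borel_measurable borel"
    and int: "integrable lborel (\<lambda>t. h t (Wn a t))"
  shows "has_bochner_integral \<mu> (\<lambda>t. h t (\<Phi> t))
    ((\<integral>t. h t (Wn a t) \<partial>lborel) + \<zeta> *\<^sub>R h 0 (mat22 0 0 0 1))"
proof -
  have AE: "AE t in \<mu>. h t (Phi0 t) = h t (\<Phi> t)"
    using AE_trace_density by eventually_elim simp
  show ?thesis
    using Phi0_integral[OF lin _ int]
    by (subst has_bochner_integral_cong_AE[OF _ _ AE, symmetric]) measurable
qed

lemma weight_matrix_V: "weight_matrix (V a \<zeta>)"
  unfolding weight_matrix_def
proof (intro conjI allI pos_matrix_measure_V)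
  fix n :: nat
  have "has_bochner_integral \<mu> (\<lambda>t. t ^ n *\<^sub>R \<Phi> t)
    ((\<integral>t. t ^ n *\<^sub>R Wn a t \<partial>lborel) + \<zeta> *\<^sub>R (0 ^ n *\<^sub>R mat22 0 0 0 1))"
    by (intro trace_density_integral[of "\<lambda>t X. t ^ n *\<^sub>R X"] integrable_Wn exp_bounded_intros)
      (auto intro: linear_scale_self)
  then show "integrable \<mu> (\<lambda>t. t ^ n *\<^sub>R \<Phi> t)" by (auto simp: has_bochner_integral_iff)
qed

end

section \<open>Density of polynomial multiples\<close>

text \<open>Polynomials of degree strictly less than \<open>n\<close>; only \<open>0\<close> for \<open>n = 0\<close>.\<close>

definition mdeg :: "nat \<Rightarrow> (real \<Rightarrow> cmat2) \<Rightarrow> bool" where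
  "mdeg n f \<longleftrightarrow> (\<exists>A. \<forall>t. f t = (\<Sum>k<n. t ^ k *\<^sub>R A k))"

lemma mdeg_mono:
  assumes "mdeg n f" "n \<le> m"
  shows "mdeg m f"
proof -
  obtain A where A: "\<And>t. f t = (\<Sum>k<n. t ^ k *\<^sub>R A k)"
    using assms(1) unfolding mdeg_def by blast
  have "f t = (\<Sum>k<m. t ^ k *\<^sub>R (if k < n then A k else 0))" for t
    unfolding A by (rule sum.mono_neutral_cong_left) (use assms(2) in auto)
  then show ?thesis
    unfolding mdeg_def by (intro exI[of _ "\<lambda>k. if k < n then A k else 0"] allI)
qed

lemma mdeg_zero: "mdeg n (\<lambda>t. 0)"
  unfolding mdeg_def by (intro exI[of _ "\<lambda>_. 0"]) simp

lemma mdeg_add: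
  assumes "mdeg n f" "mdeg n g"
  shows "mdeg n (\<lambda>t. f t + g t)"
proof -
  obtain A B where "\<And>t. f t = (\<Sum>k<n. t ^ k *\<^sub>R A k)" "\<And>t. g t = (\<Sum>k<n. t ^ k *\<^sub>R B k)"
    using assms unfolding mdeg_def by blast
  then show ?thesis
    unfolding mdeg_def by (intro exI[of _ "\<lambda>k. A k + B k"]) (simp add: scaleR_add_right sum.distrib)
qed

lemma mdeg_linear:
  assumes "linear h" "mdeg n f"
  shows "mdeg n (\<lambda>t. h (f t))"
proof -
  obtain A where "\<And>t. f t = (\<Sum>k<n. t ^ k *\<^sub>R A k)"
    using assms(2) unfolding mdeg_def by blast
  then show ?thesis
    unfolding mdeg_def
    by (intro exI[of _ "\<lambda>k. h (A k)"]) (simp add: linear_sum[OF assms(1)] linear_cmul[OF assms(1)])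
qed

lemma linear_cmat2_mult_left: "linear (\<lambda>X :: cmat2. (C :: cmat2) ** X)"
  by (auto intro!: linearI simp: cmat2_eq_iff algebra_simps)

lemma linear_cmat2_mult_right: "linear (\<lambda>X :: cmat2. X ** (C :: cmat2))"
  by (auto intro!: linearI simp: cmat2_eq_iff algebra_simps)

lemmas mdeg_mult_left = mdeg_linear[OF linear_cmat2_mult_left]
lemmas mdeg_mult_right = mdeg_linear[OF linear_cmat2_mult_right]

lemma mdeg_minus: "mdeg n f \<Longrightarrow> mdeg n (\<lambda>t. - f t)"
  by (rule mdeg_linear[OF linear_uminus])

lemma mdeg_diff: "mdeg n f \<Longrightarrow> mdeg n g \<Longrightarrow> mdeg n (\<lambda>t. f t - g t)"
  using mdeg_add[of n f "\<lambda>t. - g t"] by (simp add: mdeg_minus)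

lemma mdeg_sum: "(\<And>i. i \<in> I \<Longrightarrow> mdeg n (f i)) \<Longrightarrow> mdeg n (\<lambda>t. \<Sum>i\<in>I. f i t)"
  by (induction I rule: infinite_finite_induct) (simp_all add: mdeg_zero mdeg_add)

lemma mdeg_monom: "k < n \<Longrightarrow> mdeg n (\<lambda>t. t ^ k *\<^sub>R A)"
  unfolding mdeg_def
  by (intro exI[of _ "\<lambda>j. if j = k then A else 0"])
    (simp add: if_distrib[of "\<lambda>X. _ *\<^sub>R X"] sum.delta cong: if_cong)

lemma mdeg_times_power:
  assumes "mdeg n f"
  shows "mdeg (n + j) (\<lambda>t. t ^ j *\<^sub>R f t)"
proof -
  obtain A where A: "\<And>t. f t = (\<Sum>k<n. t ^ k *\<^sub>R A k)"
    using assms unfolding mdeg_def by blast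
  have "mdeg (n + j) (\<lambda>t. \<Sum>k<n. t ^ (j + k) *\<^sub>R A k)"
    by (intro mdeg_sum mdeg_monom) auto
  then show ?thesis by (simp add: A scaleR_sum_right power_add)
qed

lemma mdeg_derivative:
  assumes "mdeg n f"
  obtains f' where "mdeg (n - 1) f'" "\<And>t. (f has_vector_derivative f' t) (at t)"
proof -
  obtain A where A: "\<And>t. f t = (\<Sum>k<n. t ^ k *\<^sub>R A k)"
    using assms unfolding mdeg_def by blast
  \<comment> \<open>For \<open>k = 0\<close> the truncated exponent \<open>k - 1\<close> is 0, but
    the factor \<open>real k\<close> removes that term.\<close>
  let ?f' = "\<lambda>t. \<Sum>k<n. t ^ (k - 1) *\<^sub>R (real k *\<^sub>R A k)"
  have "mdeg (n - 1) ?f'"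
  proof (intro mdeg_sum)
    fix k assume "k \<in> {..<n}"
    then show "mdeg (n - 1) (\<lambda>t. t ^ (k - 1) *\<^sub>R (real k *\<^sub>R A k))"
      by (cases k) (auto simp: mdeg_zero simp del: scaleR_scaleR of_nat_Suc intro!: mdeg_monom)
  qed
  moreover have "(f has_vector_derivative ?f' t) (at t)" for t
  proof -
    have "((\<lambda>t. \<Sum>k<n. t ^ k *\<^sub>R A k) has_vector_derivative ?f' t) (at t)"
      by (rule has_vector_derivative_sum)
        (auto intro!: derivative_eq_intros simp: has_real_derivative_iff_has_vector_derivative[symmetric])
    moreover have "f = (\<lambda>t. \<Sum>k<n. t ^ k *\<^sub>R A k)" by (rule ext) (rule A)
    ultimately show ?thesis by simp
  qed
  ultimately show ?thesis by (rule that)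
qed

lemma mdeg_continuous_on:
  assumes "mdeg n f"
  shows "continuous_on S f"
proof -
  obtain A where "\<And>t. f t = (\<Sum>k<n. t ^ k *\<^sub>R A k)"
    using assms unfolding mdeg_def by blast
  then have "f = (\<lambda>t. \<Sum>k<n. t ^ k *\<^sub>R A k)" by auto
  then show ?thesis by (simp only:) (intro continuous_intros)
qed

lemma mdeg_measurable: "mdeg n f \<Longrightarrow> f \<in> borel_measurable borel"
  by (intro borel_measurable_continuous_onI mdeg_continuous_on)

lemma mdeg_exp_bounded:
  assumes "mdeg n f"
  shows "exp_bounded f"
proof -
  obtain A where "\<And>t. f t = (\<Sum>k<n. t ^ k *\<^sub>R A k)"
    using assms unfolding mdeg_def by blast
  then have "f = (\<lambda>t. \<Sum>k<n. t ^ k *\<^sub>R A k)" by auto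
  then show ?thesis by (simp only:) (intro exp_bounded_intros)
qed

lemma real_polynomial_function_mdeg:
  assumes "real_polynomial_function (q :: real \<Rightarrow> real)"
  shows "\<exists>n. mdeg n (\<lambda>t. q t *\<^sub>R X)"
proof -
  obtain c n where q: "q = (\<lambda>x. \<Sum>i\<le>n. c i * x ^ i)"
    using assms unfolding real_polynomial_function_iff_sum by blast
  have "mdeg (Suc n) (\<lambda>t. \<Sum>i\<le>n. t ^ i *\<^sub>R (c i *\<^sub>R X))"
    by (intro mdeg_sum mdeg_monom) auto
  then show ?thesis
    by (intro exI[of _ "Suc n"]) (simp add: q scaleR_sum_left mult.commute)
qed

lemma mdeg_sum_ex:
  assumes "finite I" "\<And>i. i \<in> I \<Longrightarrow> \<exists>n. mdeg n (f i)"
  shows "\<exists>n. mdeg n (\<lambda>t. \<Sum>i\<in>I. f i t)"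
proof -
  obtain N where N: "\<And>i. i \<in> I \<Longrightarrow> mdeg (N i) (f i)"
    using assms(2) by metis
  \<comment> \<open>The sum of the individual degree bounds is a convenient common bound.\<close>
  have "mdeg (\<Sum>i\<in>I. N i) (f i)" if "i \<in> I" for i
    using N[OF that] assms(1) that by (rule_tac mdeg_mono) (auto intro: member_le_sum)
  then show ?thesis using mdeg_sum by blast
qed

lemma norm_cmat2_squared:
  fixes X :: cmat2
  shows "(norm (X $ 1 $ 1))\<^sup>2 + (norm (X $ 1 $ 2))\<^sup>2 + ((norm (X $ 2 $ 1))\<^sup>2 + (norm (X $ 2 $ 2))\<^sup>2) = (norm X)\<^sup>2"
  by (simp add: norm_vec_def L2_set_def sum_2 sum_nonneg)

lemma norm_squared_Basis:
  fixes X :: "'a::euclidean_space"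
  shows "(norm X)\<^sup>2 = (\<Sum>c\<in>Basis. (X \<bullet> c)\<^sup>2)"
  unfolding power2_norm_eq_inner by (subst euclidean_inner) (simp add: power2_eq_square)

section \<open>The norm of the weighted L^2 space and approximation by multiples of p^2\<close>

context exceptional_hermite
begin

abbreviation energy :: "real \<Rightarrow> cmat2 \<Rightarrow> real" where
  "energy t X \<equiv> Re (trace (X ** \<Phi> t ** adj X))"

lemma pos_semidef_trace_density: "pos_semidef (\<Phi> t)"
  using is_trace_density by (simp add: is_trace_density_def)

lemma energy_nonneg: "energy t X \<ge> 0"
  unfolding trace_congruence using pos_semidef_quad(1)[OF pos_semidef_trace_density] by simp

lemma energy_add_le: "energy t (X + Y) \<le> 2 * energy t X + 2 * energy t Y"
proof -
  have "energy t (X + Y) + energy t (X - Y) = 2 * energy t X + 2 * energy t Y"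
    by (simp add: trace_congruence quad_form_cmat2 algebra_simps)
  then show ?thesis using energy_nonneg[of "X - Y" t] by linarith
qed

text \<open>\<open>Phi0\<close> has trace one, so its quadratic form is at most twice the squared
  norm. The quantifier over \<open>X\<close> sits inside the almost everywhere statement because
  \<open>X\<close> will depend on t.\<close>

lemma energy_le: "AE t in \<mu>. \<forall>X. energy t X \<le> 2 * (norm X)\<^sup>2"
  using AE_trace_density
proof eventually_elim
  case (elim t)
  show ?case
  proof
    fix X :: cmat2
    have "energy t X \<le> 2 * ((norm (X $ 1 $ 1))\<^sup>2 + (norm (X $ 1 $ 2))\<^sup>2)
        + 2 * ((norm (X $ 2 $ 1))\<^sup>2 + (norm (X $ 2 $ 2))\<^sup>2)"
      using pos_semidef_quad_le[OF pos_semidef_Phi0, of t "X $ 1"]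
        pos_semidef_quad_le[OF pos_semidef_Phi0, of t "X $ 2"]
      unfolding trace_congruence elim trace_Phi0 by simp
    also have "\<dots> = 2 * (norm X)\<^sup>2"
      unfolding norm_cmat2_squared[symmetric] by simp
    finally show "energy t X \<le> 2 * (norm X)\<^sup>2" .
  qed
qed

lemma measurable_energy [measurable]:
  assumes [measurable]: "f \<in> borel_measurable borel"
  shows "(\<lambda>t. energy t (f t)) \<in> borel_measurable borel"
  unfolding trace_cmat2 by measurable

lemma L2_norm_sq_add_le:
  assumes [measurable]: "f \<in> borel_measurable borel" "g \<in> borel_measurable borel"
  shows "L2_norm_sq (V a \<zeta>) (\<lambda>t. f t + g t) \<le> 2 * L2_norm_sq (V a \<zeta>) f + 2 * L2_norm_sq (V a \<zeta>) g"
proof -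
  have "L2_norm_sq (V a \<zeta>) (\<lambda>t. f t + g t)
      \<le> (\<integral>\<^sup>+t. 2 * ennreal (energy t (f t)) + 2 * ennreal (energy t (g t)) \<partial>\<mu>)"
    unfolding L2_norm_sq_def
  proof (rule nn_integral_mono)
    fix t
    have "ennreal (energy t (f t + g t)) \<le> ennreal (2 * energy t (f t) + 2 * energy t (g t))"
      by (intro ennreal_leI energy_add_le)
    then show "ennreal (energy t (f t + g t)) \<le> 2 * ennreal (energy t (f t)) + 2 * ennreal (energy t (g t))"
      using energy_nonneg by (simp add: ennreal_plus ennreal_mult)
  qed
  also have "\<dots> = 2 * L2_norm_sq (V a \<zeta>) f + 2 * L2_norm_sq (V a \<zeta>) g"
    unfolding L2_norm_sq_def by (subst nn_integral_add) (auto simp: nn_integral_cmult)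
  finally show ?thesis .
qed

lemma integrable_mu_exp_bounded:
  assumes [measurable]: "q \<in> borel_measurable borel" and "exp_bounded (q :: real \<Rightarrow> real)"
  shows "integrable \<mu> q"
  using has_bochner_integral_mu[of q] integrable_w[OF assms]
  by (simp add: has_bochner_integral_iff)

lemma truncation_L2:
  assumes f: "in_L2 (V a \<zeta>) f" and e: "e > 0"
  obtains N :: nat where "L2_norm_sq (V a \<zeta>) (\<lambda>t. f t - indicator {t. norm (f t) \<le> N} t *\<^sub>R f t) < ennreal e"
proof -
  have [measurable]: "f \<in> borel_measurable borel" and fin: "L2_norm_sq (V a \<zeta>) f < \<infinity>"
    using f by (auto simp: in_L2_def)
  let ?r = "\<lambda>N t. f t - indicator {t. norm (f t) \<le> real N} t *\<^sub>R f t"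
  have "(\<lambda>N. \<integral>\<^sup>+t. ennreal (energy t (?r N t)) \<partial>\<mu>) \<longlonglongrightarrow> (\<integral>\<^sup>+t. 0 \<partial>\<mu>)"
  \<comment> \<open>The remainder at t is either zero or f t, so the energy of \<open>f\<close>
    itself is a majorant.\<close>
  proof (rule nn_integral_dominated_convergence[where w="\<lambda>t. ennreal (energy t (f t))"])
    show "(\<integral>\<^sup>+t. ennreal (energy t (f t)) \<partial>\<mu>) < \<infinity>"
      using fin by (simp add: L2_norm_sq_def)
    show "AE t in \<mu>. ennreal (energy t (?r N t)) \<le> ennreal (energy t (f t))" for N
    proof (intro AE_I2 ennreal_leI)
      fix t
      show "energy t (?r N t) \<le> energy t (f t)"
        using energy_nonneg[of "f t" t]
        by (cases "norm (f t) \<le> real N") (auto simp: trace_cmat2)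
    qed
    show "AE t in \<mu>. (\<lambda>N. ennreal (energy t (?r N t))) \<longlonglongrightarrow> 0"
    proof (intro AE_I2 tendsto_eventually)
      fix t
      obtain M where M: "norm (f t) \<le> real M" using real_arch_simple by blast
      show "\<forall>\<^sub>F N in sequentially. ennreal (energy t (?r N t)) = 0"
        using eventually_ge_at_top[of M]
      proof eventually_elim
        case (elim N)
        then have "norm (f t) \<le> real N" using M by linarith
        then show ?case by (simp add: trace_cmat2)
      qed
    qed
  qed measurable
  then have "(\<lambda>N. L2_norm_sq (V a \<zeta>) (?r N)) \<longlonglongrightarrow> 0" by (simp add: L2_norm_sq_def)
  then have "\<forall>\<^sub>F N in sequentially. L2_norm_sq (V a \<zeta>) (?r N) < ennreal e"
    using e by (intro order_tendstoD) auto
  then show ?thesis using that by (auto simp: eventually_sequentially)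
qed

text \<open>Writing f = p^2 g turns |f - p^2 R|^2 into p^4 |g - R|^2, so approximation by multiples
  of p^2 becomes plain polynomial approximation in this measure.\<close>

lemma exp_moment_measure_pp: "exp_moment_measure (density \<mu> (\<lambda>t. ennreal (pp a t ^ 4)))"
proof -
  have [measurable]: "pp a \<in> borel_measurable borel"
    by (intro borel_measurable_continuous_onI continuous_on_pp)
  have int: "integrable \<mu> (\<lambda>t. pp a t ^ 4 * exp (c * \<bar>t\<bar>))" for c
    by (intro integrable_mu_exp_bounded exp_bounded_intros) measurable
  have "integrable (density \<mu> (\<lambda>t. ennreal (pp a t ^ 4))) (\<lambda>t. exp (c * \<bar>t\<bar>))" for c
    using int[of c] by (subst integrable_density) (auto simp: mult.commute)
  moreover have "finite_measure (density \<mu> (\<lambda>t. ennreal (pp a t ^ 4)))"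
  proof (rule finite_measureI)
    have "(\<integral>\<^sup>+t. ennreal (pp a t ^ 4) \<partial>\<mu>) < \<infinity>"
      using int[of 0] by (simp add: nn_integral_eq_integral)
    then show "emeasure (density \<mu> (\<lambda>t. ennreal (pp a t ^ 4)))
        (space (density \<mu> (\<lambda>t. ennreal (pp a t ^ 4)))) \<noteq> \<infinity>"
      by (subst emeasure_density) (auto simp: less_top)
  qed
  ultimately show ?thesis
    by (simp add: exp_moment_measure_def exp_moment_measure_axioms_def)
qed

text \<open>The quotient f / p^2 stays bounded because p^2 is at least 1, and each of its real
  coordinates is approximated by a scalar polynomial.\<close>

lemma bounded_approximation_L2:
  assumes [measurable]: "f \<in> borel_measurable borel" and bd: "\<And>t. norm (f t) \<le> B" and e: "e > 0"
  obtains n R where "mdeg n R" "L2_norm_sq (V a \<zeta>) (\<lambda>t. f t - (pp a t)\<^sup>2 *\<^sub>R R t) < ennreal e"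
proof -
  let ?M = "density \<mu> (\<lambda>t. ennreal (pp a t ^ 4))"
  interpret exp_moment_measure ?M by (rule exp_moment_measure_pp)
  have [measurable]: "pp a \<in> borel_measurable borel"
    by (intro borel_measurable_continuous_onI continuous_on_pp)
  define g where "g t = (1 / (pp a t)\<^sup>2) *\<^sub>R f t" for t
  have [measurable]: "g \<in> borel_measurable borel" unfolding g_def[abs_def] by measurable
  \<comment> \<open>Each coordinate will contribute at most 2 d, which totals e / 2 and leaves room
    for the strict inequality.\<close>
  define d where "d = e / (4 * DIM(cmat2))"
  have d: "d > 0" using e by (simp add: d_def)
  have "\<exists>q. real_polynomial_function q \<and> (\<integral>\<^sup>+t. ennreal ((g t \<bullet> c - q t)\<^sup>2) \<partial>?M) < ennreal d"
    if c: "c \<in> Basis" for c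
  proof -
    have "\<bar>g t \<bullet> c\<bar> \<le> B" for t
    proof -
      have "1 \<le> (pp a t)\<^sup>2" using pp_le[of t] power_mono[of 1 "- pp a t" 2] by simp
      then have "norm (g t) \<le> norm (f t)"
        using divide_left_mono[of 1 "(pp a t)\<^sup>2" "norm (f t)"] pp_nz[of t] by (simp add: g_def)
      then show ?thesis using Basis_le_norm[OF c, of "g t"] bd[of t] by linarith
    qed
    then have "poly_approx ?M (\<lambda>t. g t \<bullet> c)"
      by (intro poly_approx_bounded) measurable
    then show ?thesis using d by (auto simp: poly_approx_def)
  qed
  then have "\<forall>c\<in>Basis. \<exists>q. real_polynomial_function q \<and>
      (\<integral>\<^sup>+t. ennreal ((g t \<bullet> c - q t)\<^sup>2) \<partial>?M) < ennreal d"
    by (rule ballI)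
  from bchoice[OF this] obtain q where "\<forall>c\<in>Basis. real_polynomial_function (q c) \<and>
      (\<integral>\<^sup>+t. ennreal ((g t \<bullet> c - q c t)\<^sup>2) \<partial>?M) < ennreal d" ..
  then have q: "real_polynomial_function (q c)"
    "(\<integral>\<^sup>+t. ennreal ((g t \<bullet> c - q c t)\<^sup>2) \<partial>?M) < ennreal d" if "c \<in> Basis" for c
    using that by simp_all
  define R where "R t = (\<Sum>c\<in>Basis. q c t *\<^sub>R c)" for t
  have "\<exists>n. mdeg n R"
    unfolding R_def[abs_def] by (intro mdeg_sum_ex real_polynomial_function_mdeg q) auto
  then obtain n where n: "mdeg n R" by blast
  have [measurable]: "R \<in> borel_measurable borel" by (rule mdeg_measurable[OF n])
  have q_meas: "q c \<in> borel_measurable borel" if "c \<in> Basis" for c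
    using q(1)[OF that] by (rule real_polynomial_function_measurable)
  have "L2_norm_sq (V a \<zeta>) (\<lambda>t. f t - (pp a t)\<^sup>2 *\<^sub>R R t)
      \<le> (\<integral>\<^sup>+t. (\<Sum>c\<in>Basis. 2 * (ennreal (pp a t ^ 4) * ennreal ((g t \<bullet> c - q c t)\<^sup>2))) \<partial>\<mu>)"
    unfolding L2_norm_sq_def
  proof (rule nn_integral_mono_AE)
    show "AE t in \<mu>. ennreal (energy t (f t - (pp a t)\<^sup>2 *\<^sub>R R t))
        \<le> (\<Sum>c\<in>Basis. 2 * (ennreal (pp a t ^ 4) * ennreal ((g t \<bullet> c - q c t)\<^sup>2)))"
      using energy_le
    proof eventually_elim
      case (elim t)
      have "f t - (pp a t)\<^sup>2 *\<^sub>R R t = (pp a t)\<^sup>2 *\<^sub>R (g t - R t)"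
        using pp_nz[of t] by (simp add: g_def scaleR_diff_right)
      then have "(norm (f t - (pp a t)\<^sup>2 *\<^sub>R R t))\<^sup>2 = pp a t ^ 4 * (norm (g t - R t))\<^sup>2"
        by (simp add: power_mult_distrib flip: power_mult)
      also have "(norm (g t - R t))\<^sup>2 = (\<Sum>c\<in>Basis. (g t \<bullet> c - q c t)\<^sup>2)"
        unfolding norm_squared_Basis R_def
        by (intro sum.cong) (simp_all add: inner_diff_left inner_sum_left_Basis)
      finally have "energy t (f t - (pp a t)\<^sup>2 *\<^sub>R R t)
          \<le> (\<Sum>c\<in>Basis. 2 * (pp a t ^ 4 * (g t \<bullet> c - q c t)\<^sup>2))"
        using elim[rule_format, of "f t - (pp a t)\<^sup>2 *\<^sub>R R t"]
        by (simp add: sum_distrib_left)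
      then have "ennreal (energy t (f t - (pp a t)\<^sup>2 *\<^sub>R R t))
          \<le> ennreal (\<Sum>c\<in>Basis. 2 * (pp a t ^ 4 * (g t \<bullet> c - q c t)\<^sup>2))"
        by (rule ennreal_leI)
      also have "\<dots> = (\<Sum>c\<in>Basis. 2 * (ennreal (pp a t ^ 4) * ennreal ((g t \<bullet> c - q c t)\<^sup>2)))"
        by (subst sum_ennreal[symmetric]) (auto simp: ennreal_mult intro!: sum.cong)
      finally show ?case .
    qed
  qed
  also have "\<dots> = (\<Sum>c\<in>Basis. \<integral>\<^sup>+t. 2 * (ennreal (pp a t ^ 4) * ennreal ((g t \<bullet> c - q c t)\<^sup>2)) \<partial>\<mu>)"
    using q_meas by (intro nn_integral_sum) measurable
  also have "\<dots> = (\<Sum>c\<in>Basis. 2 * (\<integral>\<^sup>+t. ennreal ((g t \<bullet> c - q c t)\<^sup>2) \<partial>?M))"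
  proof (rule sum.cong[OF refl])
    fix c :: cmat2 assume "c \<in> Basis"
    note [measurable] = q_meas[OF this]
    show "(\<integral>\<^sup>+t. 2 * (ennreal (pp a t ^ 4) * ennreal ((g t \<bullet> c - q c t)\<^sup>2)) \<partial>\<mu>)
        = 2 * (\<integral>\<^sup>+t. ennreal ((g t \<bullet> c - q c t)\<^sup>2) \<partial>?M)"
      by (subst nn_integral_density) (auto simp: nn_integral_cmult)
  qed
  also have "\<dots> \<le> (\<Sum>c\<in>(Basis :: cmat2 set). ennreal (2 * d))"
  proof (rule sum_mono)
    fix c :: cmat2 assume "c \<in> Basis"
    from q(2)[OF this]
    have "2 * (\<integral>\<^sup>+t. ennreal ((g t \<bullet> c - q c t)\<^sup>2) \<partial>?M) \<le> 2 * ennreal d"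
      by (intro mult_left_mono) (auto intro: less_imp_le)
    then show "2 * (\<integral>\<^sup>+t. ennreal ((g t \<bullet> c - q c t)\<^sup>2) \<partial>?M) \<le> ennreal (2 * d)"
      using d by (simp add: ennreal_mult)
  qed
  also have "\<dots> = ennreal (DIM(cmat2) * (2 * d))"
    using d by (simp add: ennreal_mult ennreal_of_nat_eq_real_of_nat)
  also have "\<dots> < ennreal e"
    using e by (simp add: d_def ennreal_less_iff)
  finally show ?thesis using n that by blast
qed

lemma polynomial_multiples_dense_L2:
  assumes f: "in_L2 (V a \<zeta>) f" and e: "e > 0"
  obtains n R where "mdeg n R" "L2_norm_sq (V a \<zeta>) (\<lambda>t. f t - (pp a t)\<^sup>2 *\<^sub>R R t) < ennreal e"
proof -
  have fm [measurable]: "f \<in> borel_measurable borel" using f by (simp add: in_L2_def)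
  have [measurable]: "pp a \<in> borel_measurable borel"
    by (intro borel_measurable_continuous_onI continuous_on_pp)
  have e4: "e / 4 > 0" using e by simp
  obtain N where N: "L2_norm_sq (V a \<zeta>) (\<lambda>t. f t - indicator {t. norm (f t) \<le> real N} t *\<^sub>R f t) < ennreal (e / 4)"
    using truncation_L2[OF f e4] by blast
  define g where "g t = indicator {t. norm (f t) \<le> real N} t *\<^sub>R f t" for t
  have [measurable]: "g \<in> borel_measurable borel" unfolding g_def[abs_def] by measurable
  have "norm (g t) \<le> real N" for t by (simp add: g_def indicator_def)
  then obtain n R where R: "mdeg n R" "L2_norm_sq (V a \<zeta>) (\<lambda>t. g t - (pp a t)\<^sup>2 *\<^sub>R R t) < ennreal (e / 4)"
    using bounded_approximation_L2[of g N "e / 4"] e4 by auto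
  have [measurable]: "R \<in> borel_measurable borel" by (rule mdeg_measurable[OF R(1)])
  have "L2_norm_sq (V a \<zeta>) (\<lambda>t. f t - (pp a t)\<^sup>2 *\<^sub>R R t)
      = L2_norm_sq (V a \<zeta>) (\<lambda>t. (f t - g t) + (g t - (pp a t)\<^sup>2 *\<^sub>R R t))"
    by simp
  also have "\<dots> \<le> 2 * L2_norm_sq (V a \<zeta>) (\<lambda>t. f t - g t)
      + 2 * L2_norm_sq (V a \<zeta>) (\<lambda>t. g t - (pp a t)\<^sup>2 *\<^sub>R R t)"
    by (intro L2_norm_sq_add_le) measurable
  also have "\<dots> < ennreal e"
    using N R(2) e unfolding g_def by (intro ennreal_two_fourths)
  finally show ?thesis using R(1) that by blast
qed

end

section \<open>The exceptional space and the differential operator\<close>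

text \<open>Stated with truncated subtraction because it is applied to derivatives, whose bound is
  \<open>m - 1\<close>. When \<open>m\<close> is 0 the function is zero, so multiplication by t
  still does not exceed the bound.\<close>

lemma mdeg_times_t:
  assumes "mdeg (m - 1) f"
  shows "mdeg m (\<lambda>t. t *\<^sub>R f t)"
proof (cases m)
  case 0
  then have "f = (\<lambda>t. 0)" using assms by (auto simp: mdeg_def)
  then show ?thesis by (simp add: mdeg_zero)
next
  case (Suc n)
  then show ?thesis using mdeg_times_power[of n f 1] assms by simp
qed

lemma mdeg_scaleR: "mdeg n f \<Longrightarrow> mdeg n (\<lambda>t. c *\<^sub>R f t)"
  by (rule mdeg_linear[OF linear_scale_self])

lemma mdeg_const: "0 < n \<Longrightarrow> mdeg n (\<lambda>t. A)"
  using mdeg_monom[of 0 n A] by simp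

lemma mdeg_SucE:
  assumes "mdeg (Suc m) Z"
  obtains Z0 A where "mdeg m Z0" "\<And>t. Z t = Z0 t + t ^ m *\<^sub>R A"
proof -
  obtain A where A: "\<And>t. Z t = (\<Sum>k<Suc m. t ^ k *\<^sub>R A k)"
    using assms unfolding mdeg_def by blast
  have "mdeg m (\<lambda>t. \<Sum>k<m. t ^ k *\<^sub>R A k)" by (auto simp: mdeg_def)
  then show ?thesis by (rule that[of _ "A m"]) (simp add: A)
qed

lemma has_vector_derivative_power_scaleR:
  "((\<lambda>t. t ^ Suc n *\<^sub>R X) has_vector_derivative t ^ n *\<^sub>R (real (Suc n) *\<^sub>R X)) (at t)"
  using has_vector_derivative_scaleR[OF DERIV_pow[of "Suc n" t] has_vector_derivative_const[of X]]
  by (simp add: mult.commute)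

text \<open>Differentiation lowers both sides by one degree and multiplies \<open>C\<close> by the
  nonzero number \<open>Suc n\<close>; at the bottom the right side is an empty sum. This makes
  monic matrix polynomials injective under left multiplication.\<close>

lemma monomial_mdeg_eq_0:
  assumes "mdeg n L" "\<And>t. t ^ n *\<^sub>R C = L t"
  shows "C = 0"
  using assms
proof (induction n arbitrary: C L)
  case 0
  then show ?case by (simp add: mdeg_def)
next
  case (Suc n)
  obtain L' where L': "mdeg (Suc n - 1) L'" "\<And>t. (L has_vector_derivative L' t) (at t)"
    using mdeg_derivative[OF Suc.prems(1)] by blast
  have "L = (\<lambda>t. t ^ Suc n *\<^sub>R C)" using Suc.prems(2) by auto
  then have eq: "t ^ n *\<^sub>R (real (Suc n) *\<^sub>R C) = L' t" for t
    using vector_derivative_unique_at[OF has_vector_derivative_power_scaleR[of n C t], of "L' t"] L'(2)[of t]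
    by simp
  have "mdeg n L'" using L'(1) by simp
  then have "real (Suc n) *\<^sub>R C = 0" using eq by (rule Suc.IH)
  then show ?case by (simp del: of_nat_Suc)
qed

lemmas has_vector_derivative_cmat2_mult =
  bounded_bilinear.has_vector_derivative[OF bounded_bilinear_cmat2_mult]

lemma has_vector_derivative_mult_left:
  fixes f :: "real \<Rightarrow> cmat2"
  assumes "(f has_vector_derivative f') F"
  shows "((\<lambda>t. (C :: cmat2) ** f t) has_vector_derivative C ** f') F"
  by (rule bounded_linear.has_vector_derivative[OF
      bounded_bilinear.bounded_linear_right[OF bounded_bilinear_cmat2_mult] assms])

lemma has_vector_derivative_mult_right:
  fixes f :: "real \<Rightarrow> cmat2"
  assumes "(f has_vector_derivative f') F"
  shows "((\<lambda>t. f t ** (C :: cmat2)) has_vector_derivative f' ** C) F"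
  by (rule bounded_linear.has_vector_derivative[OF
      bounded_bilinear.bounded_linear_left[OF bounded_bilinear_cmat2_mult] assms])

lemma cmat2_distrib:
  fixes A B C :: cmat2
  shows "(A + B) ** C = A ** C + B ** C" "A ** (B + C) = A ** B + A ** C"
    "(A - B) ** C = A ** C - B ** C" "A ** (B - C) = A ** B - A ** C"
    "(r *\<^sub>R A) ** B = r *\<^sub>R (A ** B)" "A ** (r *\<^sub>R B) = r *\<^sub>R (A ** B)"
    "(- A) ** B = - (A ** B)" "A ** (- B) = - (A ** B)"
  by (simp_all add: cmat2_eq_iff algebra_simps)

lemma has_vector_derivative_mat22:
  assumes "(f has_vector_derivative f') (at t)" "(g has_vector_derivative g') (at t)"
    "(h has_vector_derivative h') (at t)" "(k has_vector_derivative k') (at t)"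
  shows "((\<lambda>t. mat22 (f t) (g t) (h t) (k t)) has_vector_derivative mat22 f' g' h' k') (at t)"
proof -
  have lin: "bounded_linear (\<lambda>x. mat22 x 0 0 0)" "bounded_linear (\<lambda>x. mat22 0 x 0 0)"
    "bounded_linear (\<lambda>x. mat22 0 0 x 0)" "bounded_linear (\<lambda>x. mat22 0 0 0 x)"
    unfolding linear_linear by (auto intro!: linearI simp: cmat2_eq_iff)
  have split: "mat22 x y z w = mat22 x 0 0 0 + mat22 0 y 0 0 + mat22 0 0 z 0 + mat22 0 0 0 w" for x y z w
    by (simp add: cmat2_eq_iff)
  have "((\<lambda>t. mat22 (f t) 0 0 0 + mat22 0 (g t) 0 0 + mat22 0 0 (h t) 0 + mat22 0 0 0 (k t))
      has_vector_derivative mat22 f' 0 0 0 + mat22 0 g' 0 0 + mat22 0 0 h' 0 + mat22 0 0 0 k') (at t)"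
    by (intro has_vector_derivative_add bounded_linear.has_vector_derivative[OF lin(1)]
        bounded_linear.has_vector_derivative[OF lin(2)] bounded_linear.has_vector_derivative[OF lin(3)]
        bounded_linear.has_vector_derivative[OF lin(4)] assms)
  moreover have "(\<lambda>t. mat22 (f t) 0 0 0 + mat22 0 (g t) 0 0 + mat22 0 0 (h t) 0 + mat22 0 0 0 (k t))
      = (\<lambda>t. mat22 (f t) (g t) (h t) (k t))"
    by (rule ext) (rule split[symmetric])
  ultimately show ?thesis by (simp add: split[symmetric])
qed

text \<open>Keeping the entries real turns each matrix identity into four identities between real
  expressions, which can be settled by clearing denominators and \<open>algebra\<close>.\<close>

definition rmat :: "real \<Rightarrow> real \<Rightarrow> real \<Rightarrow> real \<Rightarrow> cmat2" where
  "rmat x y z w = mat22 (of_real x) (of_real y) (of_real z) (of_real w)"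

lemma rmat_mult: "rmat x y z w ** rmat x' y' z' w'
    = rmat (x * x' + y * z') (x * y' + y * w') (z * x' + w * z') (z * y' + w * w')"
  by (simp add: rmat_def cmat2_eq_iff)

lemma rmat_add: "rmat x y z w + rmat x' y' z' w' = rmat (x + x') (y + y') (z + z') (w + w')"
  by (simp add: rmat_def cmat2_eq_iff)

lemma rmat_diff: "rmat x y z w - rmat x' y' z' w' = rmat (x - x') (y - y') (z - z') (w - w')"
  by (simp add: rmat_def cmat2_eq_iff)

lemma rmat_scaleR: "r *\<^sub>R rmat x y z w = rmat (r * x) (r * y) (r * z) (r * w)"
  by (simp add: rmat_def cmat2_eq_iff) (simp add: scaleR_conv_of_real)

lemma rmat_adj: "adj (rmat x y z w) = rmat x z y w"
  by (simp add: rmat_def cmat2_eq_iff)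

lemma mat_1_rmat: "(mat 1 :: cmat2) = rmat 1 0 0 1"
  by (simp add: rmat_def cmat2_eq_iff mat_def)

lemma rmat_eqI: "x = x' \<Longrightarrow> y = y' \<Longrightarrow> z = z' \<Longrightarrow> w = w' \<Longrightarrow> rmat x y z w = rmat x' y' z' w'"
  by simp

lemmas rmat_arith = rmat_mult rmat_add rmat_diff rmat_scaleR rmat_adj mat_1_rmat

lemma has_vector_derivative_rmat:
  assumes "(f has_real_derivative f') (at t)" "(g has_real_derivative g') (at t)"
    "(h has_real_derivative h') (at t)" "(k has_real_derivative k') (at t)"
  shows "((\<lambda>t. rmat (f t) (g t) (h t) (k t)) has_vector_derivative rmat f' g' h' k') (at t)"
  unfolding rmat_def by (intro has_vector_derivative_mat22 has_vector_derivative_of_real assms)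

definition lin_factor :: "real \<Rightarrow> real \<Rightarrow> cmat2" where
  "lin_factor a t = rmat t (- a / 2) (a / (a\<^sup>2 - 2)) t"

text \<open>Meant for \<open>n \<noteq> 1\<close>; the junk value \<open>0 / (0 - 1)\<close> makes the second term vanish for \<open>n = 0\<close>.\<close>

definition exc_basis :: "real \<Rightarrow> nat \<Rightarrow> real \<Rightarrow> cmat2" where
  "exc_basis a n t = t ^ n *\<^sub>R mat 1
    + (t ^ (n - 1) * (real n / (real n - 1))) *\<^sub>R rmat 0 (- a / 2) (a / (a\<^sup>2 - 2)) 0"

text \<open>The polynomials of degree at most \<open>m + 1\<close> in the exceptional space.\<close>

definition exc_space :: "real \<Rightarrow> nat \<Rightarrow> (real \<Rightarrow> cmat2) \<Rightarrow> bool" where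
  "exc_space a m Y \<longleftrightarrow> (\<exists>Z. mdeg m Z \<and> (\<forall>t. (Y has_vector_derivative Z t ** lin_factor a t) (at t)))"

text \<open>For \<open>Y' = Z T\<close> the operator becomes \<open>Y F\<^sub>0 + Z G + Z' H\<close> with \<open>G = T F\<^sub>1 + F\<^sub>2\<close> and \<open>H = T F\<^sub>2\<close>;
  the denominators cancel.\<close>

definition G :: "real \<Rightarrow> real \<Rightarrow> cmat2" where
  "G a t = rmat (- 2 * t\<^sup>2 + (2 + a\<^sup>2) / (a\<^sup>2 - 2)) ((2 / a + a) * t) (- 2 * t / a) 0"

definition H :: "real \<Rightarrow> real \<Rightarrow> cmat2" where
  "H a t = rmat (a\<^sup>2 * t / (a\<^sup>2 - 2)) (a * t\<^sup>2) (a / (a\<^sup>2 - 2)) t"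

lemma has_vector_derivative_lin_factor: "(lin_factor a has_vector_derivative mat 1) (at t)"
  unfolding lin_factor_def[abs_def] mat_1_rmat
  by (intro has_vector_derivative_rmat) (auto intro!: derivative_eq_intros)

text \<open>With n = m + 2, the coefficient n / (n - 1) is the one for which both terms of the
  derivative share the factor n t^(n-2), leaving t I + K.\<close>

lemma has_vector_derivative_exc_basis:
  "(exc_basis a (m + 2) has_vector_derivative (t ^ m *\<^sub>R (real (m + 2) *\<^sub>R mat 1)) ** lin_factor a t) (at t)"
proof -
  let ?K = "rmat 0 (- a / 2) (a / (a\<^sup>2 - 2)) 0"
  define c where "c = real (m + 2) / (real (m + 2) - 1)"
  have "exc_basis a (m + 2) = (\<lambda>t. t ^ Suc (Suc m) *\<^sub>R mat 1 + t ^ Suc m *\<^sub>R (c *\<^sub>R ?K))"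
    by (simp add: exc_basis_def fun_eq_iff c_def)
  moreover have "((\<lambda>t. t ^ Suc (Suc m) *\<^sub>R mat 1 + t ^ Suc m *\<^sub>R (c *\<^sub>R ?K)) has_vector_derivative
      t ^ Suc m *\<^sub>R (real (Suc (Suc m)) *\<^sub>R mat 1) + t ^ m *\<^sub>R (real (Suc m) *\<^sub>R (c *\<^sub>R ?K))) (at t)"
    by (intro has_vector_derivative_add has_vector_derivative_power_scaleR)
  moreover have "real (Suc m) *\<^sub>R (c *\<^sub>R ?K) = real (m + 2) *\<^sub>R ?K"
    by (simp add: c_def)
  moreover have "t ^ Suc m *\<^sub>R (real (Suc (Suc m)) *\<^sub>R mat 1) + t ^ m *\<^sub>R (real (m + 2) *\<^sub>R ?K)
      = (t ^ m *\<^sub>R (real (m + 2) *\<^sub>R mat 1)) ** lin_factor a t"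
    unfolding lin_factor_def rmat_arith by (rule rmat_eqI) (simp_all add: algebra_simps add_divide_distrib)
  ultimately show ?thesis by (simp only:)
qed

lemma exc_space_exc_basis: "exc_space a (Suc m) (exc_basis a (m + 2))"
  unfolding exc_space_def using has_vector_derivative_exc_basis
  by (intro exI[of _ "\<lambda>t. t ^ m *\<^sub>R (real (m + 2) *\<^sub>R mat 1)"] conjI allI mdeg_monom) auto

lemma zero_mult_cmat2 [simp]: "(0 :: cmat2) ** A = 0" "A ** (0 :: cmat2) = (0 :: cmat2)"
  by (simp_all add: cmat2_eq_iff)

lemma exc_space_const: "exc_space a m (\<lambda>t. C)"
  unfolding exc_space_def by (intro exI[of _ "\<lambda>t. 0"]) (simp add: mdeg_zero)

lemma exc_space_mono: "exc_space a m Y \<Longrightarrow> m \<le> n \<Longrightarrow> exc_space a n Y"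
  unfolding exc_space_def using mdeg_mono by blast

lemma exc_space_add:
  assumes "exc_space a m Y" "exc_space a m Y2"
  shows "exc_space a m (\<lambda>t. Y t + Y2 t)"
proof -
  obtain Z Z2 where "mdeg m Z" "mdeg m Z2"
    "\<And>t. (Y has_vector_derivative Z t ** lin_factor a t) (at t)" "\<And>t. (Y2 has_vector_derivative Z2 t ** lin_factor a t) (at t)"
    using assms unfolding exc_space_def by blast
  then show ?thesis
    unfolding exc_space_def
    by (intro exI[of _ "\<lambda>t. Z t + Z2 t"]) (auto simp: cmat2_distrib intro!: mdeg_add has_vector_derivative_add)
qed

lemma exc_space_mult_left:
  assumes "exc_space a m Y"
  shows "exc_space a m (\<lambda>t. C ** Y t)"
proof -
  obtain Z where "mdeg m Z" "\<And>t. (Y has_vector_derivative Z t ** lin_factor a t) (at t)"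
    using assms unfolding exc_space_def by blast
  then show ?thesis
    unfolding exc_space_def
    by (intro exI[of _ "\<lambda>t. C ** Z t"])
      (auto simp: matrix_mul_assoc[symmetric] intro!: mdeg_mult_left has_vector_derivative_mult_left)
qed

lemma exc_space_diff: "exc_space a m Y \<Longrightarrow> exc_space a m Y2 \<Longrightarrow> exc_space a m (\<lambda>t. Y t - Y2 t)"
  using exc_space_add[OF _ exc_space_mult_left[of a m Y2 "- mat 1"]] by (simp add: cmat2_distrib)

lemma exc_space_0_constant:
  assumes "exc_space a 0 Y"
  obtains C where "Y = (\<lambda>t. C)"
proof -
  have "(Y has_vector_derivative 0) (at t within UNIV)" for t
    using assms unfolding exc_space_def mdeg_def by auto
  then obtain C where "\<And>t. t \<in> UNIV \<Longrightarrow> Y t = C"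
    by (rule has_vector_derivative_zero_constant[OF convex_UNIV]) (rule that)
  then have "Y = (\<lambda>t. C)" by (intro ext) simp
  then show ?thesis by (rule that)
qed

text \<open>The top coefficient is removed from \<open>Z\<close>, not from \<open>Y\<close>; the
  factor 1 / (m + 2) undoes the one produced by differentiating the basis element. Iterated, this
  shows that the basis spans.\<close>

lemma exc_space_SucE:
  assumes "exc_space a (Suc m) Y"
  obtains C where "exc_space a m (\<lambda>t. Y t - C ** exc_basis a (m + 2) t)"
proof -
  obtain Z where Z: "mdeg (Suc m) Z" "\<And>t. (Y has_vector_derivative Z t ** lin_factor a t) (at t)"
    using assms unfolding exc_space_def by blast
  obtain Z0 A where A: "mdeg m Z0" "\<And>t. Z t = Z0 t + t ^ m *\<^sub>R A"
    using mdeg_SucE[OF Z(1)] by blast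
  let ?C = "(1 / real (m + 2)) *\<^sub>R A"
  have "((\<lambda>t. Y t - ?C ** exc_basis a (m + 2) t) has_vector_derivative Z0 t ** lin_factor a t) (at t)" for t
  proof -
    have "((\<lambda>t. Y t - ?C ** exc_basis a (m + 2) t) has_vector_derivative
        Z t ** lin_factor a t - ?C ** ((t ^ m *\<^sub>R (real (m + 2) *\<^sub>R mat 1)) ** lin_factor a t)) (at t)"
      by (intro has_vector_derivative_diff Z has_vector_derivative_mult_left has_vector_derivative_exc_basis)
    also have "Z t ** lin_factor a t - ?C ** ((t ^ m *\<^sub>R (real (m + 2) *\<^sub>R mat 1)) ** lin_factor a t) = Z0 t ** lin_factor a t"
      by (simp add: A cmat2_distrib)
    finally show ?thesis .
  qed
  then show ?thesis using A(1) that unfolding exc_space_def by blast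
qed

lemma mdeg_exc_basis: "mdeg (Suc (m + 2)) (exc_basis a (m + 2))"
  unfolding exc_basis_def[abs_def] scaleR_scaleR[symmetric] by (intro mdeg_add mdeg_monom) auto

text \<open>Z T has degree at most m, so its primitive has degree at most m + 1. For
  \<open>m = 0\<close> the functions are constant, since the space has no elements of degree
  one.\<close>

lemma exc_space_mdeg:
  assumes "exc_space a m Y"
  shows "mdeg (m + 2) Y"
  using assms
proof (induction m arbitrary: Y)
  case 0
  then show ?case using exc_space_0_constant mdeg_const by (metis add_2_eq_Suc' zero_less_Suc)
next
  case (Suc m)
  obtain C where C: "exc_space a m (\<lambda>t. Y t - C ** exc_basis a (m + 2) t)" using exc_space_SucE[OF Suc.prems] by blast
  have "mdeg (Suc m + 2) (\<lambda>t. (Y t - C ** exc_basis a (m + 2) t) + C ** exc_basis a (m + 2) t)"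
    using mdeg_exc_basis[of m a] by (intro mdeg_add mdeg_mono[OF Suc.IH[OF C]] mdeg_mult_left) auto
  then show ?case by simp
qed

section \<open>Cancellation of the poles and invariance of the exceptional space\<close>

context exceptional_hermite
begin

abbreviation "D \<equiv> second_order_op (F2 a) (F1 a) (F0 a)"

lemma b_nz: "a\<^sup>2 - 2 \<noteq> 0" using a by simp

lemma F2_rmat: "F2 a t = (1 / pp a t) *\<^sub>R rmat (- (a\<^sup>2) * (2 * t\<^sup>2 + 1))
    (- ((a\<^sup>2 - 2) * a * t * (2 * t\<^sup>2 + 1))) (4 * a * t / (a\<^sup>2 - 2)) (4 * t\<^sup>2)"
  by (simp add: F2_def rmat_def)

lemma F1_rmat: "F1 a t = (1 / (pp a t)\<^sup>2) *\<^sub>R rmat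
    (- 2 * t * ((pp a t)\<^sup>2 + 4 * pp a t - 4 * a\<^sup>2))
    (4 * (a\<^sup>2 - 2) * t\<^sup>2 / a * (- pp a t + 2 * a\<^sup>2))
    (4 * (pp a t + 2 * a\<^sup>2) * (pp a t - a\<^sup>2) / (a * (a\<^sup>2 - 2)))
    (- 8 * a\<^sup>2 * t)"
  by (simp add: F1_def rmat_def)

lemma F0_rmat: "F0 a t = rmat (2 - 4 / a\<^sup>2) 0 0 0"
  by (simp add: F0_def rmat_def)

text \<open>Writing \<open>b\<close> for \<open>a\<^sup>2 - 2\<close> and \<open>p\<close> for the value of the quadratic turns the entrywise
  identities into consequences of \<open>a\<^sup>2 = b + 2\<close> and \<open>p = - 2 b t\<^sup>2 - a\<^sup>2\<close>.\<close>

lemma bp_obtain: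
  obtains b p where "a\<^sup>2 - 2 = b" "pp a t = p" "b \<noteq> 0" "p \<noteq> 0" "a\<^sup>2 = b + 2" "p = - 2 * b * t\<^sup>2 - a\<^sup>2"
  using that[of "a\<^sup>2 - 2" "pp a t"] b_nz pp_nz[of t] by (simp add: pp_def algebra_simps)

lemma lin_factor_F2: "lin_factor a t ** F2 a t = H a t"
proof -
  obtain b p where bp: "a\<^sup>2 - 2 = b" "pp a t = p" and nz: "b \<noteq> 0" "p \<noteq> 0"
    and eq: "a\<^sup>2 = b + 2" "p = - 2 * b * t\<^sup>2 - a\<^sup>2"
    by (rule bp_obtain)
  show ?thesis
    unfolding F2_rmat lin_factor_def H_def rmat_arith bp
  proof (rule rmat_eqI, goal_cases)
    case 1 show ?case using nz a_nz by (simp add: divide_simps) (use eq in algebra)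
  next
    case 2 show ?case using nz a_nz by (simp add: divide_simps) (use eq in algebra)
  next
    case 3 show ?case using nz a_nz by (simp add: divide_simps) (use eq in algebra)
  next
    case 4 show ?case using nz a_nz by (simp add: divide_simps) (use eq in algebra)
  qed
qed

lemma lin_factor_F1_F2: "lin_factor a t ** F1 a t + F2 a t = G a t"
proof -
  obtain b p where bp: "a\<^sup>2 - 2 = b" "pp a t = p" and nz: "b \<noteq> 0" "p \<noteq> 0"
    and eq: "a\<^sup>2 = b + 2" "p = - 2 * b * t\<^sup>2 - a\<^sup>2"
    by (rule bp_obtain)
  show ?thesis
    unfolding F2_rmat F1_rmat lin_factor_def G_def rmat_arith bp
  proof (rule rmat_eqI, goal_cases)
    case 1 show ?case using nz a_nz by (simp add: divide_simps) (use eq in algebra)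
  next
    case 2 show ?case using nz a_nz by (simp add: divide_simps) (use eq in algebra)
  next
    case 3 show ?case using nz a_nz by (simp add: divide_simps) (use eq in algebra)
  next
    case 4 show ?case using nz a_nz by (simp add: divide_simps) (simp add: algebra_simps power2_eq_square)
  qed
qed

text \<open>Differentiating Y F0 + Z G + Z' H gives the coefficients T F0 + G' of Z, G + H' of Z'
  and H of Z''. Each must have T as a right factor for the image to stay in the space. This lemma
  and the next two exhibit the three left cofactors.\<close>

lemma H_factor: "H a t = rmat 0 (a * t) 0 1 ** lin_factor a t"
  unfolding H_def lin_factor_def rmat_arith
  by (rule rmat_eqI) (use b_nz in \<open>simp_all add: power2_eq_square\<close>)

lemma has_vector_derivative_H:
  "(H a has_vector_derivative rmat (- 2 * t) (2 / a + 2 * a) (- 2 / a) 0 ** lin_factor a t - G a t) (at t)"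
proof -
  have "(H a has_vector_derivative rmat (a\<^sup>2 / (a\<^sup>2 - 2)) (a * (2 * t)) 0 1) (at t)"
    unfolding H_def[abs_def] by (intro has_vector_derivative_rmat) (use a_nz b_nz in \<open>auto intro!: derivative_eq_intros\<close>)
  moreover have "rmat (a\<^sup>2 / (a\<^sup>2 - 2)) (a * (2 * t)) 0 1
    = rmat (- 2 * t) (2 / a + 2 * a) (- 2 / a) 0 ** lin_factor a t - G a t"
  proof -
    obtain b p where bp: "a\<^sup>2 - 2 = b" "pp a t = p" and nz: "b \<noteq> 0" "p \<noteq> 0"
      and eq: "a\<^sup>2 = b + 2" "p = - 2 * b * t\<^sup>2 - a\<^sup>2"
      by (rule bp_obtain)
    show ?thesis
      unfolding G_def lin_factor_def rmat_arith bp
    proof (rule rmat_eqI, goal_cases)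
      case 1 show ?case using nz a_nz by (simp add: divide_simps) (simp add: algebra_simps power2_eq_square)
    next
      case 2 show ?case by (simp add: algebra_simps)
    next
      case 3 show ?case by simp
    next
      case 4 show ?case using a_nz by simp
    qed
  qed
  ultimately show ?thesis by simp
qed

lemma has_vector_derivative_G:
  "(G a has_vector_derivative rmat (- 2 * (a\<^sup>2 + 2) / a\<^sup>2) 0 0 0 ** lin_factor a t - lin_factor a t ** F0 a t) (at t)"
proof -
  have "(G a has_vector_derivative rmat (- 2 * (2 * t)) (2 / a + a) (- 2 / a) 0) (at t)"
    unfolding G_def[abs_def] by (intro has_vector_derivative_rmat) (use a_nz b_nz in \<open>auto intro!: derivative_eq_intros\<close>)
  moreover have "rmat (- 2 * (2 * t)) (2 / a + a) (- 2 / a) 0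
    = rmat (- 2 * (a\<^sup>2 + 2) / a\<^sup>2) 0 0 0 ** lin_factor a t - lin_factor a t ** F0 a t"
  proof -
    obtain b p where bp: "a\<^sup>2 - 2 = b" "pp a t = p" and nz: "b \<noteq> 0" "p \<noteq> 0"
      and eq: "a\<^sup>2 = b + 2" "p = - 2 * b * t\<^sup>2 - a\<^sup>2"
      by (rule bp_obtain)
    show ?thesis
      unfolding F0_rmat lin_factor_def rmat_arith bp
    proof (rule rmat_eqI, goal_cases)
      case 1 show ?case using nz a_nz by (simp add: divide_simps) (simp add: algebra_simps power2_eq_square)
    next
      case 2 show ?case using nz a_nz by (simp add: divide_simps) (simp add: algebra_simps power2_eq_square)
    next
      case 3 show ?case using nz a_nz by (simp add: divide_simps) (use eq in algebra)
    next
      case 4 show ?case by simp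
    qed
  qed
  ultimately show ?thesis by simp
qed

lemma D_eq:
  assumes Y: "\<And>t. (Y has_vector_derivative Z t ** lin_factor a t) (at t)"
    and Z: "\<And>t. (Z has_vector_derivative Z' t) (at t)"
  shows "D Y t = Y t ** F0 a t + Z t ** G a t + Z' t ** H a t"
proof -
  have 1: "vector_derivative Y (at s) = Z s ** lin_factor a s" for s
    by (rule vector_derivative_at[OF Y])
  have "((\<lambda>s. Z s ** lin_factor a s) has_vector_derivative Z t ** mat 1 + Z' t ** lin_factor a t) (at t)"
    by (rule has_vector_derivative_cmat2_mult[OF Z has_vector_derivative_lin_factor])
  then have 2: "vector_derivative (\<lambda>s. Z s ** lin_factor a s) (at t) = Z t + Z' t ** lin_factor a t"
    by (simp add: vector_derivative_at)
  have "D Y t = Y t ** F0 a t + Z t ** (lin_factor a t ** F1 a t + F2 a t) + Z' t ** (lin_factor a t ** F2 a t)"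
    unfolding second_order_op_def 1 2 by (simp add: cmat2_distrib matrix_mul_assoc)
  then show ?thesis by (simp add: lin_factor_F1_F2 lin_factor_F2)
qed

text \<open>The derivative of the image is again a left multiple of T, with \<open>?Z\<close> in
  place of \<open>Z\<close>. The cofactors \<open>Gt\<close> and \<open>Ht\<close> grow linearly in
  t, but they multiply derivatives of \<open>Z\<close>, so the index \<open>m\<close> is preserved
  and the operator is triangular.\<close>

lemma exc_space_D:
  assumes "exc_space a m Y"
  shows "exc_space a m (D Y)"
proof -
  obtain Z where Z: "mdeg m Z" "\<And>t. (Y has_vector_derivative Z t ** lin_factor a t) (at t)"
    using assms unfolding exc_space_def by blast
  obtain Z' where Z': "mdeg (m - 1) Z'" "\<And>t. (Z has_vector_derivative Z' t) (at t)"
    using mdeg_derivative[OF Z(1)] by blast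
  obtain Z'' where Z'': "mdeg (m - 1 - 1) Z''" "\<And>t. (Z' has_vector_derivative Z'' t) (at t)"
    using mdeg_derivative[OF Z'(1)] by blast
  define Ft where "Ft = rmat (- 2 * (a\<^sup>2 + 2) / a\<^sup>2) 0 0 0"
  define Gt where "Gt t = rmat (- 2 * t) (2 / a + 2 * a) (- 2 / a) 0" for t
  define Ht where "Ht t = rmat 0 (a * t) 0 1" for t
  let ?Z = "\<lambda>t. Z t ** Ft + Z' t ** Gt t + Z'' t ** Ht t"
  have F0_const: "F0 a t = F0 a 0" for t by (simp add: F0_def)
  have "D Y = (\<lambda>t. Y t ** F0 a 0 + Z t ** G a t + Z' t ** H a t)"
  proof
    fix t
    show "D Y t = Y t ** F0 a 0 + Z t ** G a t + Z' t ** H a t"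
      using D_eq[OF Z(2) Z'(2), of t] by (simp only: F0_const[of t])
  qed
  moreover have "((\<lambda>t. Y t ** F0 a 0 + Z t ** G a t + Z' t ** H a t) has_vector_derivative ?Z t ** lin_factor a t) (at t)" for t
  proof -
    have "((\<lambda>t. Y t ** F0 a 0 + Z t ** G a t + Z' t ** H a t) has_vector_derivative
        (Z t ** lin_factor a t) ** F0 a 0 + (Z t ** (Ft ** lin_factor a t - lin_factor a t ** F0 a t) + Z' t ** G a t)
        + (Z' t ** (Gt t ** lin_factor a t - G a t) + Z'' t ** H a t)) (at t)"
      unfolding Ft_def Gt_def
      by (intro has_vector_derivative_add has_vector_derivative_mult_right has_vector_derivative_cmat2_mult
          has_vector_derivative_G has_vector_derivative_H Z Z' Z'')
    also have "(Z t ** lin_factor a t) ** F0 a 0 + (Z t ** (Ft ** lin_factor a t - lin_factor a t ** F0 a t) + Z' t ** G a t)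
        + (Z' t ** (Gt t ** lin_factor a t - G a t) + Z'' t ** H a t) = ?Z t ** lin_factor a t"
      unfolding H_factor Ht_def[symmetric] F0_const[of t] by (simp add: cmat2_distrib matrix_mul_assoc)
    finally show ?thesis .
  qed
  moreover have "mdeg m ?Z"
  proof -
    have "Gt t = t *\<^sub>R rmat (-2) 0 0 0 + rmat 0 (2 / a + 2 * a) (- 2 / a) 0" for t
      unfolding Gt_def rmat_arith by (rule rmat_eqI) simp_all
    then have Gt: "Z' t ** Gt t = t *\<^sub>R (Z' t ** rmat (-2) 0 0 0)
        + Z' t ** rmat 0 (2 / a + 2 * a) (- 2 / a) 0" for t
      by (simp only: cmat2_distrib)
    have "Ht t = t *\<^sub>R rmat 0 a 0 0 + rmat 0 0 0 1" for t
      unfolding Ht_def rmat_arith by (rule rmat_eqI) simp_all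
    then have Ht: "Z'' t ** Ht t = t *\<^sub>R (Z'' t ** rmat 0 a 0 0) + Z'' t ** rmat 0 0 0 1" for t
      by (simp only: cmat2_distrib)
    have "mdeg m Z'" "mdeg (m - 1) Z''" "mdeg m Z''"
      using mdeg_mono[OF Z'(1)] mdeg_mono[OF Z''(1)] by auto
    then show ?thesis
      unfolding Gt Ht by (intro mdeg_add mdeg_mult_right mdeg_times_t Z Z')
  qed
  ultimately show ?thesis unfolding exc_space_def by (intro exI[of _ ?Z]) simp
qed

lemma pp_lin_factor: "rmat t (a / 2) (- a / (a\<^sup>2 - 2)) t ** lin_factor a t
    = (pp a t * (- 1 / (2 * (a\<^sup>2 - 2)))) *\<^sub>R mat 1"
proof -
  obtain b p where bp: "a\<^sup>2 - 2 = b" "pp a t = p" and nz: "b \<noteq> 0" "p \<noteq> 0"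
    and eq: "a\<^sup>2 = b + 2" "p = - 2 * b * t\<^sup>2 - a\<^sup>2"
    by (rule bp_obtain)
  show ?thesis
    unfolding lin_factor_def rmat_arith bp
    by (rule rmat_eqI) (use nz in \<open>simp_all add: eq(2) field_simps power2_eq_square\<close>)
qed

lemma exc_space_pp_squared_mult:
  assumes "mdeg n R"
  obtains m where "exc_space a m (\<lambda>t. (pp a t)\<^sup>2 *\<^sub>R R t)"
proof -
  obtain R' where R': "mdeg (n - 1) R'" "\<And>t. (R has_vector_derivative R' t) (at t)"
    using mdeg_derivative[OF assms] by blast
  define N where "N t = (-2 * (a\<^sup>2 - 2)) *\<^sub>R rmat t (a / 2) (- a / (a\<^sup>2 - 2)) t" for t
  have N: "N t ** lin_factor a t = pp a t *\<^sub>R mat 1" for t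
  proof -
    have "(-2 * (a\<^sup>2 - 2)) * (pp a t * (- 1 / (2 * (a\<^sup>2 - 2)))) = pp a t"
      using b_nz by (simp add: field_simps)
    then show ?thesis unfolding N_def cmat2_distrib pp_lin_factor scaleR_scaleR by (simp only:)
  qed
  have pp': "(pp a has_real_derivative 4 * (2 - a\<^sup>2) * t) (at t)" for t
    unfolding pp_def[abs_def] by (auto intro!: derivative_eq_intros)
  \<comment> \<open>The constant 8 comes from 2 p' with p' = 4 (2 - a^2) t; the remaining factor p
    of the derivative is rewritten as N T.\<close>
  define Z where "Z t = (t *\<^sub>R ((8 * (2 - a\<^sup>2)) *\<^sub>R R t) + pp a t *\<^sub>R R' t) ** N t" for t
  have "((\<lambda>t. (pp a t)\<^sup>2 *\<^sub>R R t) has_vector_derivative Z t ** lin_factor a t) (at t)" for t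
  proof -
    have "((\<lambda>t. (pp a t)\<^sup>2) has_real_derivative 2 * pp a t * (4 * (2 - a\<^sup>2) * t)) (at t)"
      using pp' by (auto intro!: derivative_eq_intros)
    then have "((\<lambda>t. (pp a t)\<^sup>2 *\<^sub>R R t) has_vector_derivative
        (pp a t)\<^sup>2 *\<^sub>R R' t + (2 * pp a t * (4 * (2 - a\<^sup>2) * t)) *\<^sub>R R t) (at t)"
      by (intro has_vector_derivative_scaleR R')
    also have "(pp a t)\<^sup>2 *\<^sub>R R' t + (2 * pp a t * (4 * (2 - a\<^sup>2) * t)) *\<^sub>R R t = Z t ** lin_factor a t"
      unfolding Z_def matrix_mul_assoc[symmetric] N
      by (simp add: cmat2_distrib scaleR_add_right power2_eq_square mult_ac add.commute)
    finally show ?thesis .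
  qed
  moreover have "\<exists>m. mdeg m Z"
  proof -
    have pp: "pp a t *\<^sub>R X = t ^ 2 *\<^sub>R ((2 * (2 - a\<^sup>2)) *\<^sub>R X) + (- a\<^sup>2) *\<^sub>R X" for t and X :: cmat2
      unfolding pp_def cmat2_eq_iff
      by (simp only: vector_scaleR_component vector_add_component scaleR_conv_of_real)
        (simp add: algebra_simps)
    have "mdeg (n + 2) (\<lambda>t. pp a t *\<^sub>R R' t)"
      unfolding pp using R'(1)
      by (intro mdeg_add mdeg_times_power mdeg_scaleR) (auto intro: mdeg_mono)
    moreover have "mdeg (n + 2) (\<lambda>t. t *\<^sub>R ((8 * (2 - a\<^sup>2)) *\<^sub>R R t))"
      by (intro mdeg_times_t mdeg_scaleR mdeg_mono[OF assms]) auto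
    ultimately have S: "mdeg (n + 2) (\<lambda>t. t *\<^sub>R ((8 * (2 - a\<^sup>2)) *\<^sub>R R t) + pp a t *\<^sub>R R' t)" (is "mdeg _ ?S")
      by (intro mdeg_add)
    have "Z t = t *\<^sub>R (?S t ** ((-2 * (a\<^sup>2 - 2)) *\<^sub>R mat 1))
        + ?S t ** ((-2 * (a\<^sup>2 - 2)) *\<^sub>R rmat 0 (a / 2) (- a / (a\<^sup>2 - 2)) 0)" for t
    proof -
      have "N t = t *\<^sub>R ((-2 * (a\<^sup>2 - 2)) *\<^sub>R mat 1)
          + (-2 * (a\<^sup>2 - 2)) *\<^sub>R rmat 0 (a / 2) (- a / (a\<^sup>2 - 2)) 0"
        unfolding N_def rmat_arith by (rule rmat_eqI) simp_all
      then show ?thesis unfolding Z_def by (simp only: cmat2_distrib)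
    qed
    then have "Z = (\<lambda>t. t *\<^sub>R (?S t ** ((-2 * (a\<^sup>2 - 2)) *\<^sub>R mat 1))
        + ?S t ** ((-2 * (a\<^sup>2 - 2)) *\<^sub>R rmat 0 (a / 2) (- a / (a\<^sup>2 - 2)) 0))"
      by (rule ext)
    moreover have "mdeg (n + 3) \<dots>"
    proof -
      have "n + 3 - 1 = n + 2" by simp
      then have S': "mdeg (n + 3 - 1) ?S" using S by (simp only:)
      have S'': "mdeg (n + 3) ?S" by (rule mdeg_mono[OF S]) simp
      show ?thesis
        by (rule mdeg_add[OF mdeg_times_t[OF mdeg_mult_right[OF S']] mdeg_mult_right[OF S'']])
    qed
    ultimately show ?thesis by blast
  qed
  ultimately show ?thesis using that unfolding exc_space_def by blast
qed

end

section \<open>Symmetry and orthogonalization\<close>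

text \<open>With \<open>W\<^sub>0 = e\<^bsup>t\<^sup>2\<^esup> W\<close>, these are \<open>R\<^sub>0 = F\<^sub>2 W\<^sub>0\<close>, \<open>R\<^sub>1 = e\<^bsup>t\<^sup>2\<^esup> (F\<^sub>2 W)'\<close> and the skew part
  \<open>X\<^sub>0 = F\<^sub>1 W\<^sub>0 - R\<^sub>1\<close>, simplified with \<open>2 t\<^sup>2 + 1 = - (p + 2) / b\<close>. They form the bilinear concomitant
  \<open>f' F\<^sub>2 W g\<^sup>* - f F\<^sub>2 W g'\<^sup>* + f (F\<^sub>1 W - (F\<^sub>2 W)') g\<^sup>*\<close>.\<close>

definition R0 :: "real \<Rightarrow> real \<Rightarrow> cmat2" where
  "R0 a t = rmat (a\<^sup>2 * (pp a t + 2)\<^sup>2 / (4 * (a\<^sup>2 - 2) * (pp a t)\<^sup>2))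
     (a * t * (pp a t + 2) / ((a\<^sup>2 - 2) * (pp a t)\<^sup>2))
     (a * t * (pp a t + 2) / ((a\<^sup>2 - 2) * (pp a t)\<^sup>2))
     (4 * t\<^sup>2 / ((a\<^sup>2 - 2) * (pp a t)\<^sup>2))"

definition R1 :: "real \<Rightarrow> real \<Rightarrow> cmat2" where
  "R1 a t = rmat
     (4 * t * a\<^sup>2 * (pp a t + 2) / (pp a t) ^ 3 - 2 * t * (a\<^sup>2 * (pp a t + 2)\<^sup>2 / (4 * (a\<^sup>2 - 2) * (pp a t)\<^sup>2)))
     (a * (pp a t + 2) / ((a\<^sup>2 - 2) * (pp a t)\<^sup>2) * (1 - 2 * t\<^sup>2) + 4 * t\<^sup>2 * a * (pp a t + 4) / (pp a t) ^ 3)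
     (a * (pp a t + 2) / ((a\<^sup>2 - 2) * (pp a t)\<^sup>2) * (1 - 2 * t\<^sup>2) + 4 * t\<^sup>2 * a * (pp a t + 4) / (pp a t) ^ 3)
     (8 * t / ((a\<^sup>2 - 2) * (pp a t)\<^sup>2) - 8 * t ^ 3 / ((a\<^sup>2 - 2) * (pp a t)\<^sup>2) + 32 * t ^ 3 / (pp a t) ^ 3)"

definition X0 :: "real \<Rightarrow> real \<Rightarrow> cmat2" where
  "X0 a t = rmat 0 (- 1 / (a * pp a t)) (1 / (a * pp a t)) 0"

lemma W0_rmat: "W0 a t = (1 / (pp a t)\<^sup>2) *\<^sub>R rmat
     (a\<^sup>2 / (4 * (a\<^sup>2 - 2)) * (pp a t)\<^sup>2 + pp a t / (a\<^sup>2 - 2) - a\<^sup>2)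
     (a * (pp a t / (a\<^sup>2 - 2) - 2) * t)
     (a * (pp a t / (a\<^sup>2 - 2) - 2) * t)
     (2 * (a\<^sup>2 * (a\<^sup>2 - 2) - pp a t) / (a\<^sup>2 - 2)\<^sup>2)"
  by (simp add: W0_def rmat_def)

lemma adj_W0: "adj (W0 a t) = W0 a t"
  unfolding W0_rmat rmat_arith ..

lemma adj_R0: "adj (R0 a t) = R0 a t" and adj_R1: "adj (R1 a t) = R1 a t"
  unfolding R0_def R1_def rmat_arith by (rule refl)+

lemma adj_X0: "adj (X0 a t) = - X0 a t"
  by (simp add: X0_def rmat_def cmat2_eq_iff)

lemma adj_add: "adj (A + B) = adj A + adj B" and adj_diff: "adj (A - B) = adj A - adj B"
  and adj_scaleR: "adj (r *\<^sub>R A) = r *\<^sub>R adj A" and adj_zero [simp]: "adj 0 = 0"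
  by (simp_all add: cmat2_eq_iff)

lemma pos_def_left_inverse:
  assumes "pos_def A"
  obtains B where "B ** A = mat 1"
proof -
  have "x = 0" if "A *v x = 0" for x
  proof (rule ccontr)
    assume "x \<noteq> 0"
    \<comment> \<open>\<open>quad_form\<close> conjugates its right-hand vector, so testing A x
      against x requires the conjugate of x.\<close>
    define v where "v = (\<chi> i. cnj (x $ i))"
    have "v \<noteq> 0" using \<open>x \<noteq> 0\<close> by (auto simp: v_def vec_eq_iff)
    moreover have "quad_form A v = cnj (x $ 1) * (A *v x) $ 1 + cnj (x $ 2) * (A *v x) $ 2"
      by (simp add: quad_form_cmat2 v_def matrix_vector_mult_def sum_2 algebra_simps)
    then have "quad_form A v = 0" by (simp add: that)
    ultimately show False using assms by (auto simp: pos_def_def)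
  qed
  then have "\<exists>B. B ** A = mat 1"
    unfolding matrix_left_invertible_ker by blast
  then show ?thesis using that by blast
qed

lemma continuous_AE_zero:
  fixes q :: "real \<Rightarrow> real"
  assumes q: "continuous_on UNIV q" and AE: "AE t in lborel. q t = 0"
  shows "q t = 0"
proof (rule ccontr)
  assume "q t \<noteq> 0"
  let ?S = "{t. q t \<noteq> 0}"
  have "open ?S" using q by (intro open_Collect_neq continuous_on_const)
  then have "\<not> negligible ?S" using \<open>q t \<noteq> 0\<close> open_not_negligible by blast
  moreover have "?S \<in> null_sets lborel"
    using AE \<open>open ?S\<close> by (subst AE_iff_null_sets) auto
  then have "?S \<in> null_sets lebesgue"
    by (rule null_sets_completionI)
  ultimately show False by (simp add: negligible_iff_null_sets)
qed

context exceptional_hermite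
begin

text \<open>First symmetry equation: the product is its own adjoint, so F2 W = W F2^*.\<close>

lemma F2_W0: "F2 a t ** W0 a t = R0 a t"
proof -
  obtain b p where bp: "a\<^sup>2 - 2 = b" "pp a t = p" and nz: "b \<noteq> 0" "p \<noteq> 0"
    and eq: "a\<^sup>2 = b + 2" "p = - 2 * b * t\<^sup>2 - a\<^sup>2"
    by (rule bp_obtain)
  show ?thesis
    unfolding F2_rmat W0_rmat R0_def rmat_arith bp
  proof (rule rmat_eqI, goal_cases)
    case 1 show ?case using nz a_nz by (simp add: divide_simps) (use eq in algebra)
  next
    case 2 show ?case using nz a_nz by (simp add: divide_simps) (use eq in algebra)
  next
    case 3 show ?case using nz a_nz by (simp add: divide_simps) (use eq in algebra)
  next
    case 4 show ?case using nz a_nz by (simp add: divide_simps) (use eq in algebra)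
  qed
qed

text \<open>Second symmetry equation: \<open>X0\<close> is skew-adjoint, so adding the adjoint gives
  F1 W + W F1^* = 2 (F2 W)'.\<close>

lemma F1_W0: "F1 a t ** W0 a t = X0 a t + R1 a t"
proof -
  obtain b p where bp: "a\<^sup>2 - 2 = b" "pp a t = p" and nz: "b \<noteq> 0" "p \<noteq> 0"
    and eq: "a\<^sup>2 = b + 2" "p = - 2 * b * t\<^sup>2 - a\<^sup>2"
    by (rule bp_obtain)
  show ?thesis
    unfolding F1_rmat W0_rmat X0_def R1_def rmat_arith bp
  proof (rule rmat_eqI, goal_cases)
    case 1 show ?case using nz a_nz by (simp add: divide_simps) (use eq in algebra)
  next
    case 2 show ?case using nz a_nz by (simp add: divide_simps) (use eq in algebra)
  next
    case 3 show ?case using nz a_nz by (simp add: divide_simps) (use eq in algebra)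
  next
    case 4 show ?case using nz a_nz by (simp add: divide_simps) (use eq in algebra)
  qed
qed

lemma W0_F2: "W0 a t ** adj (F2 a t) = R0 a t"
  using arg_cong[OF F2_W0, of adj] by (simp add: adj_mult adj_W0 adj_R0)

lemma W0_F1: "W0 a t ** adj (F1 a t) = R1 a t - X0 a t"
  using arg_cong[OF F1_W0, of adj] by (simp add: adj_mult adj_W0 adj_R1 adj_X0 adj_add)

lemma DERIV_pp [derivative_intros]: "(pp a has_real_derivative 4 * (2 - a\<^sup>2) * t) (at t)"
  unfolding pp_def[abs_def] by (auto intro!: derivative_eq_intros)

lemma has_vector_derivative_R0:
  "((\<lambda>t. exp (- t\<^sup>2) *\<^sub>R R0 a t) has_vector_derivative exp (- t\<^sup>2) *\<^sub>R R1 a t) (at t)"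
proof -
  obtain b p where bp: "a\<^sup>2 - 2 = b" "pp a t = p" and nz: "b \<noteq> 0" "p \<noteq> 0"
    and eq: "a\<^sup>2 = b + 2" "p = - 2 * b * t\<^sup>2 - a\<^sup>2"
    by (rule bp_obtain)
  have dp: "(pp a has_real_derivative - 4 * b * t) (at t)"
    using DERIV_pp[of t] bp(1) by (simp add: algebra_simps)
  have de: "((\<lambda>t. exp (- t\<^sup>2)) has_real_derivative - 2 * t * exp (- t\<^sup>2)) (at t)"
    by (auto intro!: derivative_eq_intros)
  show ?thesis
    unfolding R0_def R1_def rmat_arith bp(1)
  proof (intro has_vector_derivative_rmat, goal_cases)
    case 1 show ?case
      by (rule derivative_eq_intros dp de refl | (use nz bp in \<open>simp; fail\<close>))+
        (use nz in \<open>simp add: bp(2) field_simps power2_eq_square power3_eq_cube\<close>)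
  next
    case 2 show ?case
      by (rule derivative_eq_intros dp de refl | (use nz bp in \<open>simp; fail\<close>))+
        (use nz in \<open>simp add: bp(2) field_simps power2_eq_square power3_eq_cube\<close>)
  next
    case 3 show ?case
      by (rule derivative_eq_intros dp de refl | (use nz bp in \<open>simp; fail\<close>))+
        (use nz in \<open>simp add: bp(2) field_simps power2_eq_square power3_eq_cube\<close>)
  next
    case 4 show ?case
      by (rule derivative_eq_intros dp de refl | (use nz bp in \<open>simp; fail\<close>))+
        (use nz in \<open>simp add: bp(2) field_simps power2_eq_square power3_eq_cube\<close>)
  qed
qed

text \<open>Third symmetry equation: for X = F1 W - (F2 W)' it reads X' = F0 W - W F0^*, which is
  the familiar (F2 W)'' - (F1 W)' + F0 W = W F0^*.\<close>

lemma has_vector_derivative_X0: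
  "((\<lambda>t. exp (- t\<^sup>2) *\<^sub>R X0 a t) has_vector_derivative
    exp (- t\<^sup>2) *\<^sub>R (F0 a t ** W0 a t - W0 a t ** adj (F0 a t))) (at t)"
proof -
  obtain b p where bp: "a\<^sup>2 - 2 = b" "pp a t = p" and nz: "b \<noteq> 0" "p \<noteq> 0"
    and eq: "a\<^sup>2 = b + 2" "p = - 2 * b * t\<^sup>2 - a\<^sup>2"
    by (rule bp_obtain)
  have f0: "2 - 4 / a\<^sup>2 = 2 * b / a\<^sup>2"
    using a_nz bp(1)[symmetric] by (simp add: field_simps)
  have dp: "(pp a has_real_derivative - 4 * b * t) (at t)"
    using DERIV_pp[of t] bp(1) by (simp add: algebra_simps)
  have de: "((\<lambda>t. exp (- t\<^sup>2)) has_real_derivative - 2 * t * exp (- t\<^sup>2)) (at t)"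
    by (auto intro!: derivative_eq_intros)
  show ?thesis
    unfolding X0_def F0_rmat W0_rmat rmat_arith bp(1) f0
  proof (intro has_vector_derivative_rmat, goal_cases)
    case 1 show ?case by simp
  next
    case 2 show ?case
      by (rule derivative_eq_intros dp de refl | (use nz a_nz bp in \<open>simp; fail\<close>))+
        (use nz a_nz in \<open>simp add: bp(2) field_simps power2_eq_square\<close>)
  next
    case 3 show ?case
      by (rule derivative_eq_intros dp de refl | (use nz a_nz bp in \<open>simp; fail\<close>))+
        (use nz a_nz in \<open>simp add: bp(2) field_simps power2_eq_square\<close>)
  next
    case 4 show ?case by simp
  qed
qed

lemma exp_bounded_rmat:
  assumes "exp_bounded f" "exp_bounded g" "exp_bounded h" "exp_bounded k"
  shows "exp_bounded (\<lambda>t. rmat (f t) (g t) (h t) (k t))"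
  unfolding rmat_def by (intro exp_bounded_intros assms)

lemma exp_bounded_R0: "exp_bounded (R0 a)"
proof -
  have "R0 a = (\<lambda>t. (1 / pp a t ^ 2) *\<^sub>R rmat
     (a\<^sup>2 / (4 * (a\<^sup>2 - 2)) * (pp a t + 2)\<^sup>2) (a / (a\<^sup>2 - 2) * t * (pp a t + 2))
     (a / (a\<^sup>2 - 2) * t * (pp a t + 2)) (4 / (a\<^sup>2 - 2) * t\<^sup>2))"
    unfolding R0_def[abs_def] rmat_arith by (rule ext, rule rmat_eqI) simp_all
  then show ?thesis by (simp only:) (intro exp_bounded_intros exp_bounded_rmat)
qed

lemma exp_bounded_X0: "exp_bounded (X0 a)"
proof -
  have "X0 a = (\<lambda>t. (1 / pp a t) *\<^sub>R rmat 0 (- 1 / a) (1 / a) 0)"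
    unfolding X0_def[abs_def] rmat_arith by (rule ext, rule rmat_eqI) simp_all
  then show ?thesis by (simp only:) (intro exp_bounded_intros)
qed

section \<open>The matrix-valued inner product on continuous functions of exponential growth\<close>

definition nice :: "(real \<Rightarrow> cmat2) \<Rightarrow> bool" where
  "nice f \<longleftrightarrow> continuous_on UNIV f \<and> exp_bounded f"

lemma nice_mdeg: "mdeg n f \<Longrightarrow> nice f"
  by (simp add: nice_def mdeg_continuous_on mdeg_exp_bounded)

lemma nice_exc_space: "exc_space a m f \<Longrightarrow> nice f"
  by (rule nice_mdeg[OF exc_space_mdeg])

lemma nice_measurable: "nice f \<Longrightarrow> f \<in> borel_measurable borel"
  by (simp add: nice_def borel_measurable_continuous_onI)

lemma nice_add: "nice f \<Longrightarrow> nice g \<Longrightarrow> nice (\<lambda>t. f t + g t)"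
  by (auto simp: nice_def intro: continuous_on_add exp_bounded_add)

lemma nice_diff: "nice f \<Longrightarrow> nice g \<Longrightarrow> nice (\<lambda>t. f t - g t)"
  by (auto simp: nice_def intro: continuous_on_diff exp_bounded_diff)

lemma nice_mult_left: "nice f \<Longrightarrow> nice (\<lambda>t. C ** f t)"
  by (auto simp: nice_def intro: continuous_on_cmat2_mult exp_bounded_cmat2_mult exp_bounded_const)

lemma nice_const: "nice (\<lambda>t. C)"
  by (simp add: nice_def exp_bounded_const)

lemma Wn_W0: "Wn a t = exp (- t\<^sup>2) *\<^sub>R ((1 / sqrt pi) *\<^sub>R W0 a t)"
  by (simp add: Wn_def W_eq_W0)

lemma adj_Wn: "adj (Wn a t) = Wn a t"
  by (simp add: Wn_W0 adj_scaleR adj_W0)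

abbreviation "ip \<equiv> matrix_inner (V a \<zeta>)"
abbreviation "\<W> f g \<equiv> \<integral>t. f t ** Wn a t ** adj (g t) \<partial>lborel"

lemma integrable_Wn_mult:
  assumes "nice f" "nice g"
  shows "integrable lborel (\<lambda>t. f t ** Wn a t ** adj (g t))"
proof -
  have [measurable]: "W0 a \<in> borel_measurable borel"
    by (intro borel_measurable_continuous_onI continuous_on_W0)
  note [measurable] = nice_measurable[OF assms(1)] nice_measurable[OF assms(2)]
  have "integrable lborel (\<lambda>t. exp (- t\<^sup>2) *\<^sub>R ((1 / sqrt pi) *\<^sub>R (f t ** W0 a t ** adj (g t))))"
    using assms unfolding nice_def
    by (intro exp_bounded_gauss_integrable exp_bounded_intros exp_bounded_W0) (auto intro: exp_bounded_adj)
  then show ?thesis by (simp add: Wn_W0 cmat2_distrib)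
qed

lemma ip_eq:
  assumes "nice f" "nice g"
  shows "ip f g = \<W> f g + \<zeta> *\<^sub>R (f 0 ** mat22 0 0 0 1 ** adj (g 0))"
proof -
  note [measurable] = nice_measurable[OF assms(1)] nice_measurable[OF assms(2)]
  have "has_bochner_integral \<mu> (\<lambda>t. f t ** \<Phi> t ** adj (g t))
      (\<W> f g + \<zeta> *\<^sub>R (f 0 ** mat22 0 0 0 1 ** adj (g 0)))"
    by (rule trace_density_integral[of "\<lambda>t X. f t ** X ** adj (g t)"])
      (auto intro!: linearI integrable_Wn_mult assms simp: cmat2_distrib)
  then show ?thesis by (simp add: matrix_inner_def has_bochner_integral_iff)
qed

lemma ip_add_left:
  assumes "nice f" "nice g" "nice h"
  shows "ip (\<lambda>t. f t + g t) h = ip f h + ip g h"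
  using assms by (simp add: ip_eq nice_add cmat2_distrib integrable_Wn_mult scaleR_add_right)

lemma ip_mult_left:
  assumes "nice f" "nice h"
  shows "ip (\<lambda>t. C ** f t) h = C ** ip f h"
proof -
  have "\<W> (\<lambda>t. C ** f t) h = C ** \<W> f h"
    using integral_bounded_linear[OF bounded_bilinear.bounded_linear_right[OF bounded_bilinear_cmat2_mult]
        integrable_Wn_mult[OF assms], of C]
    by (simp add: matrix_mul_assoc)
  then show ?thesis using assms by (simp add: ip_eq nice_mult_left cmat2_distrib matrix_mul_assoc)
qed

lemma ip_diff_left:
  assumes "nice f" "nice g" "nice h"
  shows "ip (\<lambda>t. f t - g t) h = ip f h - ip g h"
  using assms by (simp add: ip_eq nice_diff cmat2_distrib integrable_Wn_mult scaleR_diff_right)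

lemma ip_adj:
  assumes "nice f" "nice g"
  shows "ip g f = adj (ip f g)"
proof -
  have "\<W> g f = adj (\<W> f g)"
    using integral_bounded_linear[OF bounded_linear_adj integrable_Wn_mult[OF assms]]
    by (simp add: adj_mult adj_Wn matrix_mul_assoc)
  moreover have "adj (mat22 0 0 0 1) = mat22 0 0 0 1" by (simp add: cmat2_eq_iff)
  ultimately show ?thesis using assms by (simp add: ip_eq adj_add adj_scaleR adj_mult matrix_mul_assoc)
qed

lemma ip_add_right:
  assumes "nice f" "nice g" "nice h"
  shows "ip h (\<lambda>t. f t + g t) = ip h f + ip h g"
  using assms by (simp add: ip_adj[of _ h] nice_add ip_add_left adj_add)

lemma ip_mult_right:
  assumes "nice f" "nice h"
  shows "ip h (\<lambda>t. C ** f t) = ip h f ** adj C"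
  using assms by (simp add: ip_adj[of _ h] nice_mult_left ip_mult_left adj_mult)

lemma D_pointwise:
  assumes "\<And>t. (f has_vector_derivative f' t) (at t)" "\<And>t. (f' has_vector_derivative f'' t) (at t)"
  shows "D f t = f t ** F0 a t + f' t ** F1 a t + f'' t ** F2 a t"
proof -
  have "vector_derivative f (at s) = f' s" for s by (rule vector_derivative_at[OF assms(1)])
  then show ?thesis
    using vector_derivative_at[OF assms(2), of t] by (simp add: second_order_op_def)
qed

lemma D_at_0:
  assumes "exc_space a m f"
  shows "D f 0 ** mat22 0 0 0 1 = 0"
proof -
  obtain f' where f': "mdeg (m + 2 - 1) f'" "\<And>t. (f has_vector_derivative f' t) (at t)"
    using mdeg_derivative[OF exc_space_mdeg[OF assms]] by blast
  obtain f'' where f'': "\<And>t. (f' has_vector_derivative f'' t) (at t)"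
    using mdeg_derivative[OF f'(1)] by blast
  have "F0 a 0 ** mat22 0 0 0 1 = 0" "F1 a 0 ** mat22 0 0 0 1 = 0" "F2 a 0 ** mat22 0 0 0 1 = 0"
    by (simp_all add: F0_def F1_def F2_def cmat2_eq_iff)
  then show ?thesis
    unfolding D_pointwise[OF f'(2) f''] by (simp add: cmat2_distrib matrix_mul_assoc[symmetric])
qed

lemma D_symmetric:
  assumes f: "exc_space a m f" and g: "exc_space a n g"
  shows "ip (D f) g = ip f (D g)"
proof -
  note fm = exc_space_mdeg[OF f] and gm = exc_space_mdeg[OF g]
  obtain f' where f': "mdeg (m + 2 - 1) f'" "\<And>t. (f has_vector_derivative f' t) (at t)"
    using mdeg_derivative[OF fm] by blast
  obtain f'' where f'': "mdeg (m + 2 - 1 - 1) f''" "\<And>t. (f' has_vector_derivative f'' t) (at t)"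
    using mdeg_derivative[OF f'(1)] by blast
  obtain g' where g': "mdeg (n + 2 - 1) g'" "\<And>t. (g has_vector_derivative g' t) (at t)"
    using mdeg_derivative[OF gm] by blast
  obtain g'' where g'': "mdeg (n + 2 - 1 - 1) g''" "\<And>t. (g' has_vector_derivative g'' t) (at t)"
    using mdeg_derivative[OF g'(1)] by blast
  have adj_deriv: "((\<lambda>t. adj (h t)) has_vector_derivative adj h') (at t)"
    if "(h has_vector_derivative h') (at t)" for h h' t
    by (rule bounded_linear.has_vector_derivative[OF bounded_linear_adj that])
  note nf = nice_exc_space[OF f] and ng = nice_exc_space[OF g]
  note nDf = nice_exc_space[OF exc_space_D[OF f]] and nDg = nice_exc_space[OF exc_space_D[OF g]]
  define B where "B t = f' t ** R0 a t ** adj (g t) - f t ** R0 a t ** adj (g' t) + f t ** X0 a t ** adj (g t)" for t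
  define d where "d t = D f t ** W0 a t ** adj (g t) - f t ** W0 a t ** adj (D g t)" for t
  \<comment> \<open>Lagrange's identity. The two terms f' R0 g'^* cancel, and the three symmetry
    equations turn the rest into the difference of the integrands.\<close>
  have "((\<lambda>t. exp (- t\<^sup>2) *\<^sub>R B t) has_vector_derivative exp (- t\<^sup>2) *\<^sub>R d t) (at t)" for t
  proof -
    let ?e = "exp (- t\<^sup>2)"
    have "((\<lambda>t. f' t ** (exp (- t\<^sup>2) *\<^sub>R R0 a t) ** adj (g t) - f t ** (exp (- t\<^sup>2) *\<^sub>R R0 a t) ** adj (g' t)
          + f t ** (exp (- t\<^sup>2) *\<^sub>R X0 a t) ** adj (g t)) has_vector_derivative
        ((f' t ** (?e *\<^sub>R R0 a t)) ** adj (g' t) + (f' t ** (?e *\<^sub>R R1 a t) + f'' t ** (?e *\<^sub>R R0 a t)) ** adj (g t))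
        - ((f t ** (?e *\<^sub>R R0 a t)) ** adj (g'' t) + (f t ** (?e *\<^sub>R R1 a t) + f' t ** (?e *\<^sub>R R0 a t)) ** adj (g' t))
        + ((f t ** (?e *\<^sub>R X0 a t)) ** adj (g' t)
          + (f t ** (?e *\<^sub>R (F0 a t ** W0 a t - W0 a t ** adj (F0 a t))) + f' t ** (?e *\<^sub>R X0 a t)) ** adj (g t))) (at t)"
      by (intro has_vector_derivative_add has_vector_derivative_diff has_vector_derivative_cmat2_mult
          adj_deriv has_vector_derivative_R0 has_vector_derivative_X0 f' f'' g' g'')
    moreover have "((f' t ** (?e *\<^sub>R R0 a t)) ** adj (g' t) + (f' t ** (?e *\<^sub>R R1 a t) + f'' t ** (?e *\<^sub>R R0 a t)) ** adj (g t))
        - ((f t ** (?e *\<^sub>R R0 a t)) ** adj (g'' t) + (f t ** (?e *\<^sub>R R1 a t) + f' t ** (?e *\<^sub>R R0 a t)) ** adj (g' t))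
        + ((f t ** (?e *\<^sub>R X0 a t)) ** adj (g' t)
          + (f t ** (?e *\<^sub>R (F0 a t ** W0 a t - W0 a t ** adj (F0 a t))) + f' t ** (?e *\<^sub>R X0 a t)) ** adj (g t))
        = ?e *\<^sub>R d t"
    proof -
      have Df: "D f t ** W0 a t = f t ** (F0 a t ** W0 a t) + f' t ** (X0 a t + R1 a t) + f'' t ** R0 a t"
        unfolding D_pointwise[OF f'(2) f''(2)] F1_W0[symmetric] F2_W0[symmetric]
        by (simp add: cmat2_distrib matrix_mul_assoc)
      have Dg: "W0 a t ** adj (D g t) = (W0 a t ** adj (F0 a t)) ** adj (g t) + (R1 a t - X0 a t) ** adj (g' t)
          + R0 a t ** adj (g'' t)"
        unfolding D_pointwise[OF g'(2) g''(2)] W0_F1[symmetric] W0_F2[symmetric] adj_add adj_mult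
        by (simp add: cmat2_distrib matrix_mul_assoc)
      have d: "d t = (f t ** (F0 a t ** W0 a t) + f' t ** (X0 a t + R1 a t) + f'' t ** R0 a t) ** adj (g t)
          - f t ** ((W0 a t ** adj (F0 a t)) ** adj (g t) + (R1 a t - X0 a t) ** adj (g' t) + R0 a t ** adj (g'' t))"
        unfolding d_def Df[symmetric] Dg[symmetric] by (simp add: matrix_mul_assoc)
      show ?thesis
        unfolding d by (simp add: cmat2_distrib matrix_mul_assoc algebra_simps)
    qed
    ultimately show ?thesis by (simp add: B_def[abs_def] cmat2_distrib scaleR_add_right scaleR_diff_right)
  qed
  moreover have "continuous_on UNIV d"
    using nf ng nDf nDg unfolding d_def[abs_def] nice_def by (intro continuous_intros continuous_on_W0) auto
  moreover have "exp_bounded B"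
    unfolding B_def[abs_def]
    by (intro exp_bounded_intros exp_bounded_R0 exp_bounded_X0 mdeg_exp_bounded[OF fm] mdeg_exp_bounded[OF gm]
        mdeg_exp_bounded[OF f'(1)] mdeg_exp_bounded[OF g'(1)])
  moreover have "exp_bounded d"
    using nf ng nDf nDg unfolding d_def[abs_def] nice_def
    by (intro exp_bounded_diff exp_bounded_cmat2_mult exp_bounded_adj exp_bounded_W0) auto
  ultimately have "(\<integral>t. exp (- t\<^sup>2) *\<^sub>R d t \<partial>lborel) = 0"
    by (rule integral_derivative_gauss_eq_0)
  moreover have "\<W> (D f) g - \<W> f (D g) = (1 / sqrt pi) *\<^sub>R (\<integral>t. exp (- t\<^sup>2) *\<^sub>R d t \<partial>lborel)"
  proof -
    have "\<W> (D f) g - \<W> f (D g) = (\<integral>t. D f t ** Wn a t ** adj (g t) - f t ** Wn a t ** adj (D g t) \<partial>lborel)"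
      by (intro Bochner_Integration.integral_diff[symmetric] integrable_Wn_mult nf ng nDf nDg)
    also have "\<dots> = (\<integral>t. (1 / sqrt pi) *\<^sub>R (exp (- t\<^sup>2) *\<^sub>R d t) \<partial>lborel)"
      by (intro Bochner_Integration.integral_cong refl)
        (simp add: d_def Wn_W0 cmat2_distrib scaleR_diff_right mult.commute)
    also have "\<dots> = (1 / sqrt pi) *\<^sub>R (\<integral>t. exp (- t\<^sup>2) *\<^sub>R d t \<partial>lborel)"
      by (rule integral_scaleR_right)
    finally show ?thesis .
  qed
  ultimately have W: "\<W> (D f) g = \<W> f (D g)" by simp
  \<comment> \<open>The point mass contributes zero to each side separately, which is why symmetry
    holds for every \<open>\<zeta>\<close>.\<close>
  have "f 0 ** mat22 0 0 0 1 ** adj (D g 0) = f 0 ** adj (D g 0 ** mat22 0 0 0 1)"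
    by (simp add: adj_mult matrix_mul_assoc[symmetric]) (simp add: cmat2_eq_iff)
  then have "f 0 ** mat22 0 0 0 1 ** adj (D g 0) = 0" by (simp add: D_at_0[OF g])
  then show ?thesis
    using W by (simp add: ip_eq nf ng nDf nDg D_at_0[OF f])
qed

text \<open>Definiteness comes from the absolutely continuous part: its density is positive definite
  at every point, and continuity upgrades vanishing almost everywhere to vanishing everywhere. The
  point mass only adds a nonnegative term.\<close>

lemma ip_definite:
  assumes f: "nice f"
  shows "0 \<le> Re (trace (ip f f))" and "Re (trace (ip f f)) = 0 \<Longrightarrow> f t = 0"
proof -
  define q where "q t = Re (trace (f t ** Wn a t ** adj (f t)))" for t
  have q: "q t = Re (quad_form (Wn a t) (f t $ 1)) + Re (quad_form (Wn a t) (f t $ 2))" for t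
    by (simp add: q_def trace_congruence)
  have q_nonneg: "q t \<ge> 0" for t
    unfolding q using pos_semidef_quad(1)[OF pos_def_imp_pos_semidef[OF pos_def_Wn]] by simp
  have int: "integrable lborel q"
    unfolding q_def[abs_def]
    by (rule integrable_bounded_linear[OF bounded_linear_Re_trace integrable_Wn_mult[OF f f]])
  have "Re (trace (\<W> f f)) = (\<integral>t. q t \<partial>lborel)"
    unfolding q_def
    by (rule integral_bounded_linear[OF bounded_linear_Re_trace integrable_Wn_mult[OF f f], symmetric])
  then have eq: "Re (trace (ip f f)) = (\<integral>t. q t \<partial>lborel) + \<zeta> * Re (trace (f 0 ** mat22 0 0 0 1 ** adj (f 0)))"
    unfolding ip_eq[OF f f] by (simp add: trace_cmat2 algebra_simps)
  have delta: "0 \<le> \<zeta> * Re (trace (f 0 ** mat22 0 0 0 1 ** adj (f 0)))"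
    unfolding trace_congruence using pos_semidef_quad(1)[OF pos_semidef_unit] zeta by simp
  have int_nonneg: "0 \<le> (\<integral>t. q t \<partial>lborel)" using q_nonneg by (simp add: integral_nonneg_AE)
  show "0 \<le> Re (trace (ip f f))" using eq delta int_nonneg by simp
  assume "Re (trace (ip f f)) = 0"
  then have "(\<integral>t. q t \<partial>lborel) = 0" using eq delta int_nonneg by simp
  then have "AE t in lborel. q t = 0"
    using int q_nonneg by (subst (asm) integral_nonneg_eq_0_iff_AE) auto
  moreover have "continuous_on UNIV q"
    unfolding q_def[abs_def] trace_cmat2 using f
    by (intro continuous_intros continuous_on_Wn) (auto simp: nice_def)
  ultimately have "q t = 0" using continuous_AE_zero by blast
  then have "Re (quad_form (Wn a t) (f t $ i)) = 0" if "i \<in> {1, 2}" for i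
    using that pos_semidef_quad(1)[OF pos_def_imp_pos_semidef[OF pos_def_Wn[of t]]] unfolding q
    by (smt (verit) empty_iff insert_iff)
  then have "f t $ 1 = 0" "f t $ 2 = 0"
    using pos_def_Wn[of t] unfolding pos_def_def by (metis insertI1 insertI2 less_irrefl)+
  then show "f t = 0" by (simp add: vec_eq_iff forall_2)
qed

lemma ip_pos_def:
  assumes P: "nice P" and inj: "\<And>C :: cmat2. (\<And>t. C ** P t = 0) \<Longrightarrow> C = 0"
  shows "pos_def (ip P P)"
  unfolding pos_def_def
proof (intro allI impI)
  fix v :: "complex ^ 2" assume "v \<noteq> 0"
  \<comment> \<open>Placing v in the first row of an otherwise zero matrix turns the quadratic form
    into the trace of an inner product.\<close>
  define C where "C = mat22 (v $ 1) (v $ 2) 0 0"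
  have "C \<noteq> 0" using \<open>v \<noteq> 0\<close> by (auto simp: C_def cmat2_eq_iff vec_eq_iff forall_2)
  have "ip (\<lambda>t. C ** P t) (\<lambda>t. C ** P t) = C ** ip P P ** adj C"
    using P by (simp add: ip_mult_left ip_mult_right nice_mult_left matrix_mul_assoc)
  moreover have "trace (C ** ip P P ** adj C) = quad_form (ip P P) v"
    by (simp add: trace_cmat2 quad_form_cmat2 C_def algebra_simps)
  ultimately have tr: "Re (trace (ip (\<lambda>t. C ** P t) (\<lambda>t. C ** P t))) = Re (quad_form (ip P P) v)" by simp
  have "Re (quad_form (ip P P) v) \<noteq> 0"
    using ip_definite(2)[OF nice_mult_left[OF P, of C]] inj[of C] \<open>C \<noteq> 0\<close> tr by metis
  then have "Re (quad_form (ip P P) v) > 0"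
    using ip_definite(1)[OF nice_mult_left[OF P, of C]] tr by simp
  moreover have "Im (quad_form (ip P P) v) = 0"
  proof -
    define A where "A = ip P P"
    have "adj A = A" using ip_adj[OF P P] by (simp add: A_def)
    then have "A $ 1 $ 1 = cnj (A $ 1 $ 1)" "A $ 2 $ 2 = cnj (A $ 2 $ 2)" "A $ 2 $ 1 = cnj (A $ 1 $ 2)"
      by (metis adj_nth)+
    then have "Im (A $ 1 $ 1) = 0" "Im (A $ 2 $ 2) = 0" "A $ 2 $ 1 = cnj (A $ 1 $ 2)"
      by (auto simp: complex_eq_iff)
    then have "Im (quad_form A v) = 0"
      by (simp add: quad_form_cmat2 algebra_simps)
    then show ?thesis by (simp add: A_def)
  qed
  ultimately show "Im (quad_form (ip P P) v) = 0 \<and> 0 < Re (quad_form (ip P P) v)" by simp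
qed

lemma monic_injective:
  fixes C :: cmat2
  assumes "mdeg n L" "\<And>t. P t = t ^ n *\<^sub>R mat 1 + L t" "\<And>t. C ** P t = 0"
  shows "C = 0"
proof (rule monomial_mdeg_eq_0)
  show "mdeg n (\<lambda>t. - (C ** L t))" by (intro mdeg_minus mdeg_mult_left assms)
  show "t ^ n *\<^sub>R C = - (C ** L t)" for t
    using assms(3)[of t] unfolding assms(2) by (simp add: cmat2_distrib eq_neg_iff_add_eq_0)
qed

text \<open>Elements of index \<open>m\<close> have degree at most m + 1, so subtracting one leaves
  the leading coefficient I of the basis element untouched.\<close>

lemma monic_exc_basis_minus:
  assumes "exc_space a m g"
  obtains L where "mdeg (m + 2) L" "\<And>t. exc_basis a (m + 2) t - g t = t ^ (m + 2) *\<^sub>R mat 1 + L t"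
proof -
  have "mdeg (m + 2) (\<lambda>t. t ^ (m + 1) *\<^sub>R ((real (m + 2) / (real (m + 2) - 1)) *\<^sub>R rmat 0 (- a / 2) (a / (a\<^sup>2 - 2)) 0) - g t)"
    by (intro mdeg_diff mdeg_monom exc_space_mdeg[OF assms]) auto
  then show ?thesis by (rule that) (simp add: exc_basis_def)
qed

text \<open>Gram-Schmidt over the ring of constant matrices. The function \<open>f\<close> is
  arbitrary because the induction step projects two functions: the given one and the next basis
  element.\<close>

lemma projection_exists:
  assumes "nice f"
  shows "\<exists>g. exc_space a m g \<and> (\<forall>h. exc_space a m h \<longrightarrow> ip (\<lambda>t. f t - g t) h = 0)"
  using assms
proof (induction m arbitrary: f)
  case 0
  let ?I = "\<lambda>t::real. mat 1 :: cmat2"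
  have "pos_def (ip ?I ?I)" by (rule ip_pos_def) (auto simp: nice_const)
  then obtain B where B: "B ** ip ?I ?I = mat 1" by (rule pos_def_left_inverse)
  \<comment> \<open>\<open>B\<close> inverts the Gram matrix from the left; the coefficient must
    stand on the left of the basis element, so \<open>B\<close> is applied on the right.\<close>
  let ?c = "ip f ?I ** B"
  have "ip (\<lambda>t. f t - ?c ** mat 1) ?I = ip f ?I - ip (\<lambda>t. ?c ** mat 1) ?I"
    by (rule ip_diff_left[OF 0 nice_const nice_const])
  also have "ip (\<lambda>t. ?c ** mat 1) ?I = ?c ** ip ?I ?I"
    by (rule ip_mult_left[OF nice_const nice_const])
  also have "ip f ?I - ?c ** ip ?I ?I = 0" by (simp add: matrix_mul_assoc[symmetric] B)
  finally have orth: "ip (\<lambda>t. f t - ?c) ?I = 0" by simp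
  have "ip (\<lambda>t. f t - ?c) h = 0" if h: "exc_space a 0 h" for h
  proof -
    obtain C where "h = (\<lambda>t. C)" using exc_space_0_constant[OF h] by blast
    then have "ip (\<lambda>t. f t - ?c) h = ip (\<lambda>t. f t - ?c) (\<lambda>t. C ** mat 1)" by simp
    also have "\<dots> = ip (\<lambda>t. f t - ?c) ?I ** adj C"
      using 0 by (intro ip_mult_right nice_diff nice_const)
    finally show ?thesis by (simp add: orth)
  qed
  then show ?case using exc_space_const by (intro exI[of _ "\<lambda>t. ?c"]) simp
next
  case (Suc m)
  have nM: "nice (exc_basis a (m + 2))" by (rule nice_exc_space[OF exc_space_exc_basis])
  obtain gM where gM: "exc_space a m gM" "\<And>h. exc_space a m h \<Longrightarrow> ip (\<lambda>t. exc_basis a (m + 2) t - gM t) h = 0"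
    using Suc.IH[OF nM] by blast
  define P where "P t = exc_basis a (m + 2) t - gM t" for t
  have EP: "exc_space a (Suc m) P"
    unfolding P_def[abs_def] by (intro exc_space_diff exc_space_exc_basis exc_space_mono[OF gM(1)]) simp
  note nP = nice_exc_space[OF EP]
  obtain L where L: "mdeg (m + 2) L" "\<And>t. P t = t ^ (m + 2) *\<^sub>R mat 1 + L t"
    using monic_exc_basis_minus[OF gM(1)] unfolding P_def by blast
  have "pos_def (ip P P)" by (rule ip_pos_def[OF nP]) (rule monic_injective[OF L])
  then obtain B where B: "B ** ip P P = mat 1" by (rule pos_def_left_inverse)
  obtain gf where gf: "exc_space a m gf" "\<And>h. exc_space a m h \<Longrightarrow> ip (\<lambda>t. f t - gf t) h = 0"
    using Suc.IH[OF Suc.prems] by blast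
  define r where "r t = f t - gf t" for t
  have nr: "nice r" unfolding r_def[abs_def] by (intro nice_diff Suc.prems nice_exc_space[OF gf(1)])
  let ?c = "ip r P ** B"
  have orth: "ip (\<lambda>t. r t - ?c ** P t) h = ip r h - ?c ** ip P h" if "nice h" for h
    using nr nP that by (simp add: ip_diff_left ip_mult_left nice_mult_left)
  have P: "ip (\<lambda>t. r t - ?c ** P t) P = 0"
    unfolding orth[OF nP] by (simp add: matrix_mul_assoc[symmetric] B)
  have E: "ip (\<lambda>t. r t - ?c ** P t) h = 0" if "exc_space a m h" for h
    unfolding orth[OF nice_exc_space[OF that]] using gM(2)[OF that] gf(2)[OF that] by (simp add: P_def[abs_def] r_def[abs_def])
  have "ip (\<lambda>t. r t - ?c ** P t) h = 0" if h: "exc_space a (Suc m) h" for h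
  proof -
    obtain C where C: "exc_space a m (\<lambda>t. h t - C ** exc_basis a (m + 2) t)" using exc_space_SucE[OF h] by blast
    \<comment> \<open>Replacing the basis element by the orthogonalized P moves the correction
      \<open>C ** gM t\<close> into the part of lower index.\<close>
    define k where "k t = (h t - C ** exc_basis a (m + 2) t) + C ** gM t" for t
    have k: "exc_space a m k" unfolding k_def[abs_def] by (intro exc_space_add C exc_space_mult_left gM)
    have "h = (\<lambda>t. C ** P t + k t)" by (simp add: P_def k_def cmat2_distrib fun_eq_iff)
    then have "ip (\<lambda>t. r t - ?c ** P t) h
        = ip (\<lambda>t. r t - ?c ** P t) P ** adj C + ip (\<lambda>t. r t - ?c ** P t) k"
      using nr nP nice_exc_space[OF k] by (simp add: ip_add_right ip_mult_right nice_diff nice_mult_left)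
    then show ?thesis using P E[OF k] by simp
  qed
  moreover have "(\<lambda>t. r t - ?c ** P t) = (\<lambda>t. f t - (gf t + ?c ** P t))"
    by (simp add: r_def fun_eq_iff)
  moreover have "exc_space a (Suc m) (\<lambda>t. gf t + ?c ** P t)"
    by (intro exc_space_add exc_space_mult_left EP exc_space_mono[OF gf(1)]) simp
  ultimately show ?case by (intro exI[of _ "\<lambda>t. gf t + ?c ** P t"]) simp
qed

lemma exceptional_matrix_polys_exist:
  "\<exists>P. exceptional_matrix_polys (V a \<zeta>) D {1} P"
proof -
  have "\<forall>m. \<exists>g. exc_space a m g \<and> (\<forall>h. exc_space a m h \<longrightarrow> ip (\<lambda>t. exc_basis a (m + 2) t - g t) h = 0)"
    using projection_exists[OF nice_exc_space[OF exc_space_exc_basis]] by blast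
  from choice[OF this] obtain g where
    "\<forall>m. exc_space a m (g m) \<and> (\<forall>h. exc_space a m h \<longrightarrow> ip (\<lambda>t. exc_basis a (m + 2) t - g m t) h = 0)" ..
  then have g: "exc_space a m (g m)" "exc_space a m h \<Longrightarrow> ip (\<lambda>t. exc_basis a (m + 2) t - g m t) h = 0" for m h
    by auto
  \<comment> \<open>For \<open>n = 0\<close> the identity is the right value; at the excluded index
    1 the value is a placeholder.\<close>
  define P where "P n = (if n < 2 then (\<lambda>t. mat 1) else (\<lambda>t. exc_basis a n t - g (n - 2) t))" for n
  have P0: "P 0 = (\<lambda>t. mat 1)" by (simp add: P_def)
  have P2: "P (m + 2) = (\<lambda>t. exc_basis a (m + 2) t - g m t)" for m by (simp add: P_def)
  have cases: "n = 0 \<or> (\<exists>m. n = m + 2)" if "n \<noteq> 1" for n :: nat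
    using that by presburger
  have E_P2: "exc_space a (Suc m) (P (m + 2))" for m
    unfolding P2 by (intro exc_space_diff exc_space_exc_basis exc_space_mono[OF g(1)]) simp
  have orth: "ip (P (m + 2)) h = 0" if "exc_space a m h" for m h
    unfolding P2 by (rule g(2)[OF that])
  \<comment> \<open>Index shift: the polynomial of degree n >= 2 lies in index n - 1, so all
    admissible degrees below m + 2 lie in index m, to which \<open>P (m + 2)\<close> is
    orthogonal.\<close>
  have E_P: "exc_space a m (P n)" if "n \<noteq> 1" "n < m + 2" for m n
    using cases[OF that(1)]
  proof
    assume "n = 0" then show ?thesis by (simp add: P0 exc_space_const)
  next
    assume "\<exists>j. n = j + 2"
    then obtain j where "n = j + 2" ..
    then show ?thesis using exc_space_mono[OF E_P2[of j]] that by simp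
  qed
  have nice_P: "nice (P n)" if "n \<noteq> 1" for n
    using E_P[OF that, of n] by (intro nice_exc_space) auto
  have monic: "\<exists>L. mdeg n L \<and> (\<forall>t. P n t = t ^ n *\<^sub>R mat 1 + L t)" if "n \<noteq> 1" for n
    using cases[OF that]
  proof
    assume "n = 0" then show ?thesis by (intro exI[of _ "\<lambda>t. 0"]) (simp add: P0 mdeg_zero)
  next
    assume "\<exists>j. n = j + 2"
    then obtain j where n: "n = j + 2" ..
    obtain L where "mdeg (j + 2) L" "\<And>t. exc_basis a (j + 2) t - g j t = t ^ (j + 2) *\<^sub>R mat 1 + L t"
      using monic_exc_basis_minus[OF g(1)[of j]] by blast
    then show ?thesis unfolding n P2 by blast
  qed
  have nonsing: "matrix_poly_nonsing n (P n)" if n: "n \<noteq> 1" for n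
  proof -
    obtain L where L: "mdeg n L" "\<And>t. P n t = t ^ n *\<^sub>R mat 1 + L t" using monic[OF n] by blast
    obtain A where A: "\<And>t. L t = (\<Sum>k<n. t ^ k *\<^sub>R A k)" using L(1) unfolding mdeg_def by blast
    define A' where "A' k = (if k = n then mat 1 else A k)" for k
    have "P n t = (\<Sum>k\<le>n. t ^ k *\<^sub>R A' k)" for t
    proof -
      have "(\<Sum>k\<le>n. t ^ k *\<^sub>R A' k) = (\<Sum>k<n. t ^ k *\<^sub>R A' k) + t ^ n *\<^sub>R A' n"
        by (simp add: lessThan_Suc_atMost[symmetric])
      also have "(\<Sum>k<n. t ^ k *\<^sub>R A' k) = (\<Sum>k<n. t ^ k *\<^sub>R A k)"
        by (intro sum.cong) (auto simp: A'_def)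
      finally show ?thesis by (simp add: L(2) A A'_def)
    qed
    moreover have "invertible (A' n)"
      unfolding invertible_def A'_def by (intro exI[of _ "mat 1"]) simp
    ultimately show ?thesis
      unfolding matrix_poly_nonsing_def by (intro exI[of _ A'] conjI ext)
  qed
  have ip_lt: "ip (P n) (P k) = 0" if n: "n \<noteq> 1" and k: "k \<noteq> 1" "k < n" for n k
  proof -
    obtain m where m: "n = m + 2" using cases[OF n] k(2) by auto
    show ?thesis unfolding m using k m by (intro orth E_P) auto
  qed
  have ip_ne: "ip (P n) (P k) = 0" if "n \<noteq> 1" "k \<noteq> 1" "n \<noteq> k" for n k
  proof (cases "k < n")
    case False
    then have "ip (P k) (P n) = 0" using that by (intro ip_lt) auto
    then show ?thesis using ip_adj[OF nice_P[OF that(2)] nice_P[OF that(1)]] by simp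
  qed (use that ip_lt in simp)
  have pd: "pos_def (ip (P n) (P n))" if n: "n \<noteq> 1" for n
  proof -
    obtain L where L: "mdeg n L" "\<And>t. P n t = t ^ n *\<^sub>R mat 1 + L t" using monic[OF n] by blast
    show ?thesis by (rule ip_pos_def[OF nice_P[OF n]]) (rule monic_injective[OF L])
  qed
  have decomp: "\<exists>C k. exc_space a m k \<and> h = (\<lambda>t. C ** P (m + 2) t + k t)" if h: "exc_space a (Suc m) h" for m h
  proof -
    obtain C where C: "exc_space a m (\<lambda>t. h t - C ** exc_basis a (m + 2) t)" using exc_space_SucE[OF h] by blast
    let ?k = "\<lambda>t. (h t - C ** exc_basis a (m + 2) t) + C ** g m t"
    have "exc_space a m ?k" by (intro exc_space_add C exc_space_mult_left g)
    moreover have "h t = C ** P (m + 2) t + ?k t" for t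
      unfolding P2 cmat2_distrib by simp
    ultimately show ?thesis by blast
  qed
  have span: "\<exists>C. \<forall>t. h t = (\<Sum>n\<in>{n. n < m + 2 \<and> n \<noteq> 1}. C n ** P n t)" if "exc_space a m h" for m h
    using that
  proof (induction m arbitrary: h)
    case 0
    obtain C where "h = (\<lambda>t. C)" using exc_space_0_constant[OF 0] by blast
    moreover have "{n. n < 0 + 2 \<and> n \<noteq> 1} = {0 :: nat}" by auto
    ultimately show ?case by (intro exI[of _ "\<lambda>_. C"]) (simp add: P0)
  next
    case (Suc m)
    obtain C k where k: "exc_space a m k" "h = (\<lambda>t. C ** P (m + 2) t + k t)" using decomp[OF Suc.prems] by blast
    obtain C1 where C1: "\<And>t. k t = (\<Sum>n\<in>{n. n < m + 2 \<and> n \<noteq> 1}. C1 n ** P n t)"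
      using Suc.IH[OF k(1)] by blast
    define C2 where "C2 n = (if n = m + 2 then C else C1 n)" for n
    have S: "{n. n < Suc m + 2 \<and> n \<noteq> 1} = insert (m + 2) {n. n < m + 2 \<and> n \<noteq> 1}" by auto
    have fin: "finite {n. n < m + 2 \<and> n \<noteq> (1 :: nat)}" by simp
    have "h t = (\<Sum>n\<in>{n. n < Suc m + 2 \<and> n \<noteq> 1}. C2 n ** P n t)" for t
    proof -
      have "(\<Sum>n\<in>{n. n < m + 2 \<and> n \<noteq> 1}. C2 n ** P n t) = k t"
        unfolding C1 by (intro sum.cong) (auto simp: C2_def)
      then show ?thesis
        unfolding S by (subst sum.insert[OF fin]) (simp_all add: k(2) C2_def)
    qed
    then show ?case by blast
  qed
  have dense: "\<exists>S C. finite S \<and> S \<inter> {1} = {} \<and>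
      L2_norm_sq (V a \<zeta>) (\<lambda>t. f t - (\<Sum>n\<in>S. C n ** P n t)) < ennreal e"
    if "in_L2 (V a \<zeta>) f" "e > 0" for f e
  proof -
    obtain n R where R: "mdeg n R" "L2_norm_sq (V a \<zeta>) (\<lambda>t. f t - (pp a t)\<^sup>2 *\<^sub>R R t) < ennreal e"
      using polynomial_multiples_dense_L2[OF \<open>in_L2 (V a \<zeta>) f\<close> \<open>e > 0\<close>] by blast
    obtain m where m: "exc_space a m (\<lambda>t. (pp a t)\<^sup>2 *\<^sub>R R t)" using exc_space_pp_squared_mult[OF R(1)] by blast
    obtain C where C: "\<And>t. (pp a t)\<^sup>2 *\<^sub>R R t = (\<Sum>n\<in>{n. n < m + 2 \<and> n \<noteq> 1}. C n ** P n t)"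
      using span[OF m] by blast
    show ?thesis
      using R(2) unfolding C
      by (intro exI[of _ "{n. n < m + 2 \<and> n \<noteq> 1}"] exI[of _ C]) auto
  qed
  \<comment> \<open>Triangularity gives D P_n = C P_n + k with k of lower index. By symmetry the
    inner product of D P_n with k is that of P_n with D k, which is zero since D k also has lower
    index. As P_n is orthogonal to k, the inner product of k with itself vanishes, so k = 0.\<close>
  have eigen: "\<exists>\<Gamma>. \<forall>t. D (P n) t = \<Gamma> ** P n t" if n: "n \<noteq> 1" for n
    using cases[OF n]
  proof
    assume "n = 0"
    have "D (\<lambda>t. mat 1) t = F0 a t" for t
      using D_pointwise[of "\<lambda>t. mat 1" "\<lambda>t. 0" "\<lambda>t. 0" t] by simp
    then show ?thesis
      using \<open>n = 0\<close> by (intro exI[of _ "F0 a 0"]) (simp add: P0 F0_def)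
  next
    assume "\<exists>j. n = j + 2"
    then obtain m where n: "n = m + 2" ..
    obtain C k where k: "exc_space a m k" "D (P n) = (\<lambda>t. C ** P (m + 2) t + k t)"
      using decomp[OF exc_space_D[OF E_P2[of m]]] unfolding n by blast
    have nP: "nice (P (m + 2))" by (rule nice_exc_space[OF E_P2])
    have "ip (D (P (m + 2))) k = ip (P (m + 2)) (D k)" by (rule D_symmetric[OF E_P2 k(1)])
    also have "\<dots> = 0" by (rule orth[OF exc_space_D[OF k(1)]])
    finally have "ip (\<lambda>t. C ** P (m + 2) t + k t) k = 0" using k(2) n by simp
    then have "ip k k = 0"
      using nP nice_exc_space[OF k(1)] orth[OF k(1)] by (simp add: ip_add_left ip_mult_left nice_mult_left)
    then have "k t = 0" for t
      using ip_definite(2)[OF nice_exc_space[OF k(1)]] by (simp add: trace_cmat2)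
    then show ?thesis using k(2) n by auto
  qed
  have "\<exists>\<Gamma>. \<forall>n. n \<noteq> 1 \<longrightarrow> (\<forall>t. D (P n) t = \<Gamma> n ** P n t)"
    using eigen by (intro choice) blast
  then have "exceptional_matrix_polys (V a \<zeta>) D {1} P"
    unfolding exceptional_matrix_polys_def
    using weight_matrix_V nonsing ip_ne pd dense by (intro conjI allI impI) auto
  then show ?thesis by blast
qed

end

theorem mainTheorem6:
  fixes a \<zeta> :: real
  assumes "a\<^sup>2 > 2" and "\<zeta> \<ge> 0"
  shows "\<exists>P :: nat \<Rightarrow> real \<Rightarrow> complex ^ 2 ^ 2.
    exceptional_matrix_polys (V a \<zeta>) (second_order_op (F2 a) (F1 a) (F0 a)) {1} P"
proof -
  interpret exceptional_hermite a \<zeta> by unfold_locales (fact assms)+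
  show ?thesis by (rule exceptional_matrix_polys_exist)
qed

end
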